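(* Let $f\colon M^2\to(N^3,g)$ be a front and $p\in M^2$ a non-degenerate peak of $f$. Then the singular curvature diverges to $-\infty$ at $p$; that is, $\kappa_s(q)\to-\infty$ as $q\to p$ along the cuspidal edges of the singular curve through $p$.
   Context: All objects are $C^\infty$. $M^2$ is an oriented $2$-manifold and $(N^3,g)$ an oriented Riemannian $3$-manifold with Levi-Civita connection $D$ and volume form $\mu_g$. A smooth map $f\colon M^2\to N^3$ is a front if there is a unit vector field $\nu$ of $N^3$ along $f$ with $g(f_*X,\nu)=0$ for all $X\in TM^2$ and such that $(f,\nu)\colon M^2\to T_1N^3$ is an immersion. In local coordinates $(u,v)$ compatible with the orientation of $M^2$, $\lambda=\mu_g(f_u,f_v,\nu)$ is the signed area density function. A singular point is a point where $f$ is not an immersion ($\lambda=0$); it is non-degenerate if $d\lambda\ne0$ there, in which case the singular set nearby is a regular curve (the singular curve). The kernel of $f_*$ at a non-degenerate singular point is a line (null direction, spanned by null vectors). A cuspidal edge is a singular point at which $f$ is locally diffeomorphic (by diffeomorphism germs of source and target) to $(u,v)\mapsto(u^2,u^3,v)$ at $(0,0)$; there the null direction is transversal to the singular curve $\gamma(t)$, and the singular curvature is $$\kappa_s=\mathrm{sgn}(d\lambda(\eta))\,\mu_g(\hat\gamma',\hat\gamma'',\nu)/|\hat\gamma'|^3,$$ where $\hat\gamma=f\circ\gamma$, $\hat\gamma''=D_t\hat\gamma'$ and $\eta$ is a null vector field along $\gamma$ with $(\gamma',\eta)$ positively oriented. A singular point $p$ which is not a cuspidal edge is a peak if there is a coordinate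 neighborhood $U$ of $p$ such that: (i) all singular points in $U\setminus\{p\}$ are cuspidal edges; (ii) $f_*\colon T_pM^2\to T_{f(p)}N^3$ has rank $1$; (iii) the singular set in $U$ consists of finitely many regular $C^1$-curves starting at $p$. A non-degenerate peak is a peak which is a non-degenerate singular point. *)

theory Defs
  imports "HOL-Analysis.Analysis"
begin

section \<open>Smooth maps between open subsets of Euclidean spaces\<close>

text \<open>Only used for open \<open>S\<close>. In finite dimension, continuity of all directional
  derivatives is continuity of the Frechet derivative, so this is the usual class \<open>C^k\<close>.\<close>

primrec Ck_on :: "nat \<Rightarrow> 'a::euclidean_space set \<Rightarrow> ('a \<Rightarrow> 'b::real_normed_vector) \<Rightarrow> bool" where
  "Ck_on 0 S F \<longleftrightarrow> continuous_on S F"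
| "Ck_on (Suc k) S F \<longleftrightarrow>
     F differentiable_on S \<and> (\<forall>v. Ck_on k S (\<lambda>x. frechet_derivative F (at x) v))"

definition smooth_on :: "'a::euclidean_space set \<Rightarrow> ('a \<Rightarrow> 'b::real_normed_vector) \<Rightarrow> bool" where
  "smooth_on S F \<longleftrightarrow> (\<forall>k. Ck_on k S F)"


section \<open>Manifolds\<close>

text \<open>A manifold is given by an atlas on an open subset (\<open>carrier\<close>) of a Hausdorff, second
  countable topological space. A chart is a pair of its domain and its coordinate map.\<close>

type_synonym ('m, 'n) chart = "'m set \<times> ('m \<Rightarrow> real ^ 'n)"

abbreviation chart_dom :: "('m, 'n) chart \<Rightarrow> 'm set" where
  "chart_dom c \<equiv> fst c"

abbreviation coord :: "('m, 'n) chart \<Rightarrow> 'm \<Rightarrow> real ^ 'n" where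
  "coord c \<equiv> snd c"

definition cinv :: "('m, 'n) chart \<Rightarrow> real ^ 'n \<Rightarrow> 'm" where
  "cinv c = inv_into (chart_dom c) (coord c)"

definition is_chart :: "('m::topological_space, 'n::finite) chart \<Rightarrow> bool" where
  "is_chart c \<longleftrightarrow> open (chart_dom c) \<and> open (coord c ` chart_dom c) \<and>
     homeomorphism (chart_dom c) (coord c ` chart_dom c) (coord c) (cinv c)"

definition transition :: "('m, 'n) chart \<Rightarrow> ('m, 'n) chart \<Rightarrow> real ^ 'n \<Rightarrow> real ^ 'n" where
  "transition c d = coord d \<circ> cinv c"

definition smoothly_compatible :: "('m, 'n::finite) chart \<Rightarrow> ('m, 'n) chart \<Rightarrow> bool" where
  "smoothly_compatible c d \<longleftrightarrow>
     smooth_on (coord c ` (chart_dom c \<inter> chart_dom d)) (transition c d) \<and>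
     smooth_on (coord d ` (chart_dom c \<inter> chart_dom d)) (transition d c)"

definition carrier :: "('m, 'n) chart set \<Rightarrow> 'm set" where
  "carrier A = (\<Union>c\<in>A. chart_dom c)"

definition oriented_manifold ::
    "('m::{t2_space,second_countable_topology}, 'n::finite) chart set \<Rightarrow> bool" where
  "oriented_manifold A \<longleftrightarrow>
     (\<forall>c\<in>A. is_chart c) \<and>
     (\<forall>c\<in>A. \<forall>d\<in>A. smoothly_compatible c d \<and>
        (\<forall>q\<in>chart_dom c \<inter> chart_dom d.
           det (matrix (frechet_derivative (transition c d) (at (coord c q)))) > 0))"

text \<open>Charts of the smooth structure, i.e. diffeomorphisms from an open subset of the manifold
  onto an open subset of Euclidean space (not necessarily orientation preserving).\<close>

definition smooth_chart ::
    "('m::topological_space, 'n::finite) chart set \<Rightarrow> ('m, 'n) chart \<Rightarrow> bool" where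
  "smooth_chart A c \<longleftrightarrow> is_chart c \<and> chart_dom c \<subseteq> carrier A \<and> (\<forall>d\<in>A. smoothly_compatible c d)"

definition local_rep ::
    "('m, 'a) chart \<Rightarrow> ('n, 'b) chart \<Rightarrow> ('m \<Rightarrow> 'n) \<Rightarrow> real ^ 'a \<Rightarrow> real ^ 'b" where
  "local_rep c d f = coord d \<circ> f \<circ> cinv c"

definition smooth_map ::
    "('m::topological_space, 'a::finite) chart set \<Rightarrow> ('n::topological_space, 'b::finite) chart set
     \<Rightarrow> ('m \<Rightarrow> 'n) \<Rightarrow> bool" where
  "smooth_map A B f \<longleftrightarrow> continuous_on (carrier A) f \<and> f ` carrier A \<subseteq> carrier B \<and>
     (\<forall>c\<in>A. \<forall>d\<in>B. smooth_on (coord c ` (chart_dom c \<inter> f -` chart_dom d)) (local_rep c d f))"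


section \<open>Riemannian metric, Levi-Civita connection, volume form\<close>

text \<open>Tensors and connections are families of components, one for each chart of the atlas,
  subject to the transformation law under change of charts. \<open>g d y\<close> is the matrix of
  the metric at the point \<open>y\<close> with respect to the coordinate basis of the chart \<open>d\<close>.\<close>

type_synonym 'n metric_comp = "('n, 3) chart \<Rightarrow> 'n \<Rightarrow> real ^ 3 ^ 3"
type_synonym 'n connection_comp = "('n, 3) chart \<Rightarrow> 'n \<Rightarrow> real ^ 3 \<Rightarrow> real ^ 3 \<Rightarrow> real ^ 3"

definition metric ::
    "'n metric_comp \<Rightarrow> ('n, 3) chart \<Rightarrow> 'n \<Rightarrow> real ^ 3 \<Rightarrow> real ^ 3 \<Rightarrow> real" where
  "metric g d y X Y = X \<bullet> (g d y *v Y)"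

definition riemannian_metric :: "('n, 3) chart set \<Rightarrow> 'n metric_comp \<Rightarrow> bool" where
  "riemannian_metric B g \<longleftrightarrow>
     (\<forall>d\<in>B. smooth_on (coord d ` chart_dom d) (\<lambda>x. g d (cinv d x)) \<and>
        (\<forall>y\<in>chart_dom d. (\<forall>X Y. metric g d y X Y = metric g d y Y X) \<and>
           (\<forall>X. X \<noteq> 0 \<longrightarrow> metric g d y X X > 0))) \<and>
     (\<forall>d\<in>B. \<forall>e\<in>B. \<forall>y\<in>chart_dom d \<inter> chart_dom e.
        let J = frechet_derivative (transition d e) (at (coord d y))
        in \<forall>X Y. metric g e y (J X) (J Y) = metric g d y X Y)"

text \<open>In the chart \<open>d\<close>, the covariant derivative of a vector field \<open>Y\<close> in direction \<open>X\<close>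
  is the ordinary directional derivative of the components of \<open>Y\<close> plus \<open>\<Gamma> d y X Y\<close>.\<close>

definition affine_connection :: "('n, 3) chart set \<Rightarrow> 'n connection_comp \<Rightarrow> bool" where
  "affine_connection B \<Gamma> \<longleftrightarrow>
     (\<forall>d\<in>B. (\<forall>X Y. smooth_on (coord d ` chart_dom d) (\<lambda>x. \<Gamma> d (cinv d x) X Y)) \<and>
        (\<forall>y\<in>chart_dom d. bilinear (\<Gamma> d y))) \<and>
     (\<forall>d\<in>B. \<forall>e\<in>B. \<forall>y\<in>chart_dom d \<inter> chart_dom e.
        let J = (\<lambda>x. frechet_derivative (transition d e) (at x)); x = coord d y
        in \<forall>X Y. J x (\<Gamma> d y X Y) =
             frechet_derivative (\<lambda>x'. J x' Y) (at x) X + \<Gamma> e y (J x X) (J x Y))"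

definition torsion_free :: "('n, 3) chart set \<Rightarrow> 'n connection_comp \<Rightarrow> bool" where
  "torsion_free B \<Gamma> \<longleftrightarrow> (\<forall>d\<in>B. \<forall>y\<in>chart_dom d. \<forall>X Y. \<Gamma> d y X Y = \<Gamma> d y Y X)"

definition metric_connection ::
    "('n, 3) chart set \<Rightarrow> 'n metric_comp \<Rightarrow> 'n connection_comp \<Rightarrow> bool" where
  "metric_connection B g \<Gamma> \<longleftrightarrow> (\<forall>d\<in>B. \<forall>y\<in>chart_dom d. \<forall>X Y Z.
     frechet_derivative (\<lambda>x. metric g d (cinv d x) Y Z) (at (coord d y)) X =
       metric g d y (\<Gamma> d y X Y) Z + metric g d y Y (\<Gamma> d y X Z))"

definition levi_civita ::
    "('n, 3) chart set \<Rightarrow> 'n metric_comp \<Rightarrow> 'n connection_comp \<Rightarrow> bool" where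
  "levi_civita B g \<Gamma> \<longleftrightarrow>
     affine_connection B \<Gamma> \<and> torsion_free B \<Gamma> \<and> metric_connection B g \<Gamma>"

text \<open>The components with respect to \<open>d\<close> of the covariant derivative, at time \<open>t\<close>, of a vector
  field along the curve \<open>\<sigma>\<close> whose components are \<open>X\<close>.\<close>

definition covariant_deriv ::
    "'n connection_comp \<Rightarrow> ('n, 3) chart \<Rightarrow> (real \<Rightarrow> 'n) \<Rightarrow> (real \<Rightarrow> real ^ 3) \<Rightarrow> real \<Rightarrow> real ^ 3" where
  "covariant_deriv \<Gamma> d \<sigma> X t =
     vector_derivative X (at t) + \<Gamma> d (\<sigma> t) (vector_derivative (coord d \<circ> \<sigma>) (at t)) (X t)"

definition volume_form ::
    "'n metric_comp \<Rightarrow> ('n, 3) chart \<Rightarrow> 'n \<Rightarrow> real ^ 3 \<Rightarrow> real ^ 3 \<Rightarrow> real ^ 3 \<Rightarrow> real" where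
  "volume_form g d y X Y Z = sqrt (det (g d y)) * det (vector [X, Y, Z] :: real ^ 3 ^ 3)"


section \<open>Fronts\<close>

text \<open>A vector field along \<open>f\<close> is again a family of components, one for each chart of the target.\<close>

type_synonym ('m, 'n) field_along = "('n, 3) chart \<Rightarrow> 'm \<Rightarrow> real ^ 3"

definition smooth_field_along ::
    "('m, 2) chart set \<Rightarrow> ('n, 3) chart set \<Rightarrow> ('m \<Rightarrow> 'n) \<Rightarrow> ('m, 'n) field_along \<Rightarrow> bool" where
  "smooth_field_along A B f \<nu> \<longleftrightarrow>
     (\<forall>c\<in>A. \<forall>d\<in>B. smooth_on (coord c ` (chart_dom c \<inter> f -` chart_dom d)) (\<nu> d \<circ> cinv c)) \<and>
     (\<forall>d\<in>B. \<forall>e\<in>B. \<forall>q\<in>carrier A. f q \<in> chart_dom d \<inter> chart_dom e \<longrightarrow>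
        \<nu> e q = frechet_derivative (transition d e) (at (coord d (f q))) (\<nu> d q))"

text \<open>The unit tangent bundle is a submanifold of the tangent bundle, whose charts are
  given by the coordinates of the base point together with the components of the vector;
  the last clause is the injectivity of the differential of \<open>(f, \<nu>)\<close> in such a chart.\<close>

definition front ::
    "('m::topological_space, 2) chart set \<Rightarrow> ('n::topological_space, 3) chart set \<Rightarrow>
     'n metric_comp \<Rightarrow> ('m \<Rightarrow> 'n) \<Rightarrow> ('m, 'n) field_along \<Rightarrow> bool" where
  "front A B g f \<nu> \<longleftrightarrow> smooth_map A B f \<and> smooth_field_along A B f \<nu> \<and>
     (\<forall>c\<in>A. \<forall>d\<in>B. \<forall>q\<in>chart_dom c. f q \<in> chart_dom d \<longrightarrow>
        metric g d (f q) (\<nu> d q) (\<nu> d q) = 1 \<and>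
        (\<forall>X. metric g d (f q) (frechet_derivative (local_rep c d f) (at (coord c q)) X) (\<nu> d q) = 0) \<and>
        inj (frechet_derivative (\<lambda>x. (local_rep c d f x, \<nu> d (cinv c x))) (at (coord c q))))"

definition area_density ::
    "'n metric_comp \<Rightarrow> ('m \<Rightarrow> 'n) \<Rightarrow> ('m, 'n) field_along \<Rightarrow> ('m, 2) chart \<Rightarrow> ('n, 3) chart
     \<Rightarrow> real ^ 2 \<Rightarrow> real" where
  "area_density g f \<nu> c d x =
     (let df = frechet_derivative (local_rep c d f) (at x); q = cinv c x
      in volume_form g d (f q) (df (axis 1 1)) (df (axis 2 1)) (\<nu> d q))"

text \<open>The following pointwise notions do not depend on the charts, hence \<open>\<exists>\<close> may be read as \<open>\<forall>\<close>.\<close>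

definition singular_set ::
    "('m, 2) chart set \<Rightarrow> ('n, 3) chart set \<Rightarrow> ('m \<Rightarrow> 'n) \<Rightarrow> 'm set" where
  "singular_set A B f = {q. \<exists>c\<in>A. \<exists>d\<in>B. q \<in> chart_dom c \<and> f q \<in> chart_dom d \<and>
     \<not> inj (frechet_derivative (local_rep c d f) (at (coord c q)))}"

definition non_degenerate ::
    "('m, 2) chart set \<Rightarrow> ('n, 3) chart set \<Rightarrow> 'n metric_comp \<Rightarrow> ('m \<Rightarrow> 'n) \<Rightarrow>
     ('m, 'n) field_along \<Rightarrow> 'm \<Rightarrow> bool" where
  "non_degenerate A B g f \<nu> q \<longleftrightarrow> q \<in> singular_set A B f \<and>
     (\<exists>c\<in>A. \<exists>d\<in>B. q \<in> chart_dom c \<and> f q \<in> chart_dom d \<and>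
        frechet_derivative (area_density g f \<nu> c d) (at (coord c q)) \<noteq> (\<lambda>_. 0))"

definition rank_at ::
    "('m, 2) chart set \<Rightarrow> ('n, 3) chart set \<Rightarrow> ('m \<Rightarrow> 'n) \<Rightarrow> 'm \<Rightarrow> nat \<Rightarrow> bool" where
  "rank_at A B f q r \<longleftrightarrow> (\<exists>c\<in>A. \<exists>d\<in>B. q \<in> chart_dom c \<and> f q \<in> chart_dom d \<and>
     dim (range (frechet_derivative (local_rep c d f) (at (coord c q)))) = r)"

definition cuspidal_edge ::
    "('m::topological_space, 2) chart set \<Rightarrow> ('n::topological_space, 3) chart set \<Rightarrow>
     ('m \<Rightarrow> 'n) \<Rightarrow> 'm \<Rightarrow> bool" where
  "cuspidal_edge A B f q \<longleftrightarrow>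
     (\<exists>\<Phi> \<Psi>. smooth_chart A \<Phi> \<and> smooth_chart B \<Psi> \<and>
        q \<in> chart_dom \<Phi> \<and> coord \<Phi> q = 0 \<and> f q \<in> chart_dom \<Psi> \<and> coord \<Psi> (f q) = 0 \<and> f ` chart_dom \<Phi> \<subseteq> chart_dom \<Psi> \<and>
        (\<forall>x\<in>chart_dom \<Phi>. coord \<Psi> (f x) =
           vector [(coord \<Phi> x $ 1)^2, (coord \<Phi> x $ 1)^3, coord \<Phi> x $ 2]))"


section \<open>Singular curvature\<close>

text \<open>\<open>\<gamma>\<close> is a regular parametrization, with \<open>\<gamma> 0 = q\<close>, of the singular set near \<open>q\<close>;
  \<open>c\<close> and \<open>d\<close> are charts containing \<open>\<gamma>\<close> and \<open>f \<circ> \<gamma>\<close>.\<close>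

definition singular_curve ::
    "('m::topological_space, 2) chart set \<Rightarrow> ('n, 3) chart set \<Rightarrow> ('m \<Rightarrow> 'n) \<Rightarrow>
     ('m, 2) chart \<Rightarrow> ('n, 3) chart \<Rightarrow> 'm \<Rightarrow> real \<Rightarrow> (real \<Rightarrow> 'm) \<Rightarrow> bool" where
  "singular_curve A B f c d q \<epsilon> \<gamma> \<longleftrightarrow>
     \<epsilon> > 0 \<and> \<gamma> 0 = q \<and> inj_on \<gamma> {-\<epsilon><..<\<epsilon>} \<and>
     \<gamma> ` {-\<epsilon><..<\<epsilon>} \<subseteq> chart_dom c \<and> f ` \<gamma> ` {-\<epsilon><..<\<epsilon>} \<subseteq> chart_dom d \<and>
     smooth_on {-\<epsilon><..<\<epsilon>} (coord c \<circ> \<gamma>) \<and>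
     (\<forall>t\<in>{-\<epsilon><..<\<epsilon>}. vector_derivative (coord c \<circ> \<gamma>) (at t) \<noteq> 0) \<and>
     (\<exists>W. open W \<and> q \<in> W \<and> W \<inter> singular_set A B f = \<gamma> ` {-\<epsilon><..<\<epsilon>})"

text \<open>A null vector field along \<open>\<gamma>\<close>, by its components in \<open>c\<close>, such that \<open>(\<gamma>', \<eta>)\<close> is
  positively oriented (in particular \<open>\<eta>\<close> has no zeros).\<close>

definition null_field ::
    "('m \<Rightarrow> 'n) \<Rightarrow> ('m, 2) chart \<Rightarrow> ('n, 3) chart \<Rightarrow> real \<Rightarrow> (real \<Rightarrow> 'm) \<Rightarrow>
     (real \<Rightarrow> real ^ 2) \<Rightarrow> bool" where
  "null_field f c d \<epsilon> \<gamma> \<eta> \<longleftrightarrow> smooth_on {-\<epsilon><..<\<epsilon>} \<eta> \<and>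
     (\<forall>t\<in>{-\<epsilon><..<\<epsilon>}.
        frechet_derivative (local_rep c d f) (at (coord c (\<gamma> t))) (\<eta> t) = 0 \<and>
        det (vector [vector_derivative (coord c \<circ> \<gamma>) (at t), \<eta> t] :: real ^ 2 ^ 2) > 0)"

definition singular_curvature_formula ::
    "'n metric_comp \<Rightarrow> 'n connection_comp \<Rightarrow> ('m \<Rightarrow> 'n) \<Rightarrow> ('m, 'n) field_along \<Rightarrow>
     ('m, 2) chart \<Rightarrow> ('n, 3) chart \<Rightarrow> (real \<Rightarrow> 'm) \<Rightarrow> (real \<Rightarrow> real ^ 2) \<Rightarrow> real \<Rightarrow> real" where
  "singular_curvature_formula g \<Gamma> f \<nu> c d \<gamma> \<eta> t =
     (let \<sigma> = f \<circ> \<gamma>;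
          \<sigma>' = (\<lambda>s. vector_derivative (coord d \<circ> \<sigma>) (at s));
          \<sigma>'' = covariant_deriv \<Gamma> d \<sigma> \<sigma>'
      in sgn (frechet_derivative (area_density g f \<nu> c d) (at (coord c (\<gamma> t))) (\<eta> t)) *
         volume_form g d (\<sigma> t) (\<sigma>' t) (\<sigma>'' t) (\<nu> d (\<gamma> t)) /
         sqrt (metric g d (\<sigma> t) (\<sigma>' t) (\<sigma>' t)) ^ 3)"

text \<open>At a cuspidal edge \<open>q\<close> the value does not depend on the choices of \<open>c\<close>, \<open>d\<close>, \<open>\<gamma>\<close>, \<open>\<eta>\<close>.\<close>

definition singular_curvature ::
    "('m::topological_space, 2) chart set \<Rightarrow> ('n, 3) chart set \<Rightarrow> 'n metric_comp \<Rightarrow>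
     'n connection_comp \<Rightarrow> ('m \<Rightarrow> 'n) \<Rightarrow> ('m, 'n) field_along \<Rightarrow> 'm \<Rightarrow> real" where
  "singular_curvature A B g \<Gamma> f \<nu> q =
     (THE k. \<exists>c\<in>A. \<exists>d\<in>B. \<exists>\<epsilon> \<gamma> \<eta>.
        singular_curve A B f c d q \<epsilon> \<gamma> \<and> null_field f c d \<epsilon> \<gamma> \<eta> \<and>
        k = singular_curvature_formula g \<Gamma> f \<nu> c d \<gamma> \<eta> 0)"


section \<open>Peaks\<close>

text \<open>A regular \<open>C^1\<close> curve starting at \<open>p\<close>, in the coordinates of \<open>c\<close>; the derivative at the
  initial point is one-sided.\<close>

definition regular_C1_curve_from :: "('m, 2) chart \<Rightarrow> 'm \<Rightarrow> (real \<Rightarrow> 'm) \<Rightarrow> bool" where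
  "regular_C1_curve_from c p \<sigma> \<longleftrightarrow> \<sigma> 0 = p \<and> \<sigma> ` {0..<1} \<subseteq> chart_dom c \<and>
     (\<exists>\<sigma>'. continuous_on {0..<1} \<sigma>' \<and>
        (\<forall>t\<in>{0..<1}. \<sigma>' t \<noteq> 0 \<and>
           ((coord c \<circ> \<sigma>) has_vector_derivative \<sigma>' t) (at t within {0..<1})))"

definition peak ::
    "('m::topological_space, 2) chart set \<Rightarrow> ('n::topological_space, 3) chart set \<Rightarrow>
     ('m \<Rightarrow> 'n) \<Rightarrow> 'm \<Rightarrow> bool" where
  "peak A B f p \<longleftrightarrow> p \<in> singular_set A B f \<and> \<not> cuspidal_edge A B f p \<and>
     (\<exists>c. smooth_chart A c \<and> p \<in> chart_dom c \<and>
        (\<forall>q\<in>chart_dom c \<inter> singular_set A B f - {p}. cuspidal_edge A B f q) \<and>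
        rank_at A B f p 1 \<and>
        (\<exists>S. finite S \<and> (\<forall>\<sigma>\<in>S. regular_C1_curve_from c p \<sigma>) \<and>
           chart_dom c \<inter> singular_set A B f = {p} \<union> (\<Union>\<sigma>\<in>S. \<sigma> ` {0..<1})))"

definition non_degenerate_peak ::
    "('m::topological_space, 2) chart set \<Rightarrow> ('n::topological_space, 3) chart set \<Rightarrow>
     'n metric_comp \<Rightarrow> ('m \<Rightarrow> 'n) \<Rightarrow> ('m, 'n) field_along \<Rightarrow> 'm \<Rightarrow> bool" where
  "non_degenerate_peak A B g f \<nu> p \<longleftrightarrow> peak A B f p \<and> non_degenerate A B g f \<nu> p"

end

theory Submission
  imports Defs "HOL-Library.Nat_Bijection"
begin

text \<open>Let \<open>T\<close> be the gradient of the area density, rotated so as to be tangent to the singular curve, and let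
  \<open>e\<close> span the image of \<open>df\<close> along that curve, so that \<open>df v = \<omega>(v) e\<close> there for a covector field \<open>\<omega>\<close>. The
  singular curvature at a cuspidal edge is then a positive multiple of \<open>\<mu>(e, D\<^sub>T e, \<nu>) / \<bar>\<omega>(T)\<bar>\<close>. If \<open>T\<close> is null
  at \<open>p\<close>, the denominator tends to 0, and by symmetry of second derivatives the numerator tends to
  \<open>- (d\<lambda>(X))\<^sup>2\<close>, where \<open>df X = e\<close>; this is negative because \<open>X\<close> is transversal to \<open>T\<close>. If \<open>T\<close> were not
  null at \<open>p\<close>, then \<open>p\<close> would be a cuspidal edge: in coordinates in which the singular curve is
  \<open>s = 0\<close> and the null direction is \<open>\<partial>\<^sub>s\<close>, separating even and odd parts in \<open>s\<close> and applying Whitney's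
  theorem gives \<open>f(s, v) = A(s\<^sup>2, v) + s\<^sup>3 B(s\<^sup>2, v)\<close>, and the front condition makes
  \<open>(x, y, z) \<mapsto> A(x, z) + y B(x, z)\<close> a local diffeomorphism.\<close>

section \<open>Calculus of smooth maps\<close>

text \<open>Two features of the definitions shape the proof. A cuspidal edge is defined by the
  existence of a normal form, so exploiting that \<open>p\<close> is not one requires a criterion
  that constructs the diffeomorphisms; this is what the extension theorem for even functions is for.
  And the singular curvature is a definite description over all charts, curves and null fields, so
  its value at a nearby cuspidal edge is accessible only once existence and independence of these
  choices are proved. The formula with T and e is preferred to a parametrization of the singular
  curve because each of its ingredients is continuous on an open neighbourhood of \<open>p\<close>:
  e is normalized so that one fixed coordinate of it is 1, which is possible because nondegeneracy
  excludes df = 0 at \<open>p\<close>. The limit is then that of a quotient of continuous functions,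
  in whatever way the cuspidal edges approach \<open>p\<close>. The connection term disappears in
  the limit, since it carries the factor \<omega>(T).\<close>

lemma Ck_on_subset: "Ck_on k S F \<Longrightarrow> T \<subseteq> S \<Longrightarrow> Ck_on k T F"
  by (induction k arbitrary: F) (auto intro: continuous_on_subset differentiable_on_subset)

text \<open>Openness matters: \<open>frechet_derivative\<close> at a point of \<open>S\<close> sees
  the values in a full neighbourhood, which must lie inside \<open>S\<close> for the two functions
  to agree there.\<close>

lemma Ck_on_cong:
  assumes "open S" "\<And>x. x \<in> S \<Longrightarrow> F x = G x" "Ck_on k S F"
  shows "Ck_on k S G"
  using assms(2,3)
proof (induction k arbitrary: F G)
  case 0
  then show ?case by (simp cong: continuous_on_cong)
next
  case (Suc k)
  have dF: "F differentiable at x" if "x \<in> S" for x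
    using Suc.prems(2) that assms(1) by (auto simp: differentiable_on_eq_differentiable_at)
  have eq: "frechet_derivative F (at x) = frechet_derivative G (at x)" if "x \<in> S" for x
    by (rule frechet_derivative_transform_within_open[OF dF[OF that] assms(1) that])
       (rule Suc.prems(1))
  have "G differentiable_on S"
    using Suc.prems(2) by (auto simp: differentiable_on_def Suc.prems(1)
        intro: differentiable_transform_within[where d=1])
  moreover have "Ck_on k S (\<lambda>x. frechet_derivative G (at x) v)" for v
    by (rule Suc.IH[of "\<lambda>x. frechet_derivative F (at x) v"]) (use eq Suc.prems(2) in auto)
  ultimately show ?case by simp
qed

text \<open>Allows the derivative to be given by an explicit family \<open>F'\<close>; most of the
  closure lemmas below are inductions on \<open>k\<close> through this rule.\<close>

lemma Ck_on_SucI: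
  assumes "open S" "\<And>x. x \<in> S \<Longrightarrow> (F has_derivative F' x) (at x)" "\<And>v. Ck_on k S (\<lambda>x. F' x v)"
  shows "Ck_on (Suc k) S F"
proof -
  have "F' x = frechet_derivative F (at x)" if "x \<in> S" for x
    using assms(2)[OF that] by (rule frechet_derivative_at)
  then have "Ck_on k S (\<lambda>x. frechet_derivative F (at x) v)" for v
    using Ck_on_cong[OF assms(1) _ assms(3)[of v]] by simp
  moreover have "F differentiable_on S"
    using assms(1,2) differentiable_on_eq_differentiable_at differentiable_def by blast
  ultimately show ?thesis by simp
qed

lemma Ck_on_SucD:
  assumes "open S" "Ck_on (Suc k) S F" "x \<in> S"
  shows "(F has_derivative frechet_derivative F (at x)) (at x)"
  using assms by (auto simp: differentiable_on_eq_differentiable_at frechet_derivative_works[symmetric])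

lemma Ck_on_Suc_imp: "open S \<Longrightarrow> Ck_on (Suc k) S F \<Longrightarrow> Ck_on k S F"
proof (induction k arbitrary: F)
  case 0
  then show ?case by (simp add: differentiable_imp_continuous_on)
next
  case (Suc k)
  then show ?case by (metis Ck_on.simps(2))
qed

lemma Ck_on_linear_comp:
  assumes "open S" "bounded_linear L" "Ck_on k S F"
  shows "Ck_on k S (\<lambda>x. L (F x))"
  using assms(3)
proof (induction k arbitrary: F)
  case 0
  then show ?case using bounded_linear.continuous_on[OF assms(2)] by simp
next
  case (Suc k)
  show ?case
  proof (rule Ck_on_SucI[OF assms(1)])
    show "((\<lambda>x. L (F x)) has_derivative (\<lambda>v. L (frechet_derivative F (at x) v))) (at x)" if "x \<in> S" for x
      using bounded_linear.has_derivative[OF assms(2) Ck_on_SucD[OF assms(1) Suc.prems that]] .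
  qed (use Suc in auto)
qed

lemma Ck_on_const: "open S \<Longrightarrow> Ck_on k S (\<lambda>x. c)"
proof (induction k arbitrary: c)
  case (Suc k)
  then show ?case by (intro Ck_on_SucI[where F'="\<lambda>_ _. 0"]) auto
qed simp

lemma Ck_on_linear: "open S \<Longrightarrow> bounded_linear L \<Longrightarrow> Ck_on k S L"
proof (cases k)
  case 0
  then show "bounded_linear L \<Longrightarrow> ?thesis" by (simp add: linear_continuous_on)
next
  case (Suc j)
  assume "open S" "bounded_linear L"
  then show ?thesis unfolding Suc
    by (intro Ck_on_SucI[where F'="\<lambda>_. L"] Ck_on_const) (auto simp: bounded_linear_imp_has_derivative)
qed

lemma Ck_on_add:
  assumes "open S" "Ck_on k S F" "Ck_on k S G"
  shows "Ck_on k S (\<lambda>x. F x + G x)"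
  using assms(2,3)
proof (induction k arbitrary: F G)
  case (Suc k)
  show ?case
  proof (rule Ck_on_SucI[OF assms(1)])
    show "((\<lambda>x. F x + G x) has_derivative
        (\<lambda>v. frechet_derivative F (at x) v + frechet_derivative G (at x) v)) (at x)" if "x \<in> S" for x
      by (intro has_derivative_add Ck_on_SucD[OF assms(1) Suc.prems(1)] Ck_on_SucD[OF assms(1) Suc.prems(2)] that)
    show "Ck_on k S (\<lambda>x. frechet_derivative F (at x) v + frechet_derivative G (at x) v)" for v
      by (rule Suc.IH) (use Suc.prems in simp_all)
  qed
qed (auto intro: continuous_intros)

lemma Ck_on_sum:
  "open S \<Longrightarrow> (\<And>i. i \<in> I \<Longrightarrow> Ck_on k S (F i)) \<Longrightarrow> Ck_on k S (\<lambda>x. \<Sum>i\<in>I. F i x)"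
  by (induction I rule: infinite_finite_induct) (auto intro: Ck_on_const Ck_on_add)

lemma Ck_on_bilinear:
  assumes "open S" "bounded_bilinear B" "Ck_on k S F" "Ck_on k S G"
  shows "Ck_on k S (\<lambda>x. B (F x) (G x))"
  using assms(3,4)
proof (induction k arbitrary: F G)
  case 0
  then show ?case using bounded_bilinear.continuous_on[OF assms(2)] by simp
next
  case (Suc k)
  show ?case
  proof (rule Ck_on_SucI[OF assms(1)])
    show "((\<lambda>x. B (F x) (G x)) has_derivative
        (\<lambda>v. B (F x) (frechet_derivative G (at x) v) + B (frechet_derivative F (at x) v) (G x))) (at x)"
      if "x \<in> S" for x
      by (intro bounded_bilinear.FDERIV[OF assms(2)] Ck_on_SucD[OF assms(1) Suc.prems(1)] Ck_on_SucD[OF assms(1) Suc.prems(2)] that)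
    show "Ck_on k S (\<lambda>x. B (F x) (frechet_derivative G (at x) v) + B (frechet_derivative F (at x) v) (G x))" for v
    proof (intro Ck_on_add[OF assms(1)] Suc.IH)
      show "Ck_on k S F" "Ck_on k S G"
        using Suc.prems Ck_on_Suc_imp[OF assms(1)] by blast+
    qed (use Suc.prems in simp_all)
  qed
qed

text \<open>The chain rule evaluates the derivative of \<open>G\<close> in a direction that moves
  with \<open>x\<close>, while \<open>Ck_on\<close> speaks of fixed directions only. Expanding the
  moving direction in the basis reduces this to products of functions covered by the induction
  hypothesis.\<close>

lemma Ck_on_compose:
  fixes F :: "'a::euclidean_space \<Rightarrow> 'b::euclidean_space" and G :: "'b \<Rightarrow> 'c::real_normed_vector"
  assumes "open S" "open T" "Ck_on k T G" "Ck_on k S F" "F ` S \<subseteq> T"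
  shows "Ck_on k S (\<lambda>x. G (F x))"
  using assms(3,4)
proof (induction k arbitrary: G)
  case 0
  then show ?case using assms(5) continuous_on_compose2 by fastforce
next
  case (Suc k)
  let ?DG = "\<lambda>y. frechet_derivative G (at y)" and ?DF = "\<lambda>x. frechet_derivative F (at x)"
  have DG: "(G has_derivative ?DG (F x)) (at (F x))" if "x \<in> S" for x
    using Ck_on_SucD[OF assms(2) Suc.prems(1)] assms(5) that by blast
  have lin: "?DG (F x) w = (\<Sum>b\<in>Basis. (w \<bullet> b) *\<^sub>R ?DG (F x) b)" if "x \<in> S" for x w
  proof -
    interpret linear "?DG (F x)" using DG[OF that] by (rule has_derivative_linear)
    show ?thesis by (subst euclidean_representation[of w, symmetric]) (simp only: sum scale)
  qed
  show ?case
  proof (rule Ck_on_SucI[OF assms(1)])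
    fix x assume x: "x \<in> S"
    show "((\<lambda>x. G (F x)) has_derivative (\<lambda>v. ?DG (F x) (?DF x v))) (at x)"
      using has_derivative_compose[OF Ck_on_SucD[OF assms(1) Suc.prems(2) x] DG[OF x]] .
  next
    fix v
    have "Ck_on k S (\<lambda>x. \<Sum>b\<in>Basis. (?DF x v \<bullet> b) *\<^sub>R ?DG (F x) b)"
    proof (intro Ck_on_sum[OF assms(1)] Ck_on_bilinear[OF assms(1) bounded_bilinear_scaleR])
      fix b
      show "Ck_on k S (\<lambda>x. ?DF x v \<bullet> b)"
        using Suc.prems(2) by (intro Ck_on_linear_comp[OF assms(1) bounded_linear_inner_left]) auto
      show "Ck_on k S (\<lambda>x. ?DG (F x) b)"
        using Suc.prems(1) by (intro Suc.IH Ck_on_Suc_imp[OF assms(1) Suc.prems(2)]) auto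
    qed
    then show "Ck_on k S (\<lambda>x. ?DG (F x) (?DF x v))"
      by (rule Ck_on_cong[OF assms(1), rotated]) (metis lin)
  qed
qed

text \<open>The derivative of 1/F is a polynomial in 1/F and the derivative of \<open>F\<close>, so
  each order of regularity of 1/F gives the next.\<close>

lemma Ck_on_inverse:
  fixes F :: "'a::euclidean_space \<Rightarrow> real"
  assumes "open S" "Ck_on k S F" "\<And>x. x \<in> S \<Longrightarrow> F x \<noteq> 0"
  shows "Ck_on k S (\<lambda>x. inverse (F x))"
  using assms(2)
proof (induction k)
  case 0
  then show ?case using assms(3) by (auto intro: continuous_on_inverse)
next
  case (Suc k)
  note mult = Ck_on_bilinear[OF assms(1) bounded_bilinear_mult]
  have IH: "Ck_on k S (\<lambda>x. inverse (F x))" using Suc Ck_on_Suc_imp[OF assms(1)] by blast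
  show ?case
  proof (rule Ck_on_SucI[OF assms(1)])
    fix x assume "x \<in> S"
    then show "((\<lambda>x. inverse (F x)) has_derivative
        (\<lambda>v. (- 1) * (inverse (F x) * frechet_derivative F (at x) v * inverse (F x)))) (at x)"
      using Deriv.has_derivative_inverse[OF assms(3) Ck_on_SucD[OF assms(1) Suc.prems]] by simp
  next
    fix v
    show "Ck_on k S (\<lambda>x. (- 1) * (inverse (F x) * frechet_derivative F (at x) v * inverse (F x)))"
      by (intro mult IH Ck_on_const assms) (use Suc.prems in auto)
  qed
qed

section \<open>Smooth maps and their closure properties\<close>

lemma smooth_onD: "smooth_on S F \<Longrightarrow> Ck_on k S F" by (simp add: smooth_on_def)

lemma smooth_on_subset: "smooth_on S F \<Longrightarrow> T \<subseteq> S \<Longrightarrow> smooth_on T F"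
  by (auto simp: smooth_on_def intro: Ck_on_subset)

lemma smooth_on_cong: "open S \<Longrightarrow> smooth_on S F \<Longrightarrow> (\<And>x. x \<in> S \<Longrightarrow> F x = G x) \<Longrightarrow> smooth_on S G"
  unfolding smooth_on_def by (metis Ck_on_cong)

lemma smooth_on_frechet: "smooth_on S F \<Longrightarrow> smooth_on S (\<lambda>x. frechet_derivative F (at x) v)"
  unfolding smooth_on_def by (metis Ck_on.simps(2))

lemma smooth_on_continuous: "smooth_on S F \<Longrightarrow> continuous_on S F"
  using smooth_onD[of S F 0] by simp

lemma smooth_on_has_derivative:
  "open S \<Longrightarrow> smooth_on S F \<Longrightarrow> x \<in> S \<Longrightarrow> (F has_derivative frechet_derivative F (at x)) (at x)"
  using Ck_on_SucD smooth_onD by blast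

lemma smooth_on_differentiable: "open S \<Longrightarrow> smooth_on S F \<Longrightarrow> x \<in> S \<Longrightarrow> F differentiable at x"
  using smooth_on_has_derivative differentiable_def by blast

lemma smooth_on_const: "open S \<Longrightarrow> smooth_on S (\<lambda>x. c)"
  by (simp add: smooth_on_def Ck_on_const)

lemma smooth_on_linear: "open S \<Longrightarrow> bounded_linear L \<Longrightarrow> smooth_on S L"
  by (simp add: smooth_on_def Ck_on_linear)

lemma smooth_on_ident: "open S \<Longrightarrow> smooth_on S (\<lambda>x. x)"
  by (simp add: smooth_on_linear)

lemma smooth_on_linear_comp: "open S \<Longrightarrow> bounded_linear L \<Longrightarrow> smooth_on S F \<Longrightarrow> smooth_on S (\<lambda>x. L (F x))"
  by (simp add: smooth_on_def Ck_on_linear_comp)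

lemma smooth_on_add: "open S \<Longrightarrow> smooth_on S F \<Longrightarrow> smooth_on S G \<Longrightarrow> smooth_on S (\<lambda>x. F x + G x)"
  by (simp add: smooth_on_def Ck_on_add)

lemma smooth_on_minus: "open S \<Longrightarrow> smooth_on S F \<Longrightarrow> smooth_on S (\<lambda>x. - F x)"
  using smooth_on_linear_comp[OF _ bounded_linear_minus[OF bounded_linear_ident]] by blast

lemma smooth_on_sum:
  "open S \<Longrightarrow> (\<And>i. i \<in> I \<Longrightarrow> smooth_on S (F i)) \<Longrightarrow> smooth_on S (\<lambda>x. \<Sum>i\<in>I. F i x)"
  by (simp add: smooth_on_def Ck_on_sum)

lemma smooth_on_bilinear:
  "open S \<Longrightarrow> bounded_bilinear B \<Longrightarrow> smooth_on S F \<Longrightarrow> smooth_on S G \<Longrightarrow> smooth_on S (\<lambda>x. B (F x) (G x))"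
  by (simp add: smooth_on_def Ck_on_bilinear)

lemma smooth_on_mult:
  fixes F G :: "'a::euclidean_space \<Rightarrow> real"
  shows "open S \<Longrightarrow> smooth_on S F \<Longrightarrow> smooth_on S G \<Longrightarrow> smooth_on S (\<lambda>x. F x * G x)"
  by (rule smooth_on_bilinear[OF _ bounded_bilinear_mult])

lemmas smooth_on_scaleR = smooth_on_bilinear[OF _ bounded_bilinear_scaleR]
lemmas smooth_on_inner = smooth_on_bilinear[OF _ bounded_bilinear_inner]

lemma smooth_on_prod:
  fixes F :: "'i \<Rightarrow> 'a::euclidean_space \<Rightarrow> real"
  shows "open S \<Longrightarrow> (\<And>i. i \<in> I \<Longrightarrow> smooth_on S (F i)) \<Longrightarrow> smooth_on S (\<lambda>x. \<Prod>i\<in>I. F i x)"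
  by (induction I rule: infinite_finite_induct) (auto intro: smooth_on_const smooth_on_mult)

lemma smooth_on_power:
  fixes F :: "'a::euclidean_space \<Rightarrow> real"
  shows "open S \<Longrightarrow> smooth_on S F \<Longrightarrow> smooth_on S (\<lambda>x. F x ^ n)"
  by (induction n) (auto intro: smooth_on_const smooth_on_mult)

lemma smooth_on_inverse:
  fixes F :: "'a::euclidean_space \<Rightarrow> real"
  shows "open S \<Longrightarrow> smooth_on S F \<Longrightarrow> (\<And>x. x \<in> S \<Longrightarrow> F x \<noteq> 0) \<Longrightarrow> smooth_on S (\<lambda>x. inverse (F x))"
  by (simp add: smooth_on_def Ck_on_inverse)

lemma smooth_on_compose:
  fixes F :: "'a::euclidean_space \<Rightarrow> 'b::euclidean_space" and G :: "'b \<Rightarrow> 'c::real_normed_vector"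
  assumes "open S" "open T" "smooth_on T G" "smooth_on S F" "F ` S \<subseteq> T"
  shows "smooth_on S (\<lambda>x. G (F x))"
  unfolding smooth_on_def
  by (intro allI Ck_on_compose[OF assms(1,2) smooth_onD[OF assms(3)] smooth_onD[OF assms(4)] assms(5)])

lemma smooth_on_vec_nth: "open S \<Longrightarrow> smooth_on S F \<Longrightarrow> smooth_on S (\<lambda>x. F x $ i)"
  by (rule smooth_on_linear_comp[OF _ bounded_linear_vec_nth])

lemma Ck_on_vec:
  fixes F :: "'a::euclidean_space \<Rightarrow> 'b::euclidean_space ^ 'n"
  assumes S: "open S" and "\<And>i. Ck_on k S (\<lambda>x. F x $ i)"
  shows "Ck_on k S F"
proof -
  have bl: "bounded_linear (axis i :: 'b \<Rightarrow> 'b ^ 'n)" for i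
    unfolding linear_conv_bounded_linear[symmetric]
    by (rule linearI) (simp_all add: axis_def vec_eq_iff)
  have eq: "y = (\<Sum>i\<in>UNIV. axis i (y $ i))" for y :: "'b ^ 'n"
    by (simp add: vec_eq_iff sum.delta axis_def)
  have "Ck_on k S (\<lambda>x. \<Sum>i\<in>UNIV. axis i (F x $ i))"
    by (intro Ck_on_sum[OF S] Ck_on_linear_comp[OF S bl] assms(2))
  then show ?thesis using eq[symmetric] by simp
qed

lemma smooth_on_vec:
  fixes F :: "'a::euclidean_space \<Rightarrow> 'b::euclidean_space ^ 'n"
  shows "open S \<Longrightarrow> (\<And>i. smooth_on S (\<lambda>x. F x $ i)) \<Longrightarrow> smooth_on S F"
  by (simp add: smooth_on_def Ck_on_vec)

lemma smooth_on_Pair: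
  assumes "open S" "smooth_on S F" "smooth_on S G"
  shows "smooth_on S (\<lambda>x. (F x, G x))"
proof -
  have "smooth_on S (\<lambda>x. (F x, 0) + (0, G x))"
    using assms
    by (intro smooth_on_add smooth_on_linear_comp[where L="\<lambda>y. (y, 0)"] smooth_on_linear_comp[where L="\<lambda>y. (0, y)"])
       (auto intro!: bounded_linear_Pair bounded_linear_ident bounded_linear_zero)
  then show ?thesis by simp
qed

lemma smooth_on_det:
  fixes F :: "'a::euclidean_space \<Rightarrow> real ^ 'n ^ 'n"
  assumes "open S" "\<And>i j. smooth_on S (\<lambda>x. F x $ i $ j)"
  shows "smooth_on S (\<lambda>x. det (F x))"
  unfolding det_def
  by (intro smooth_on_sum smooth_on_mult smooth_on_const smooth_on_prod assms)

lemma smooth_on_vector2: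
  fixes f1 f2 :: "'a::euclidean_space \<Rightarrow> 'b::euclidean_space"
  assumes "open S" "smooth_on S f1" "smooth_on S f2"
  shows "smooth_on S (\<lambda>x. vector [f1 x, f2 x] :: 'b ^ 2)"
proof (rule smooth_on_vec[OF assms(1)])
  fix i :: 2
  show "smooth_on S (\<lambda>x. (vector [f1 x, f2 x] :: 'b ^ 2) $ i)"
    using assms exhaust_2[of i] by auto
qed

lemma smooth_on_vector3:
  fixes f1 f2 f3 :: "'a::euclidean_space \<Rightarrow> 'b::euclidean_space"
  assumes "open S" "smooth_on S f1" "smooth_on S f2" "smooth_on S f3"
  shows "smooth_on S (\<lambda>x. vector [f1 x, f2 x, f3 x] :: 'b ^ 3)"
proof (rule smooth_on_vec[OF assms(1)])
  fix i :: 3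
  show "smooth_on S (\<lambda>x. (vector [f1 x, f2 x, f3 x] :: 'b ^ 3) $ i)"
    using assms exhaust_3[of i] by auto
qed

lemma smooth_on_det2:
  fixes f1 f2 :: "'a::euclidean_space \<Rightarrow> real ^ 2"
  shows "open S \<Longrightarrow> smooth_on S f1 \<Longrightarrow> smooth_on S f2 \<Longrightarrow> smooth_on S (\<lambda>x. det (vector [f1 x, f2 x] :: real ^ 2 ^ 2))"
  by (intro smooth_on_det smooth_on_vec_nth smooth_on_vector2)

lemma smooth_on_det3:
  fixes f1 f2 f3 :: "'a::euclidean_space \<Rightarrow> real ^ 3"
  shows "open S \<Longrightarrow> smooth_on S f1 \<Longrightarrow> smooth_on S f2 \<Longrightarrow> smooth_on S f3
    \<Longrightarrow> smooth_on S (\<lambda>x. det (vector [f1 x, f2 x, f3 x] :: real ^ 3 ^ 3))"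
  by (intro smooth_on_det smooth_on_vec_nth smooth_on_vector3)

lemma smooth_on_matrix_vector:
  fixes F :: "'a::euclidean_space \<Rightarrow> real ^ 'n ^ 'm"
  assumes "open S" "smooth_on S F" "smooth_on S G"
  shows "smooth_on S (\<lambda>x. F x *v G x)"
  using assms by (intro smooth_on_vec) (auto simp: matrix_vector_mult_def intro!: smooth_on_sum smooth_on_mult smooth_on_vec_nth)

text \<open>The inverse function theorem yields \<open>G\<close> with derivative inv (DF (G y)).
  Cramer's rule writes the entries of this inverse as smooth functions of G y, so regularity of
  order \<open>k\<close> of \<open>G\<close> passes to its derivative, and induction on
  \<open>k\<close> makes \<open>G\<close> smooth.\<close>

lemma smooth_local_inverse:
  fixes F :: "real ^ 'n \<Rightarrow> real ^ 'n"
  assumes S: "open S" "x0 \<in> S" and F: "smooth_on S F" and inj: "inj (frechet_derivative F (at x0))"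
  obtains U V G where "open U" "U \<subseteq> S" "x0 \<in> U" "open V" "F x0 \<in> V" "homeomorphism U V F G" "smooth_on V G"
proof -
  let ?D = "\<lambda>x. frechet_derivative F (at x)"
  define f' where "f' x = Blinfun (?D x)" for x
  have D: "(F has_derivative ?D x) (at x)" if "x \<in> S" for x
    by (rule smooth_on_has_derivative[OF S(1) F that])
  have f': "blinfun_apply (f' x) = ?D x" if "x \<in> S" for x
    unfolding f'_def using D[OF that] has_derivative_bounded_linear bounded_linear_Blinfun_apply by blast
  \<comment> \<open>The domain has finite dimension, so continuity in operator norm follows from
    continuity in each direction.\<close>
  have cont: "continuous_on S f'"
  proof (rule continuous_on_blinfun_componentwise)
    fix i :: "real ^ 'n"
    have "continuous_on S (\<lambda>x. ?D x i)"
      by (rule smooth_on_continuous[OF smooth_on_frechet[OF F]])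
    then show "continuous_on S (\<lambda>x. blinfun_apply (f' x) i)"
      by (simp add: f' cong: continuous_on_cong)
  qed
  obtain g0 where g0: "linear g0" "g0 \<circ> ?D x0 = id"
    using linear_injective_left_inverse[OF has_derivative_linear[OF D[OF S(2)]] inj] by blast
  have inv: "Blinfun g0 o\<^sub>L f' x0 = id_blinfun"
    using g0 f'[OF S(2)]
    by (intro blinfun_eqI) (auto simp: bounded_linear_Blinfun_apply linear_conv_bounded_linear fun_eq_iff)
  obtain U V G g' where UV: "open U" "U \<subseteq> S" "x0 \<in> U" "open V" "F x0 \<in> V" and hom: "homeomorphism U V F G"
    and G': "\<And>y. y \<in> V \<Longrightarrow> (G has_derivative (g' y)) (at y)"
    and g': "\<And>y. y \<in> V \<Longrightarrow> g' y = inv (blinfun_apply (f'(G y)))"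
    and bij: "\<And>y. y \<in> V \<Longrightarrow> bij (blinfun_apply (f'(G y)))"
    using inverse_function_theorem[OF S(1) _ cont S(2) inv] D f' by (metis (no_types, lifting))
  have GU: "G y \<in> U" if "y \<in> V" for y using hom that by (auto simp: homeomorphism_def)
  have GV: "\<exists>y\<in>V. x = G y" if "x \<in> U" for x using hom that by (auto simp: homeomorphism_def)
  define A where "A x = matrix (?D x)" for x
  have lin: "linear (?D x)" if "x \<in> U" for x
    using D has_derivative_linear that UV(2) by blast
  have det: "det (A x) \<noteq> 0" if x: "x \<in> U" for x
  proof -
    obtain y where "y \<in> V" "x = G y" using GV[OF x] by blast
    then have "bij (?D x)" using bij[of y] f'[of x] UV(2) x by auto
    then show ?thesis
      unfolding A_def using det_nz_iff_inj[OF lin[OF x]] bij_is_inj by blast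
  qed
  \<comment> \<open>Cramer's quotient: the \<open>k\<close>-th coordinate of the solution w of DF(x)
    w = v.\<close>
  define h where "h v k x = det (\<chi> i j. if j = k then v $ i else A x $ i $ j) * inverse (det (A x))"
    for v :: "real ^ 'n" and k x
  have FU: "smooth_on U F" using F UV(2) smooth_on_subset by blast
  have sA: "smooth_on U (\<lambda>x. A x $ i $ j)" for i j
    unfolding A_def matrix_def by (simp add: smooth_on_vec_nth smooth_on_frechet FU UV(1))
  have h: "smooth_on U (h v k)" for v k
    unfolding h_def
  proof (intro smooth_on_mult smooth_on_inverse smooth_on_det UV(1) sA det)
    show "smooth_on U (\<lambda>x. (\<chi> i j. if j = k then v $ i else A x $ i $ j) $ i $ j)" for i j
      by (cases "j = k") (simp_all add: smooth_on_const UV(1) sA)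
  qed
  have g'h: "g' y v $ k = h v k (G y)" if y: "y \<in> V" for y v k
  proof -
    have "G y \<in> S" using GU[OF y] UV(2) by blast
    then have "?D (G y) (g' y v) = v"
      using g'[OF y] bij[OF y] f' by (simp add: bij_is_surj surj_f_inv_f)
    then have "A (G y) *v g' y v = v"
      using matrix_works[OF lin[OF GU[OF y], folded linear_matrix_vector_mul_eq]] matrix_vector_mul(1)
      by (metis A_def lin[OF GU[OF y]] matrix_works)
    then have "g' y v = (\<chi> k. det (\<chi> i j. if j = k then v $ i else A (G y) $ i $ j) / det (A (G y)))"
      using cramer[OF det[OF GU[OF y]]] by blast
    then show ?thesis unfolding h_def by (simp add: divide_inverse)
  qed
  have "Ck_on k V G" for k
  proof (induction k)
    case 0
    show ?case using hom by (simp add: homeomorphism_def)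
  next
    case (Suc k)
    show ?case
    proof (rule Ck_on_SucI[OF UV(4) G'])
      fix v
      have "Ck_on k V (\<lambda>y. h v i (G y))" for i
        by (rule Ck_on_compose[OF UV(4,1) smooth_onD[OF h] Suc]) (use GU in auto)
      then have "Ck_on k V (\<lambda>y. g' y v $ i)" for i
        by (rule Ck_on_cong[OF UV(4), rotated]) (simp add: g'h)
      then show "Ck_on k V (\<lambda>y. g' y v)" by (rule Ck_on_vec[OF UV(4)])
    qed
  qed
  then have "smooth_on V G" by (simp add: smooth_on_def)
  with UV hom that show ?thesis by blast
qed

section \<open>Symmetry of second derivatives\<close>

lemma second_difference:
  fixes f :: "'a::euclidean_space \<Rightarrow> real"
  assumes S: "open S" and f: "smooth_on S f" and h: "h > 0"
    and sub: "\<And>a b. 0 \<le> a \<Longrightarrow> a \<le> h \<Longrightarrow> 0 \<le> b \<Longrightarrow> b \<le> h \<Longrightarrow> x + a *\<^sub>R u + b *\<^sub>R v \<in> S"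
  obtains a b where "0 \<le> a" "a \<le> h" "0 \<le> b" "b \<le> h"
    "f (x + h *\<^sub>R u + h *\<^sub>R v) - f (x + h *\<^sub>R u) - f (x + h *\<^sub>R v) + f x =
      h\<^sup>2 * frechet_derivative (\<lambda>y. frechet_derivative f (at y) u) (at (x + a *\<^sub>R u + b *\<^sub>R v)) v"
proof -
  let ?D = "\<lambda>y. frechet_derivative f (at y)"
  let ?E = "\<lambda>y. frechet_derivative (\<lambda>y. ?D y u) (at y)"
  have along: "((\<lambda>a. g (y + a *\<^sub>R w)) has_real_derivative frechet_derivative g (at (y + a *\<^sub>R w)) w) (at a)"
    if g: "smooth_on S g" "y + a *\<^sub>R w \<in> S" for g :: "'a \<Rightarrow> real" and y w a
  proof -
    have d: "(g has_derivative frechet_derivative g (at (y + a *\<^sub>R w))) (at (y + a *\<^sub>R w))"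
      by (rule smooth_on_has_derivative[OF S g])
    have "((\<lambda>a. y + a *\<^sub>R w) has_derivative (\<lambda>t. t *\<^sub>R w)) (at a)"
      by (auto intro!: derivative_eq_intros)
    from has_derivative_compose[OF this d] show ?thesis
      using linear_cmul[OF has_derivative_linear[OF d]]
      by (auto simp: has_field_derivative_def mult.commute[of _ "frechet_derivative g (at (y + a *\<^sub>R w)) w"]
          intro: has_derivative_eq_rhs)
  qed
  \<comment> \<open>The second difference is the increment of \<open>p\<close> over [0, h]. The mean
    value theorem is applied to \<open>p\<close>, which differentiates along \<open>u\<close>, and
    once more along \<open>v\<close> to the difference of derivatives so obtained.\<close>
  define p where "p a = f (x + h *\<^sub>R v + a *\<^sub>R u) - f (x + a *\<^sub>R u)" for a
  have "\<exists>a>0. a < h \<and> p h - p 0 = (h - 0) * (?D (x + h *\<^sub>R v + a *\<^sub>R u) u - ?D (x + a *\<^sub>R u) u)"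
    unfolding p_def
  proof (rule MVT2[OF h])
    fix a assume a: "0 \<le> a" "a \<le> h"
    have "x + h *\<^sub>R v + a *\<^sub>R u \<in> S" "x + a *\<^sub>R u \<in> S"
      using sub[OF a, of h] sub[OF a, of 0] h by (auto simp: algebra_simps)
    then show "((\<lambda>a. f (x + h *\<^sub>R v + a *\<^sub>R u) - f (x + a *\<^sub>R u)) has_real_derivative
        ?D (x + h *\<^sub>R v + a *\<^sub>R u) u - ?D (x + a *\<^sub>R u) u) (at a)"
      by (intro DERIV_diff along f)
  qed
  then obtain a where a: "0 < a" "a < h" and pa: "p h - p 0 = h * (?D (x + h *\<^sub>R v + a *\<^sub>R u) u - ?D (x + a *\<^sub>R u) u)"
    by auto
  have "\<exists>b>0. b < h \<and> ?D (x + a *\<^sub>R u + h *\<^sub>R v) u - ?D (x + a *\<^sub>R u + 0 *\<^sub>R v) u = (h - 0) * ?E (x + a *\<^sub>R u + b *\<^sub>R v) v"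
    by (rule MVT2[OF h]) (use a in \<open>intro along smooth_on_frechet[OF f] sub; simp\<close>)
  then obtain b where b: "0 < b" "b < h" and pb: "?D (x + a *\<^sub>R u + h *\<^sub>R v) u - ?D (x + a *\<^sub>R u) u = h * ?E (x + a *\<^sub>R u + b *\<^sub>R v) v"
    by auto
  have "p h - p 0 = h\<^sup>2 * ?E (x + a *\<^sub>R u + b *\<^sub>R v) v"
    using pa pb by (simp add: algebra_simps power2_eq_square)
  then show ?thesis
    by (intro that[of a b]) (use a b in \<open>auto simp: p_def algebra_simps\<close>)
qed

text \<open>The second difference does not depend on the order of \<open>u\<close> and
  \<open>v\<close>, and by \<open>second_difference\<close> it is h^2 times a value of either mixed
  derivative close to \<open>x\<close>. Continuity then excludes different values at
  \<open>x\<close>.\<close>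

lemma mixed_derivatives_eq_real:
  fixes f :: "'a::euclidean_space \<Rightarrow> real"
  assumes S: "open S" and f: "smooth_on S f" and x: "x \<in> S"
  shows "frechet_derivative (\<lambda>y. frechet_derivative f (at y) u) (at x) v =
    frechet_derivative (\<lambda>y. frechet_derivative f (at y) v) (at x) u" (is "?P x = ?Q x")
proof (rule ccontr)
  assume ne: "?P x \<noteq> ?Q x"
  define e where "e = \<bar>?P x - ?Q x\<bar> / 2"
  have e: "e > 0" using ne by (simp add: e_def)
  have P: "continuous_on S ?P" and Q: "continuous_on S ?Q"
    by (intro smooth_on_continuous smooth_on_frechet f)+
  obtain d1 where d1: "d1 > 0" "\<And>y. dist y x < d1 \<Longrightarrow> y \<in> S" using S x open_dist by blast
  obtain d2 where d2: "d2 > 0" "\<And>y. y \<in> S \<Longrightarrow> dist y x < d2 \<Longrightarrow> dist (?P y) (?P x) < e"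
    using P x e unfolding continuous_on_iff by blast
  obtain d3 where d3: "d3 > 0" "\<And>y. y \<in> S \<Longrightarrow> dist y x < d3 \<Longrightarrow> dist (?Q y) (?Q x) < e"
    using Q x e unfolding continuous_on_iff by blast
  define d where "d = min d1 (min d2 d3)"
  \<comment> \<open>Keeps the parallelogram spanned at \<open>x\<close> by h u and h v inside the
    ball of radius \<open>d\<close>; the summand 1 covers the case u = v = 0.\<close>
  define h where "h = d / (2 * (norm u + norm v + 1))"
  have n: "norm u + norm v + 1 > 0" using norm_ge_zero[of u] norm_ge_zero[of v] by linarith
  have d: "d > 0" using d1 d2 d3 by (simp add: d_def)
  have h: "h > 0" unfolding h_def using n d by simp
  have near: "dist (x + a *\<^sub>R s + b *\<^sub>R t) x < d"
    if "0 \<le> a" "a \<le> h" "0 \<le> b" "b \<le> h" "norm s + norm t = norm u + norm v" for a b s t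
  proof -
    have "dist (x + a *\<^sub>R s + b *\<^sub>R t) x \<le> norm (a *\<^sub>R s) + norm (b *\<^sub>R t)"
      by (metis add.assoc add_diff_cancel_left' dist_norm norm_triangle_ineq)
    also have "\<dots> \<le> h * norm s + h * norm t" using that by (intro add_mono) (auto intro: mult_right_mono)
    also have "\<dots> = h * (norm u + norm v)" using that(5) by (simp add: distrib_left[symmetric])
    also have "\<dots> < h * (2 * (norm u + norm v + 1))" using n by (intro mult_strict_left_mono[OF _ h]) (simp add: distrib_left)
    also have "\<dots> = d" unfolding h_def using n by simp
    finally show ?thesis .
  qed
  have inS: "y \<in> S" if "dist y x < d" for y using that d1(2) by (simp add: d_def)
  obtain a b where ab: "0 \<le> a" "a \<le> h" "0 \<le> b" "b \<le> h"
    and 1: "f (x + h *\<^sub>R u + h *\<^sub>R v) - f (x + h *\<^sub>R u) - f (x + h *\<^sub>R v) + f x = h\<^sup>2 * ?P (x + a *\<^sub>R u + b *\<^sub>R v)"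
    using second_difference[OF S f h, of x u v] inS near by metis
  obtain a' b' where ab': "0 \<le> a'" "a' \<le> h" "0 \<le> b'" "b' \<le> h"
    and 2: "f (x + h *\<^sub>R v + h *\<^sub>R u) - f (x + h *\<^sub>R v) - f (x + h *\<^sub>R u) + f x = h\<^sup>2 * ?Q (x + a' *\<^sub>R v + b' *\<^sub>R u)"
    using second_difference[OF S f h, of x v u] inS near by (metis add.commute)
  have "h\<^sup>2 * ?P (x + a *\<^sub>R u + b *\<^sub>R v) = h\<^sup>2 * ?Q (x + a' *\<^sub>R v + b' *\<^sub>R u)"
    using 1 2 by (simp add: algebra_simps)
  then have eq: "?P (x + a *\<^sub>R u + b *\<^sub>R v) = ?Q (x + a' *\<^sub>R v + b' *\<^sub>R u)" using h by simp
  have n1: "dist (x + a *\<^sub>R u + b *\<^sub>R v) x < d" by (rule near[OF ab refl])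
  have n2: "dist (x + a' *\<^sub>R v + b' *\<^sub>R u) x < d" by (rule near[OF ab']) simp
  \<comment> \<open>The triangle inequality. Here \<open>c\<close> is the common value of the two
    mixed derivatives at the intermediate points, \<open>s\<close> and \<open>t\<close> are their
    values at \<open>x\<close>.\<close>
  have aux: "\<not> (\<bar>c - s\<bar> < \<bar>s - t\<bar> / 2 \<and> \<bar>c - t\<bar> < \<bar>s - t\<bar> / 2)" for c s t :: real
    using dist_triangle3[of s t c] by (auto simp: dist_real_def)
  have "dist (?P (x + a *\<^sub>R u + b *\<^sub>R v)) (?P x) < e"
    by (rule d2(2)[OF inS[OF n1]]) (use n1 in \<open>simp add: d_def\<close>)
  moreover have "dist (?Q (x + a' *\<^sub>R v + b' *\<^sub>R u)) (?Q x) < e"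
    by (rule d3(2)[OF inS[OF n2]]) (use n2 in \<open>simp add: d_def\<close>)
  ultimately show False
    using aux unfolding eq e_def dist_real_def by blast
qed

lemma frechet_derivative_linear_comp:
  assumes "bounded_linear L" "F differentiable at x"
  shows "frechet_derivative (\<lambda>y. L (F y)) (at x) v = L (frechet_derivative F (at x) v)"
  using bounded_linear.has_derivative[OF assms(1) assms(2)[unfolded frechet_derivative_works]]
  by (metis frechet_derivative_at)

lemma mixed_derivatives_eq:
  fixes F :: "'a::euclidean_space \<Rightarrow> 'b::euclidean_space"
  assumes S: "open S" and F: "smooth_on S F" and x: "x \<in> S"
  shows "frechet_derivative (\<lambda>y. frechet_derivative F (at y) u) (at x) v =
    frechet_derivative (\<lambda>y. frechet_derivative F (at y) v) (at x) u"
proof (rule euclidean_eqI)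
  fix b :: 'b assume "b \<in> Basis"
  let ?f = "\<lambda>y. F y \<bullet> b"
  have L: "bounded_linear (\<lambda>z::'b. z \<bullet> b)" by (rule bounded_linear_inner_left)
  have f: "smooth_on S ?f" by (rule smooth_on_linear_comp[OF S L F])
  have 1: "frechet_derivative ?f (at y) w = frechet_derivative F (at y) w \<bullet> b" if "y \<in> S" for y w
    by (rule frechet_derivative_linear_comp[OF L smooth_on_differentiable[OF S F that]])
  have 2: "frechet_derivative (\<lambda>y. frechet_derivative ?f (at y) w) (at x) w' =
      frechet_derivative (\<lambda>y. frechet_derivative F (at y) w) (at x) w' \<bullet> b" for w w'
  proof -
    have "frechet_derivative (\<lambda>y. frechet_derivative ?f (at y) w) (at x) =
        frechet_derivative (\<lambda>y. frechet_derivative F (at y) w \<bullet> b) (at x)"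
      by (rule frechet_derivative_transform_within_open[OF smooth_on_differentiable[OF S smooth_on_frechet[OF f] x] S x])
         (rule 1)
    then show ?thesis
      using frechet_derivative_linear_comp[OF L smooth_on_differentiable[OF S smooth_on_frechet[OF F] x]] by metis
  qed
  show "frechet_derivative (\<lambda>y. frechet_derivative F (at y) u) (at x) v \<bullet> b =
    frechet_derivative (\<lambda>y. frechet_derivative F (at y) v) (at x) u \<bullet> b"
    using mixed_derivatives_eq_real[OF S f x, of u v] by (simp add: 2)
qed

section \<open>Whitney's theorem on even functions\<close>

text \<open>Functions all of whose derivatives are bounded. The bounds give the uniform convergence of the
  series used in the extension below.\<close>

coinductive bsmooth :: "(real \<times> real \<Rightarrow> real) \<Rightarrow> bool" where
  "(\<And>z. (h has_derivative (\<lambda>(a, b). a * hx z + b * hy z)) (at z)) \<Longrightarrow> (\<And>z. \<bar>h z\<bar> \<le> C)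
    \<Longrightarrow> bsmooth hx \<Longrightarrow> bsmooth hy \<Longrightarrow> bsmooth h"

definition dx :: "(real \<times> real \<Rightarrow> real) \<Rightarrow> real \<times> real \<Rightarrow> real" where
  "dx h z = frechet_derivative h (at z) (1, 0)"

definition dy :: "(real \<times> real \<Rightarrow> real) \<Rightarrow> real \<times> real \<Rightarrow> real" where
  "dy h z = frechet_derivative h (at z) (0, 1)"

lemma dx_dy_unique:
  assumes "\<And>z. (h has_derivative (\<lambda>(a, b). a * hx z + b * hy z)) (at z)"
  shows "dx h = hx" "dy h = hy"
  using frechet_derivative_at[OF assms, symmetric] by (auto simp: dx_def dy_def fun_eq_iff)

lemma bsmoothD:
  assumes "bsmooth h"
  shows "(h has_derivative (\<lambda>(a, b). a * dx h z + b * dy h z)) (at z)" "bsmooth (dx h)" "bsmooth (dy h)"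
    "\<exists>C. \<forall>z. \<bar>h z\<bar> \<le> C"
proof -
  obtain hx hy C where *: "\<And>z. (h has_derivative (\<lambda>(a, b). a * hx z + b * hy z)) (at z)"
    "\<And>z. \<bar>h z\<bar> \<le> C" "bsmooth hx" "bsmooth hy"
    using assms by (rule bsmooth.cases) auto
  note d = dx_dy_unique[OF *(1)]
  show "(h has_derivative (\<lambda>(a, b). a * dx h z + b * dy h z)) (at z)" unfolding d by (rule *(1))
  show "bsmooth (dx h)" "bsmooth (dy h)" unfolding d by (fact *)+
  show "\<exists>C. \<forall>z. \<bar>h z\<bar> \<le> C" using *(2) by blast
qed

lemma bsmooth_continuous: "bsmooth h \<Longrightarrow> continuous_on S h"
  by (intro continuous_at_imp_continuous_on ballI has_derivative_continuous[OF bsmoothD(1)])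

lemma bsmooth_continuous_compose:
  "bsmooth h \<Longrightarrow> continuous_on S f \<Longrightarrow> continuous_on S g \<Longrightarrow> continuous_on S (\<lambda>x. h (f x, g x))"
  by (rule continuous_on_compose2[OF bsmooth_continuous[of h UNIV]]) (auto intro: continuous_on_Pair)

lemma bsmooth_partials:
  assumes "bsmooth h"
  shows "((\<lambda>x. h (x, v)) has_real_derivative dx h (x, v)) (at x within S)"
    "((\<lambda>y. h (s, y)) has_real_derivative dy h (s, y)) (at y within S)"
proof -
  have "((\<lambda>x. h (x, v)) has_derivative (\<lambda>a. case (a, 0) of (a, b) \<Rightarrow> a * dx h (x, v) + b * dy h (x, v))) (at x within S)"
    by (rule has_derivative_compose[OF _ bsmoothD(1)[OF assms]]) (auto intro!: derivative_eq_intros)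
  then show "((\<lambda>x. h (x, v)) has_real_derivative dx h (x, v)) (at x within S)"
    by (simp add: has_field_derivative_def mult.commute[of _ "dx h (x, v)"])
  have "((\<lambda>y. h (s, y)) has_derivative (\<lambda>a. case (0, a) of (a, b) \<Rightarrow> a * dx h (s, y) + b * dy h (s, y))) (at y within S)"
    by (rule has_derivative_compose[OF _ bsmoothD(1)[OF assms]]) (auto intro!: derivative_eq_intros)
  then show "((\<lambda>y. h (s, y)) has_real_derivative dy h (s, y)) (at y within S)"
    by (simp add: has_field_derivative_def mult.commute[of _ "dy h (s, y)"])
qed

lemma bsmooth_coinduct:
  assumes "X h"
    and "\<And>h. X h \<Longrightarrow> (\<exists>C. \<forall>z. \<bar>h z\<bar> \<le> C) \<and>
      (\<exists>hx hy. (\<forall>z. (h has_derivative (\<lambda>(a, b). a * hx z + b * hy z)) (at z)) \<and> X hx \<and> X hy)"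
  shows "bsmooth h"
  using assms(1)
proof (coinduction arbitrary: h)
  case bsmooth
  then show ?case using assms(2)[of h] by blast
qed

lemma bsmooth_coinduct_stepI:
  assumes "\<And>z. \<bar>h z\<bar> \<le> C" "\<And>z. (h has_derivative (\<lambda>(a, b). a * hx z + b * hy z)) (at z)" "X hx" "X hy"
  shows "(\<exists>C. \<forall>z. \<bar>h z\<bar> \<le> C) \<and>
      (\<exists>hx hy. (\<forall>z. (h has_derivative (\<lambda>(a, b). a * hx z + b * hy z)) (at z)) \<and> X hx \<and> X hy)"
  using assms by blast

lemma has_derivative_real_partials:
  fixes f :: "real \<times> real \<Rightarrow> real"
  assumes fx: "\<And>x y. ((\<lambda>x. f (x, y)) has_real_derivative fx (x, y)) (at x)"
    and fy: "\<And>x y. ((\<lambda>y. f (x, y)) has_real_derivative fy (x, y)) (at y)"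
    and cont: "continuous_on UNIV fy"
  shows "(f has_derivative (\<lambda>(a, b). a * fx z + b * fy z)) (at z)"
proof -
  obtain x y where z: "z = (x, y)" by (cases z)
  have "((\<lambda>(x, y). f (x, y)) has_derivative
      (\<lambda>(tx, ty). fx (x, y) * tx + blinfun_apply (blinfun_mult_right (fy (x, y))) ty)) (at (x, y) within UNIV \<times> UNIV)"
  proof (rule has_derivative_partialsI)
    show "((\<lambda>x. f (x, y)) has_derivative (*) (fx (x, y))) (at x within UNIV)"
      using fx by (simp add: has_field_derivative_def)
    show "((\<lambda>y. f (x, y)) has_derivative blinfun_apply (blinfun_mult_right (fy (x, y)))) (at y within UNIV)" for x y
      using fy by (simp add: has_field_derivative_def)
    have "continuous (at (x, y)) fy" using cont by (simp add: continuous_on_eq_continuous_at)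
    then show "continuous (at (x, y) within UNIV \<times> UNIV) (\<lambda>(x, y). blinfun_mult_right (fy (x, y)))"
      by (simp add: case_prod_unfold bounded_linear.continuous[OF bounded_linear_blinfun_mult_right])
  qed auto
  then show ?thesis unfolding z by (simp add: case_prod_unfold mult.commute)
qed

text \<open>The reflection of the first variable is built in because even and odd parts in that
  variable are needed later. Its chain rule factor -1 is absorbed into the coefficient
  \<open>d\<close>, so the family of all such combinations is closed under both partial derivatives
  and coinduction applies.\<close>

lemma bsmooth_combine:
  assumes "bsmooth h" "bsmooth k"
  shows "bsmooth (\<lambda>z. c * h z + d * k (- fst z, snd z))"
proof (rule bsmooth_coinduct[where X = "\<lambda>f. \<exists>c d h k. bsmooth h \<and> bsmooth k \<and> f = (\<lambda>z. c * h z + d * k (- fst z, snd z))"])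
  fix f assume "\<exists>c d h k. bsmooth h \<and> bsmooth k \<and> f = (\<lambda>z. c * h z + d * k (- fst z, snd z))"
  then obtain c d h k where h: "bsmooth h" and k: "bsmooth k" and f: "f = (\<lambda>z. c * h z + d * k (- fst z, snd z))"
    by blast
  obtain C D where C: "\<And>z. \<bar>h z\<bar> \<le> C" and D: "\<And>z. \<bar>k z\<bar> \<le> D" using bsmoothD(4) h k by metis
  have bd: "\<bar>f z\<bar> \<le> \<bar>c\<bar> * C + \<bar>d\<bar> * D" for z
    unfolding f by (rule order_trans[OF abs_triangle_ineq]) (auto simp: abs_mult intro!: add_mono mult_left_mono C D)
  let ?R = "\<lambda>z::real \<times> real. (- fst z, snd z)"
  have "(f has_derivative (\<lambda>(a, b). a * (c * dx h z + (- d) * dx k (?R z)) + b * (c * dy h z + d * dy k (?R z)))) (at z)" for z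
  proof -
    have "((\<lambda>z. k (?R z)) has_derivative (\<lambda>w. case ?R w of (a, b) \<Rightarrow> a * dx k (?R z) + b * dy k (?R z))) (at z)"
      by (rule has_derivative_compose[OF _ bsmoothD(1)[OF k]]) (auto intro!: derivative_eq_intros)
    from has_derivative_add[OF has_derivative_mult_right[OF bsmoothD(1)[OF h], of c] has_derivative_mult_right[OF this, of d]]
    show ?thesis unfolding f by (rule has_derivative_eq_rhs) (auto simp: algebra_simps)
  qed
  then show "(\<exists>C. \<forall>z. \<bar>f z\<bar> \<le> C) \<and> (\<exists>hx hy. (\<forall>z. (f has_derivative (\<lambda>(a, b). a * hx z + b * hy z)) (at z)) \<and>
      (\<exists>c d h k. bsmooth h \<and> bsmooth k \<and> hx = (\<lambda>z. c * h z + d * k (- fst z, snd z))) \<and>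
      (\<exists>c d h k. bsmooth h \<and> bsmooth k \<and> hy = (\<lambda>z. c * h z + d * k (- fst z, snd z))))"
    by (intro bsmooth_coinduct_stepI[OF bd]) (use bsmoothD(2,3)[OF h] bsmoothD(2,3)[OF k] in blast)+
qed (use assms in blast)

section \<open>Division by the first variable\<close>

definition ray_integral :: "nat \<Rightarrow> (real \<times> real \<Rightarrow> real) \<Rightarrow> real \<times> real \<Rightarrow> real" where
  "ray_integral j h z = integral {0..1} (\<lambda>t. t ^ j * h (t * fst z, snd z))"

lemma ray_integrable: "bsmooth h \<Longrightarrow> (\<lambda>t. t ^ j * h (t * x, y)) integrable_on {0..1}"
  by (intro integrable_continuous_real continuous_intros bsmooth_continuous_compose)

text \<open>Differentiation under the integral sign. A derivative in the first variable brings out a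
  factor \<open>t\<close>; the weight t^j is part of the definition so that the family of all ray
  integrals is closed under both partial derivatives.\<close>

lemma bsmooth_ray_integral:
  assumes "bsmooth h"
  shows "bsmooth (ray_integral j h)"
proof (rule bsmooth_coinduct[where X = "\<lambda>f. \<exists>j h. bsmooth h \<and> f = ray_integral j h"])
  fix f assume "\<exists>j h. bsmooth h \<and> f = ray_integral j h"
  then obtain j h where h: "bsmooth h" and f: "f = ray_integral j h" by blast
  obtain C where C: "\<And>z. \<bar>h z\<bar> \<le> C" using bsmoothD(4) h by metis
  have C0: "0 \<le> C" using C abs_ge_zero order_trans by blast
  have bd: "\<bar>f z\<bar> \<le> C" for z
  proof -
    have "norm (integral {0..1} (\<lambda>t. t ^ j * h (t * fst z, snd z))) \<le> C * (1 - 0)"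
    proof (rule integral_bound)
      show "continuous_on {0..1} (\<lambda>t. t ^ j * h (t * fst z, snd z))"
        by (intro continuous_intros bsmooth_continuous_compose h)
      show "norm (t ^ j * h (t * fst z, snd z)) \<le> C" if "t \<in> {0..1}" for t
      proof -
        have "\<bar>t ^ j\<bar> * \<bar>h (t * fst z, snd z)\<bar> \<le> 1 * C"
          using that C0 by (intro mult_mono C) (auto simp: power_le_one)
        then show ?thesis by (simp add: abs_mult)
      qed
    qed simp
    then show ?thesis by (simp add: f ray_integral_def)
  qed
  have cont: "continuous_on (UNIV \<times> cbox 0 1) (\<lambda>(z, t). t ^ i * k (t * fst z, snd z))" if "bsmooth k" for i k
    using that by (auto simp: case_prod_unfold intro!: continuous_intros bsmooth_continuous_compose)
  have "(f has_derivative (\<lambda>(a, b). a * ray_integral (Suc j) (dx h) z + b * ray_integral j (dy h) z)) (at z)" for z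
  proof (rule has_derivative_real_partials)
    fix x y
    have "((\<lambda>x. integral (cbox 0 1) (\<lambda>t. t ^ j * h (t * x, y))) has_field_derivative
        integral (cbox 0 1) (\<lambda>t. t ^ Suc j * dx h (t * x, y))) (at x within UNIV)"
    proof (rule leibniz_rule_field_derivative)
      fix x t :: real
      have "((\<lambda>x. h (t * x, y)) has_real_derivative dx h (t * x, y) * t) (at x)"
        by (rule DERIV_chain'[where f = "\<lambda>x. t * x" and g = "\<lambda>x. h (x, y)", OF _ bsmooth_partials(1)[OF h], THEN DERIV_cong])
          (auto intro!: derivative_eq_intros)
      from DERIV_cmult[OF this, of "t ^ j"]
      show "((\<lambda>x. t ^ j * h (t * x, y)) has_real_derivative t ^ Suc j * dx h (t * x, y)) (at x within UNIV)"
        by (simp add: mult_ac)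
      show "(\<lambda>t. t ^ j * h (t * x, y)) integrable_on cbox 0 1" using ray_integrable[OF h] by simp
    next
      show "continuous_on (UNIV \<times> cbox 0 1) (\<lambda>(x, t). t ^ Suc j * dx h (t * x, y))"
        unfolding case_prod_unfold by (intro continuous_intros bsmooth_continuous_compose bsmoothD h)
    qed auto
    then show "((\<lambda>x. f (x, y)) has_real_derivative ray_integral (Suc j) (dx h) (x, y)) (at x)"
      by (simp add: f ray_integral_def)
    have "((\<lambda>y. integral (cbox 0 1) (\<lambda>t. t ^ j * h (t * x, y))) has_field_derivative
        integral (cbox 0 1) (\<lambda>t. t ^ j * dy h (t * x, y))) (at y within UNIV)"
    proof (rule leibniz_rule_field_derivative)
      fix y t :: real
      show "((\<lambda>y. t ^ j * h (t * x, y)) has_real_derivative t ^ j * dy h (t * x, y)) (at y within UNIV)"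
        by (intro DERIV_cmult bsmooth_partials(2)[OF h])
      show "(\<lambda>t. t ^ j * h (t * x, y)) integrable_on cbox 0 1" using ray_integrable[OF h] by simp
    next
      show "continuous_on (UNIV \<times> cbox 0 1) (\<lambda>(y, t). t ^ j * dy h (t * x, y))"
        unfolding case_prod_unfold by (intro continuous_intros bsmooth_continuous_compose bsmoothD h)
    qed auto
    then show "((\<lambda>y. f (x, y)) has_real_derivative ray_integral j (dy h) (x, y)) (at y)"
      by (simp add: f ray_integral_def)
  next
    have "continuous_on UNIV (\<lambda>z. integral (cbox 0 1) (\<lambda>t. t ^ j * dy h (t * fst z, snd z)))"
      by (rule integral_continuous_on_param[OF cont[OF bsmoothD(3)[OF h]]])
    then show "continuous_on UNIV (ray_integral j (dy h))" by (simp add: ray_integral_def[abs_def])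
  qed
  then show "(\<exists>C. \<forall>z. \<bar>f z\<bar> \<le> C) \<and> (\<exists>hx hy. (\<forall>z. (f has_derivative (\<lambda>(a, b). a * hx z + b * hy z)) (at z)) \<and>
      (\<exists>j h. bsmooth h \<and> hx = ray_integral j h) \<and> (\<exists>j h. bsmooth h \<and> hy = ray_integral j h))"
    using bd bsmoothD(2,3)[OF h] by blast
qed (use assms in blast)

text \<open>Hadamard's lemma: the fundamental theorem of calculus along the segment from (0, v) to
  (s, v). If \<open>h\<close> vanishes for s = 0, it exhibits h / s as a function of class
  \<open>bsmooth\<close>.\<close>

lemma ray_integral_dx:
  assumes "bsmooth h"
  shows "h (s, v) = h (0, v) + s * ray_integral 0 (dx h) (s, v)"
proof -
  have "((\<lambda>t. dx h (t * s, v) * s) has_integral h (1 * s, v) - h (0 * s, v)) {0..1}"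
    by (rule fundamental_theorem_of_calculus)
      (auto simp: has_real_derivative_iff_has_vector_derivative[symmetric] intro!: derivative_eq_intros
        DERIV_chain'[where f = "\<lambda>t. t * s" and g = "\<lambda>x. h (x, v)"] bsmooth_partials(1)[OF assms])
  from integral_unique[OF this] have "integral {0..1} (\<lambda>t. dx h (t * s, v)) * s = h (s, v) - h (0, v)"
    by simp
  then show ?thesis by (simp add: ray_integral_def mult.commute)
qed

definition even_fst :: "(real \<times> real \<Rightarrow> real) \<Rightarrow> bool" where
  "even_fst h \<longleftrightarrow> (\<forall>s v. h (- s, v) = h (s, v))"

text \<open>To be read with c = 1 for even and c = -1 for odd functions: \<open>dx\<close> reverses
  the parity in the first variable, \<open>dy\<close> keeps it.\<close>

lemma dx_reflect:
  assumes h: "bsmooth h" and eq: "\<And>s v. h (- s, v) = c * h (s, v)"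
  shows "dx h (- s, v) = - c * dx h (s, v)" "dy h (- s, v) = c * dy h (s, v)"
proof -
  have "((\<lambda>s. h (- s, v)) has_real_derivative dx h (- s, v) * (- 1)) (at s)"
    by (rule DERIV_chain'[where f = uminus and g = "\<lambda>x. h (x, v)", OF _ bsmooth_partials(1)[OF h], THEN DERIV_cong])
       (auto intro!: derivative_eq_intros)
  moreover have "((\<lambda>s. h (- s, v)) has_real_derivative c * dx h (s, v)) (at s)"
    unfolding eq by (intro DERIV_cmult bsmooth_partials(1)[OF h])
  ultimately show "dx h (- s, v) = - c * dx h (s, v)" using DERIV_unique by fastforce
  have "((\<lambda>y. h (- s, y)) has_real_derivative c * dy h (s, v)) (at v)"
    unfolding eq by (intro DERIV_cmult bsmooth_partials(2)[OF h])
  then show "dy h (- s, v) = c * dy h (s, v)" using bsmooth_partials(2)[OF h] DERIV_unique by blast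
qed

lemma ray_integral_reflect:
  assumes "\<And>s v. h (- s, v) = c * h (s, v)"
  shows "ray_integral j h (- s, v) = c * ray_integral j h (s, v)"
  by (simp add: ray_integral_def assms integral_mult_right[symmetric] mult.left_commute del: integral_mult_right)

text \<open>\<open>h\<^sub>s / (2 s)\<close>, which is the derivative of \<open>h (sqrt x, v)\<close> in \<open>x\<close> when \<open>h\<close> is even in \<open>s\<close>.\<close>

definition quot_dx :: "(real \<times> real \<Rightarrow> real) \<Rightarrow> real \<times> real \<Rightarrow> real" where
  "quot_dx h z = ray_integral 0 (dx (dx h)) z / 2"

lemma quot_dx:
  assumes h: "bsmooth h" "even_fst h"
  shows "bsmooth (quot_dx h)" "even_fst (quot_dx h)" "dx h (s, v) = 2 * s * quot_dx h (s, v)"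
proof -
  have "bsmooth (\<lambda>z. (1/2) * ray_integral 0 (dx (dx h)) z + 0 * ray_integral 0 (dx (dx h)) (- fst z, snd z))"
    by (intro bsmooth_combine bsmooth_ray_integral bsmoothD h)
  then show "bsmooth (quot_dx h)" by (simp add: quot_dx_def[abs_def])
  have 1: "dx h (- s, v) = - 1 * dx h (s, v)" for s v
    using dx_reflect(1)[OF h(1), of 1] h(2) by (simp add: even_fst_def)
  have 2: "dx (dx h) (- s, v) = 1 * dx (dx h) (s, v)" for s v
    using dx_reflect(1)[OF bsmoothD(2)[OF h(1)] 1] by simp
  show "even_fst (quot_dx h)"
    unfolding even_fst_def quot_dx_def using ray_integral_reflect[of _ 1, OF 2] by simp
  have "dx h (0, v) = 0" using 1[of 0 v] by simp
  then show "dx h (s, v) = 2 * s * quot_dx h (s, v)"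
    using ray_integral_dx[OF bsmoothD(2)[OF h(1)], of s v] by (simp add: quot_dx_def)
qed

lemma even_fst_dy: "bsmooth h \<Longrightarrow> even_fst h \<Longrightarrow> even_fst (dy h)"
  using dx_reflect(2)[of h 1] by (simp add: even_fst_def)

text \<open>For x > 0 this is the chain rule. At 0 the square root has no derivative, and the
  difference quotient is read off from a first order expansion in \<open>x\<close>. The derivative
  is one-sided: since \<open>sqrt (- x) = - sqrt x\<close> and \<open>h\<close> is even, the formula
  h (sqrt x, v) merely mirrors the right half for negative \<open>x\<close>.\<close>

lemma DERIV_even_sqrt:
  assumes h: "bsmooth h" "even_fst h" and x: "0 \<le> x"
  shows "((\<lambda>x. h (sqrt x, v)) has_real_derivative quot_dx h (sqrt x, v)) (at x within {0..})"
proof (cases "x = 0")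
  case False
  have "((\<lambda>x. h (sqrt x, v)) has_real_derivative (inverse (sqrt x) / 2) * dx h (sqrt x, v)) (at x)"
    by (rule DERIV_chain'[where f = sqrt and g = "\<lambda>x. h (x, v)", OF _ bsmooth_partials(1)[OF h(1)], THEN DERIV_cong])
       (use x False in \<open>auto intro!: DERIV_real_sqrt\<close>)
  moreover have "(inverse (sqrt x) / 2) * dx h (sqrt x, v) = quot_dx h (sqrt x, v)"
    using x False by (simp add: quot_dx(3)[OF h] field_simps)
  ultimately show ?thesis by (simp add: has_field_derivative_at_within)
next
  case True
  note q = quot_dx[OF h]
  \<comment> \<open>Substituting dx h = 2 s quot_dx h into Hadamard's formula produces a factor
    \<open>t\<close> under the integral and the total factor s^2 = x outside.\<close>
  define Q where "Q x = 2 * ray_integral 1 (quot_dx h) (sqrt x, v)" for x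
  have expand: "h (sqrt x, v) = h (0, v) + x * Q x" if "0 \<le> x" for x
  proof -
    have "ray_integral 0 (dx h) (sqrt x, v) = integral {0..1} (\<lambda>t. (2 * sqrt x) * (t ^ 1 * quot_dx h (t * sqrt x, v)))"
      by (simp add: ray_integral_def q(3) mult_ac)
    also have "\<dots> = (2 * sqrt x) * ray_integral 1 (quot_dx h) (sqrt x, v)"
      unfolding ray_integral_def by (subst integral_mult_right) simp
    finally show ?thesis
      using ray_integral_dx[OF h(1), of "sqrt x" v] that by (simp add: Q_def)
  qed
  have "continuous_on UNIV Q"
    unfolding Q_def by (intro continuous_intros bsmooth_continuous_compose bsmooth_ray_integral q(1))
  then have "(Q \<longlongrightarrow> Q 0) (at 0 within {0..})"
    by (metis UNIV_I continuous_on_def tendsto_within_subset subset_UNIV)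
  \<comment> \<open>The integral of \<open>t\<close> over [0, 1] is 1/2 and cancels the factor 2 in
    \<open>Q\<close>.\<close>
  moreover have "Q 0 = quot_dx h (0, v)"
    using ident_has_integral[of 0 "1::real"] by (simp add: Q_def ray_integral_def integral_unique)
  moreover have "\<forall>\<^sub>F x in at 0 within {0..}. (h (sqrt x, v) - h (sqrt 0, v)) / (x - 0) = Q x"
    unfolding eventually_at_filter by (rule always_eventually) (simp add: expand)
  ultimately have "((\<lambda>x. (h (sqrt x, v) - h (sqrt 0, v)) / (x - 0)) \<longlongrightarrow> quot_dx h (sqrt 0, v)) (at 0 within {0..})"
    by (simp add: tendsto_cong)
  then show ?thesis unfolding True has_field_derivative_iff .
qed

text \<open>Every value is attained on a compact square of side 2 \<pi>, which bounds
  \<open>h\<close>. The partial derivatives are smooth and periodic again, so coinduction bounds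
  derivatives of every order.\<close>

lemma smooth_periodic_bsmooth:
  assumes "smooth_on UNIV h" "\<And>s v. h (s + 2 * pi, v) = h (s, v)" "\<And>s v. h (s, v + 2 * pi) = h (s, v)"
  shows "bsmooth h"
proof (rule bsmooth_coinduct[where X = "\<lambda>h. smooth_on UNIV h \<and> (\<forall>z. h (z + (2 * pi, 0)) = h z) \<and> (\<forall>z. h (z + (0, 2 * pi)) = h z)"])
  show "smooth_on UNIV h \<and> (\<forall>z. h (z + (2 * pi, 0)) = h z) \<and> (\<forall>z. h (z + (0, 2 * pi)) = h z)"
    using assms by auto
next
  fix h :: "real \<times> real \<Rightarrow> real"
  assume "smooth_on UNIV h \<and> (\<forall>z. h (z + (2 * pi, 0)) = h z) \<and> (\<forall>z. h (z + (0, 2 * pi)) = h z)"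
  then have h: "smooth_on UNIV h" and p: "\<And>z. h (z + (2 * pi, 0)) = h z" "\<And>z. h (z + (0, 2 * pi)) = h z"
    by auto
  have D: "(h has_derivative frechet_derivative h (at z)) (at z)" for z
    by (rule smooth_on_has_derivative[OF open_UNIV h UNIV_I])
  have nat_shift: "h (z + real n *\<^sub>R c) = h z" if "\<And>z. h (z + c) = h z" for n c z
  proof (induction n)
    case (Suc n)
    have "h (z + real (Suc n) *\<^sub>R c) = h ((z + real n *\<^sub>R c) + c)" by (simp add: algebra_simps)
    then show ?case using that Suc by simp
  qed simp
  have int_shift: "h (z + real_of_int n *\<^sub>R c) = h z" if c: "\<And>z. h (z + c) = h z" for n c z
  proof (cases n)
    case (nonneg m)
    then show ?thesis using nat_shift[OF c, of z m] by simp
  next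
    case (neg m)
    have "real_of_int n + real (Suc m) = 0" using neg by simp
    then have "z + real_of_int n *\<^sub>R c + real (Suc m) *\<^sub>R c = z"
      by (metis add.assoc add.right_neutral scaleR_left_distrib scaleR_zero_left)
    then show ?thesis using nat_shift[OF c, of "z + real_of_int n *\<^sub>R c" "Suc m"] by metis
  qed
  have "compact (h ` ({0..2*pi} \<times> {0..2*pi}))"
    by (intro compact_continuous_image compact_Times compact_Icc continuous_on_subset[OF smooth_on_continuous[OF h]]) auto
  then obtain C where C: "\<And>z. z \<in> {0..2*pi} \<times> {0..2*pi} \<Longrightarrow> \<bar>h z\<bar> \<le> C"
    using compact_imp_bounded bounded_iff by (metis imageI real_norm_def)
  have "\<bar>h z\<bar> \<le> C" for z
  proof -
    have red: "x + real_of_int (- \<lfloor>x / (2*pi)\<rfloor>) * (2*pi) \<in> {0..2*pi}" for x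
      using floor_divide_lower[of "2*pi" x] floor_divide_upper[of "2*pi" x] by (simp add: algebra_simps)
    have "h z = h (z + real_of_int (- \<lfloor>fst z / (2*pi)\<rfloor>) *\<^sub>R (2*pi, 0) + real_of_int (- \<lfloor>snd z / (2*pi)\<rfloor>) *\<^sub>R (0, 2*pi))"
      unfolding int_shift[OF p(1)] int_shift[OF p(2)] by (rule refl)
    then show ?thesis using C red[of "fst z"] red[of "snd z"] by (cases z) simp
  qed
  moreover have "(h has_derivative (\<lambda>(a, b). a * dx h z + b * dy h z)) (at z)" for z
  proof (rule has_derivative_eq_rhs[OF D])
    interpret linear "frechet_derivative h (at z)" using D has_derivative_linear by blast
    have "frechet_derivative h (at z) (a, b) = a * dx h z + b * dy h z" for a b
      using add[of "a *\<^sub>R (1, 0)" "b *\<^sub>R (0, 1)"] scale[of a "(1, 0)"] scale[of b "(0, 1)"]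
      by (simp add: dx_def dy_def)
    then show "frechet_derivative h (at z) = (\<lambda>(a, b). a * dx h z + b * dy h z)" by auto
  qed
  moreover have shift: "frechet_derivative h (at (z + c)) = frechet_derivative h (at z)" if c: "\<And>z. h (z + c) = h z" for z c
  proof -
    have "((\<lambda>z. h (z + c)) has_derivative frechet_derivative h (at (z + c))) (at z)"
      by (rule has_derivative_compose[OF _ D, where f' = "\<lambda>w. w"]) (auto intro!: derivative_eq_intros)
    then show ?thesis using c by (metis (no_types, lifting) D ext has_derivative_unique)
  qed
  have "smooth_on UNIV (dx h)" "smooth_on UNIV (dy h)"
    unfolding dx_def[abs_def] dy_def[abs_def] by (intro smooth_on_frechet h)+
  moreover have "dx h (z + (2 * pi, 0)) = dx h z" "dx h (z + (0, 2 * pi)) = dx h z"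
      "dy h (z + (2 * pi, 0)) = dy h z" "dy h (z + (0, 2 * pi)) = dy h z" for z
    unfolding dx_def dy_def shift[OF p(1)] shift[OF p(2)] by (rule refl)+
  ultimately show "(\<exists>C. \<forall>z. \<bar>h z\<bar> \<le> C) \<and>
      (\<exists>hx hy. (\<forall>z. (h has_derivative (\<lambda>(a, b). a * hx z + b * hy z)) (at z)) \<and>
        (smooth_on UNIV hx \<and> (\<forall>z. hx (z + (2 * pi, 0)) = hx z) \<and> (\<forall>z. hx (z + (0, 2 * pi)) = hx z)) \<and>
        (smooth_on UNIV hy \<and> (\<forall>z. hy (z + (2 * pi, 0)) = hy z) \<and> (\<forall>z. hy (z + (0, 2 * pi)) = hy z)))"
    by (intro bsmooth_coinduct_stepI conjI allI)
qed

text \<open>A smooth function of \<open>s\<^sup>2\<close> is extended to negative arguments, as in Seeley's extension theorem, by a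
  series with weights on the nodes \<open>10\<^sup>-\<^sup>k\<close> (\<open>k\<close> an integer) whose \<open>n\<close>-th moment is \<open>(- 1)\<^sup>n\<close>. All moments of
  \<open>theta\<close> vanish, by the reflection \<open>k \<mapsto> 1 - 2 n - k\<close>; hence, after division by \<open>1 + node\<close>,
  consecutive moments are opposite, and it remains to see that the total weight is not zero.\<close>

definition tri :: "int \<Rightarrow> int" where "tri k = k * (k - 1) div 2"

lemma two_tri: "2 * tri k = k * (k - 1)"
  unfolding tri_def by (rule dvd_mult_div_cancel) auto

text \<open>The coefficients of the theta series with terms (-1)^k q^(k (k - 1) / 2) x^k, for q =
  1/10. The \<open>n\<close>-th moment is the value of the series at x = q^n, and all powers of q
  are zeros of it, as Jacobi's triple product shows.\<close>

definition theta :: "int \<Rightarrow> real" where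
  "theta k = (if even k then 1 else - 1) * (1 / 10) powi tri k"

definition node :: "int \<Rightarrow> real" where "node k = (1 / 10) powi k"

definition weight :: "int \<Rightarrow> real" where "weight k = theta k / (1 + node k)"

lemma node_pos: "node k > 0" by (simp add: node_def)

lemma abs_theta: "\<bar>theta k\<bar> = (1 / 10) powi tri k" by (simp add: theta_def abs_mult power_int_abs)

lemma theta_node_power: "theta k * node k ^ n = (if even k then 1 else - 1) * (1 / 10) powi (tri k + k * int n)"
  by (simp add: theta_def node_def power_int_add power_int_mult)

lemma abs_theta_node_power: "\<bar>theta k * node k ^ n\<bar> = (1 / 10) powi (tri k + k * int n)"
  by (simp add: theta_node_power abs_mult power_int_abs)

lemma theta_moment: "infsum (\<lambda>k. theta k * node k ^ n) UNIV = 0"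
proof -
  let ?f = "\<lambda>k. theta k * node k ^ n" and ?s = "\<lambda>k. 1 - 2 * int n - k"
  \<comment> \<open>Doubled, since \<open>tri\<close> contains an integer division and
    \<open>two_tri\<close> turns the exponents into polynomials. The sign of the term changes
    because \<open>k\<close> and its reflection add up to the odd number 1 - 2 n.\<close>
  have "2 * (tri (?s k) + ?s k * int n) = 2 * (tri k + k * int n)" for k
    unfolding distrib_left two_tri by (simp add: algebra_simps)
  then have "tri (?s k) + ?s k * int n = tri k + k * int n" for k
    by (metis mult_cancel_left zero_neq_numeral)
  then have "?f (?s k) = - ?f k" for k
    unfolding theta_node_power by simp
  moreover have "bij ?s" by (rule involuntory_imp_bij) simp
  ultimately have "infsum ?f UNIV = infsum (\<lambda>k. - ?f k) UNIV"
    using infsum_reindex_bij_betw[of ?s UNIV UNIV ?f] by simp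
  then show ?thesis by (simp add: infsum_uminus)
qed

text \<open>Two geometric tails in place of the Gaussian decay of \<open>theta\<close>:
  \<open>tri k\<close> is at least k - 1 for k \<ge> 2 and at least -k for k \<le> -1. The indices 0
  and 1, where \<open>tri\<close> vanishes, are kept apart.\<close>

definition majorant :: "int \<Rightarrow> real" where
  "majorant k = (1 / 10) powi (if 2 \<le> k then k - 1 else - k)"

lemma majorant_has_sum: "(majorant has_sum 2 / 9) (- {0, 1})"
proof -
  have "(\<lambda>n. (1 / 10) * (1 / 10) ^ n :: real) sums ((1 / 10) * (1 / (1 - 1 / 10)))"
    by (intro sums_mult geometric_sums) simp
  then have g: "((\<lambda>n. (1 / 10) ^ Suc n :: real) has_sum 1 / 9) UNIV"
    by (intro sums_nonneg_imp_has_sum) (simp_all add: field_simps)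
  have "bij_betw (\<lambda>n. int n + 2) UNIV {2..}"
    by (rule bij_betwI[where g = "\<lambda>k. nat (k - 2)"]) auto
  moreover have "(\<lambda>n. majorant (int n + 2)) = (\<lambda>n. (1 / 10) ^ Suc n)"
    unfolding majorant_def by (rule ext) (simp add: power_int_add)
  ultimately have 1: "(majorant has_sum 1 / 9) {2..}"
    using has_sum_reindex_bij_betw[of "\<lambda>n. int n + 2" UNIV "{2..}" majorant "1 / 9"] g by metis
  have "bij_betw (\<lambda>n. - 1 - int n) UNIV {..- 1}"
    by (rule bij_betwI[where g = "\<lambda>k. nat (- 1 - k)"]) auto
  moreover have "(\<lambda>n. majorant (- 1 - int n)) = (\<lambda>n. (1 / 10) ^ Suc n)"
    unfolding majorant_def by (rule ext) (simp add: power_int_add)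
  ultimately have 2: "(majorant has_sum 1 / 9) {..- 1}"
    using has_sum_reindex_bij_betw[of "\<lambda>n. - 1 - int n" UNIV "{..- 1}" majorant "1 / 9"] g by metis
  have "- {0, 1} = {2..} \<union> {..- 1 :: int}" by auto
  then show ?thesis using has_sum_Un_disjoint[OF 1 2] by force
qed

text \<open>For negative \<open>k\<close> the powers of the node grow, but the quadratic exponent
  \<open>tri k\<close> wins: tri k + k n stays above the exponent of the majorant minus (n + 2)^2.
  The second bound loses no constant and serves the numerical estimate in
  \<open>weight_total\<close>.\<close>

lemma theta_node_bound:
  assumes "k \<notin> {0, 1}"
  shows "\<bar>theta k * node k ^ n\<bar> \<le> (1 / 10) powi (- (int n + 2)\<^sup>2) * majorant k" "\<bar>theta k\<bar> \<le> majorant k"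
proof -
  define e where "e = (if 2 \<le> k then k - 1 else - k)"
  have k: "2 \<le> k \<or> k \<le> - 1" using assms by auto
  have sq: "x\<^sup>2 + x \<ge> 0" for x :: int
    by (cases "0 \<le> x") (use mult_nonneg_nonneg[of x "x + 1"] mult_nonpos_nonpos[of x "x + 1"] in
      \<open>auto simp: power2_eq_square algebra_simps\<close>)
  have "0 \<le> k * (k - 1) - 2 * e"
  proof (cases "2 \<le> k")
    case True
    then have "0 \<le> (k - 1) * (k - 2)" by simp
    then show ?thesis using True by (simp add: e_def algebra_simps)
  next
    case False
    then show ?thesis using sq[of k] by (simp add: e_def algebra_simps power2_eq_square)
  qed
  then have te: "e \<le> tri k" using two_tri[of k] by linarith
  have "0 \<le> 2 * (tri k + k * int n - e + (int n + 2)\<^sup>2)"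
  proof (cases "2 \<le> k")
    case True
    then have "0 \<le> k * int n" by simp
    moreover have "0 \<le> a \<Longrightarrow> 0 \<le> b \<Longrightarrow> d \<le> c \<Longrightarrow> 0 \<le> 2 * (c + a - d + b)" for a b c d :: int by simp
    ultimately show ?thesis using te zero_le_power2 by blast
  next
    case False
    \<comment> \<open>Completing the square. The expression x^2 + x is nonnegative at every integer,
      and (n + 2)^2 is large enough to leave the positive remainder n^2 + 7 n + 8.\<close>
    have "2 * (tri k + k * int n - e + (int n + 2)\<^sup>2) = ((k + int n)\<^sup>2 + (k + int n)) + (int n)\<^sup>2 + 7 * int n + 8"
      unfolding right_diff_distrib distrib_left two_tri using False
      by (simp add: e_def algebra_simps power2_eq_square)
    then show ?thesis using sq[of "k + int n"] zero_le_power2[of "int n"] by linarith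
  qed
  then have le: "e - (int n + 2)\<^sup>2 \<le> tri k + k * int n" by simp
  have mono: "(1 / 10 :: real) powi a \<le> (1 / 10) powi b" if "b \<le> a" for a b
    using that by (intro power_int_decreasing) auto
  show "\<bar>theta k\<bar> \<le> majorant k"
    unfolding abs_theta majorant_def e_def[symmetric] by (rule mono[OF te])
  have "(1 / 10 :: real) powi (- (int n + 2)\<^sup>2) * majorant k = (1 / 10) powi (e - (int n + 2)\<^sup>2)"
    unfolding majorant_def e_def[symmetric] by (simp flip: power_int_add)
  then show "\<bar>theta k * node k ^ n\<bar> \<le> (1 / 10) powi (- (int n + 2)\<^sup>2) * majorant k"
    unfolding abs_theta_node_power using mono[OF le] by simp
qed

lemma theta_summable: "(\<lambda>k. \<bar>theta k * node k ^ n\<bar>) summable_on UNIV"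
proof -
  have "(\<lambda>k. \<bar>theta k * node k ^ n\<bar>) summable_on (- {0, 1})"
    by (rule summable_on_comparison_test[OF summable_on_cmult_right[OF has_sum_imp_summable[OF majorant_has_sum]]])
       (use theta_node_bound(1) in auto)
  moreover have "(\<lambda>k. \<bar>theta k * node k ^ n\<bar>) summable_on {0, 1}" by simp
  ultimately have "(\<lambda>k. \<bar>theta k * node k ^ n\<bar>) summable_on (- {0, 1} \<union> {0, 1})"
    by (rule summable_on_Un_disjoint) auto
  then show ?thesis by (simp only: Compl_partition2)
qed

lemma abs_weight_le: "\<bar>weight k\<bar> \<le> \<bar>theta k\<bar>"
  using node_pos[of k] by (simp add: weight_def abs_divide divide_le_eq mult_le_cancel_left1)

lemma weight_abs_summable: "(\<lambda>k. \<bar>weight k * node k ^ n\<bar>) summable_on UNIV"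
  by (rule summable_on_comparison_test[OF theta_summable[of n]])
     (auto simp: abs_mult intro!: mult_right_mono abs_weight_le)

lemma weight_summable: "(\<lambda>k. weight k * node k ^ n) summable_on UNIV"
  by (rule abs_summable_summable) (use weight_abs_summable in simp)

lemma weight_moment: "infsum (\<lambda>k. weight k * node k ^ n) UNIV = (- 1) ^ n * infsum weight UNIV"
proof (induction n)
  case (Suc n)
  have "infsum (\<lambda>k. weight k * node k ^ n) UNIV + infsum (\<lambda>k. weight k * node k ^ Suc n) UNIV =
      infsum (\<lambda>k. weight k * node k ^ n + weight k * node k ^ Suc n) UNIV"
    by (intro infsum_add[symmetric] weight_summable)
  also have "(\<lambda>k. weight k * node k ^ n + weight k * node k ^ Suc n) = (\<lambda>k. theta k * node k ^ n)"
  proof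
    fix k
    have "weight k * (1 + node k) = theta k" using node_pos[of k] by (simp add: weight_def)
    then show "weight k * node k ^ n + weight k * node k ^ Suc n = theta k * node k ^ n"
      by (metis (no_types, opaque_lifting) distrib_left mult.assoc mult.commute mult.right_neutral power_Suc)
  qed
  finally show ?case using Suc by (simp add: theta_moment)
qed simp

text \<open>The two central weights are 1/2 and -10/11, with sum -9/22. All others together are at
  most 2/9 < 9/22 in absolute value; the small base 1/10 makes this crude comparison
  succeed.\<close>

lemma weight_total: "infsum weight UNIV < 0"
proof -
  have s: "weight summable_on S" for S
    using weight_summable[of 0] summable_on_subset_banach by (metis (no_types, lifting) mult.right_neutral power_0 subset_UNIV summable_on_cong)
  have "infsum weight UNIV = infsum weight ({0, 1} \<union> - {0, 1})" by simp
  also have "\<dots> = infsum weight {0, 1} + infsum weight (- {0, 1})"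
    by (intro infsum_Un_disjoint s) auto
  also have "infsum weight {0, 1} = - 9 / 22"
    by (simp add: weight_def theta_def node_def tri_def)
  finally have eq: "infsum weight UNIV = - 9 / 22 + infsum weight (- {0, 1})" .
  have "norm (infsum weight (- {0, 1})) \<le> 2 / 9"
    using abs_weight_le theta_node_bound(2) order_trans
    by (intro norm_infsum_le[OF has_sum_infsum[OF s] majorant_has_sum]) fastforce
  then show ?thesis unfolding eq by simp
qed

text \<open>The weights divided by their total, with the integers enumerated by the naturals.
  Moments equal to 1 at the negative nodes \<open>- r j\<close> are what a reflection needs for
  derivatives of every order to match at 0.\<close>

lemma exists_moment_sequence:
  obtains w r :: "nat \<Rightarrow> real"
  where "\<And>j. 0 < r j" "\<And>n. summable (\<lambda>j. \<bar>w j\<bar> * r j ^ n)" "\<And>n. (\<lambda>j. w j * (- r j) ^ n) sums 1"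
proof
  define m where "m = infsum weight UNIV"
  have m: "m \<noteq> 0" using weight_total by (simp add: m_def)
  show "0 < node (int_decode j)" for j by (rule node_pos)
  show "summable (\<lambda>j. \<bar>weight (int_decode j) / m\<bar> * node (int_decode j) ^ n)" for n
  proof -
    have "(\<lambda>j. \<bar>weight (int_decode j) * node (int_decode j) ^ n\<bar>) summable_on UNIV"
      using summable_on_reindex_bij_betw[OF bij_int_decode, of "\<lambda>k. \<bar>weight k * node k ^ n\<bar>"] weight_abs_summable by simp
    then have "summable (\<lambda>j. (1 / \<bar>m\<bar>) * \<bar>weight (int_decode j) * node (int_decode j) ^ n\<bar>)"
      by (intro summable_mult summable_on_imp_summable)
    then show ?thesis using node_pos by (simp add: abs_mult abs_divide less_imp_le)
  qed
  show "(\<lambda>j. weight (int_decode j) / m * (- node (int_decode j)) ^ n) sums 1" for n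
  proof -
    have "((\<lambda>k. weight k * node k ^ n) has_sum (- 1) ^ n * m) UNIV"
      using has_sum_infsum[OF weight_summable[of n]] unfolding weight_moment m_def .
    then have "((\<lambda>j. weight (int_decode j) * node (int_decode j) ^ n) has_sum (- 1) ^ n * m) UNIV"
      using has_sum_reindex_bij_betw[OF bij_int_decode, of "\<lambda>k. weight k * node k ^ n"] by simp
    from sums_mult[OF has_sum_imp_sums[OF this], of "(- 1) ^ n / m"]
    have "(\<lambda>j. (- 1) ^ n / m * (weight (int_decode j) * node (int_decode j) ^ n)) sums ((- 1) ^ n / m * ((- 1) ^ n * m))" .
    moreover have 1: "(- 1) ^ n / m * ((- 1) ^ n * m) = 1" using m by (simp flip: power_mult_distrib)
    moreover have 2: "(- 1) ^ n / m * (weight k * node k ^ n) = weight k / m * (- node k) ^ n" for k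
      by (simp add: power_minus[of "node k"])
    ultimately show ?thesis unfolding 1 2 by blast
  qed
qed

section \<open>Extension of h (sqrt x, v) to negative x\<close>

locale moment_sequence =
  fixes w r :: "nat \<Rightarrow> real"
  assumes r_pos: "0 < r j"
    and summable: "summable (\<lambda>j. \<bar>w j\<bar> * r j ^ n)"
    and moments: "(\<lambda>j. w j * (- r j) ^ n) sums 1"
begin

text \<open>With H(x, v) = h (sqrt x, v) for x \<ge> 0, the extension to x \<le> 0 is the sum of w_j
  H(- r_j x, v). Each derivative in \<open>x\<close> multiplies the terms by \<open>- r j\<close>;
  the exponent \<open>n\<close> counts how often this has happened.\<close>

definition series :: "nat \<Rightarrow> (real \<times> real \<Rightarrow> real) \<Rightarrow> real \<times> real \<Rightarrow> real" where
  "series n h z = (\<Sum>j. w j * (- r j) ^ n * h (sqrt (- fst z * r j), snd z))"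

definition extend :: "nat \<Rightarrow> (real \<times> real \<Rightarrow> real) \<Rightarrow> real \<times> real \<Rightarrow> real" where
  "extend n h z = (if fst z \<le> 0 then series n h z else h (sqrt (fst z), snd z))"

text \<open>The Weierstrass M-test. The bound on \<open>h\<close> is global, so the arguments
  \<open>a\<close> and \<open>b\<close> may be arbitrary.\<close>

lemma uniform_terms:
  assumes "bsmooth h"
  shows "uniform_limit A (\<lambda>N z. \<Sum>j<N. w j * (- r j) ^ n * h (a j z, b j z)) (\<lambda>z. \<Sum>j. w j * (- r j) ^ n * h (a j z, b j z)) sequentially"
    and "summable (\<lambda>j. w j * (- r j) ^ n * h (a j z, b j z))"
proof -
  obtain C where C: "\<And>z. \<bar>h z\<bar> \<le> C" using bsmoothD(4)[OF assms] by blast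
  have le: "norm (w j * (- r j) ^ n * h (a j z, b j z)) \<le> \<bar>w j\<bar> * r j ^ n * C" for j z
  proof -
    have "norm (w j * (- r j) ^ n * h (a j z, b j z)) = (\<bar>w j\<bar> * r j ^ n) * \<bar>h (a j z, b j z)\<bar>"
      using r_pos[of j] by (simp add: abs_mult power_abs)
    also have "\<dots> \<le> (\<bar>w j\<bar> * r j ^ n) * C"
      using r_pos[of j] by (intro mult_left_mono C mult_nonneg_nonneg) simp_all
    finally show ?thesis .
  qed
  have s: "summable (\<lambda>j. \<bar>w j\<bar> * r j ^ n * C)" by (rule summable_mult2[OF summable])
  show "uniform_limit A (\<lambda>N z. \<Sum>j<N. w j * (- r j) ^ n * h (a j z, b j z)) (\<lambda>z. \<Sum>j. w j * (- r j) ^ n * h (a j z, b j z)) sequentially"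
    by (rule Weierstrass_m_test[OF le s])
  show "Series.summable (\<lambda>j. w j * (- r j) ^ n * h (a j z, b j z))"
    by (rule summable_comparison_test'[OF s le])
qed

lemma series_zero: "series n h (0, v) = h (0, v)"
  using sums_mult2[OF moments[of n], of "h (0, v)"] by (simp add: series_def sums_iff)

lemma continuous_extend:
  assumes "bsmooth h"
  shows "continuous_on UNIV (extend n h)"
  unfolding extend_def
proof (rule continuous_on_cases_le)
  have "continuous_on UNIV (series n h)"
    unfolding series_def
    by (rule uniform_limit_theorem[OF _ uniform_terms(1)[OF assms]])
       (auto intro!: always_eventually continuous_intros bsmooth_continuous_compose[OF assms])
  then show "continuous_on {z \<in> UNIV. fst z \<le> 0} (series n h)" using continuous_on_subset by blast
  show "continuous_on {z \<in> UNIV. 0 \<le> fst z} (\<lambda>z. h (sqrt (fst z), snd z))"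
    by (intro bsmooth_continuous_compose[OF assms] continuous_intros)
  show "series n h z = h (sqrt (fst z), snd z)" if "fst z = 0" for z
    using that by (cases z) (simp add: series_zero)
qed (intro continuous_intros)

text \<open>One-sided derivatives are found on the two closed half-lines, by
  \<open>DERIV_even_sqrt\<close> on the right and by termwise differentiation on the left. At 0 they
  coincide because the moment of order n + 1 is again 1, so they combine to a two-sided derivative
  of the same form.\<close>

lemma extend_dx:
  assumes h: "bsmooth h" "even_fst h"
  shows "((\<lambda>x. extend n h (x, v)) has_real_derivative extend (Suc n) (quot_dx h) (x, v)) (at x)"
proof -
  let ?q = "quot_dx h"
  have right: "((\<lambda>x. extend n h (x, v)) has_real_derivative extend (Suc n) ?q (x, v)) (at x within {0..})" if "0 \<le> x" for x
  proof -
    have "extend n h (y, v) = h (sqrt y, v)" "extend (Suc n) ?q (y, v) = ?q (sqrt y, v)" if "0 \<le> y" for y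
      using that by (auto simp: extend_def series_zero)
    then show ?thesis
      using DERIV_even_sqrt[OF h that, of v] that
      by (auto elim!: has_field_derivative_transform_within[where d = 1])
  qed
  have left: "((\<lambda>x. extend n h (x, v)) has_real_derivative extend (Suc n) ?q (x, v)) (at x within {..0})" if x: "x \<le> 0" for x
  proof -
    let ?t = "\<lambda>j x. w j * (- r j) ^ n * h (sqrt (- x * r j), v)"
    let ?t' = "\<lambda>j x. w j * (- r j) ^ Suc n * ?q (sqrt (- x * r j), v)"
    have deriv_term: "(?t j has_real_derivative ?t' j x) (at x within {..0})" if "x \<in> {..0}" for j x
    proof -
      have "((\<lambda>x. h (sqrt x, v)) \<circ> (\<lambda>x. - x * r j) has_real_derivative ?q (sqrt (- x * r j), v) * (- r j)) (at x within {..0})"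
      proof (rule DERIV_image_chain)
        have "(\<lambda>x. - x * r j) ` {..0} \<subseteq> {0..}" using r_pos[of j] by (auto simp: mult_nonpos_nonneg less_imp_le)
        moreover have "0 \<le> - x * r j" using that r_pos[of j] by (auto simp: mult_nonpos_nonneg less_imp_le)
        ultimately show "((\<lambda>x. h (sqrt x, v)) has_real_derivative ?q (sqrt (- x * r j), v)) (at (- x * r j) within (\<lambda>x. - x * r j) ` {..0})"
          using DERIV_subset[OF DERIV_even_sqrt[OF h]] by blast
      qed (auto intro!: derivative_eq_intros)
      from DERIV_cmult[OF this, of "w j * (- r j) ^ n"] show ?thesis by (simp add: o_def mult_ac)
    qed
    have sm: "Series.summable (\<lambda>j. ?t j 0)" by (rule uniform_terms(2)[OF h(1)])
    have "\<exists>G. \<forall>x\<in>{..0}. (\<lambda>j. ?t j x) sums G x \<and> (G has_real_derivative (\<Sum>j. ?t' j x)) (at x within {..0})"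
      by (rule has_field_derivative_series[OF _ deriv_term uniform_terms(1)[OF quot_dx(1)[OF h]] _ sm])
         (auto simp: convex_real_interval)
    then obtain G where G: "\<And>x. x \<in> {..0} \<Longrightarrow> (\<lambda>j. ?t j x) sums G x"
      "\<And>x. x \<in> {..0} \<Longrightarrow> (G has_real_derivative (\<Sum>j. ?t' j x)) (at x within {..0})"
      by blast
    have "extend n h (y, v) = G y" if "y \<in> {..0}" for y
      using G(1)[OF that] that by (simp add: extend_def series_def sums_iff)
    moreover have "extend (Suc n) ?q (x, v) = (\<Sum>j. ?t' j x)" using x by (simp add: extend_def series_def)
    ultimately show ?thesis
      using G(2)[of x] x by (auto elim!: has_field_derivative_transform_within[where d = 1])
  qed
  consider "x < 0" | "x = 0" | "0 < x" by linarith
  then show ?thesis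
  proof cases
    case 1
    then have "at x within {..0} = at x" by (intro at_within_interior) simp
    then show ?thesis using left[of x] 1 by simp
  next
    case 2
    have "((\<lambda>x. extend n h (x, v)) has_real_derivative extend (Suc n) ?q (x, v)) (at x within {0..} \<union> {..0})"
      using left[of x] right[of x] 2 by (simp add: has_field_derivative_iff Lim_within_Un del: Un_iff)
    moreover have "{0..} \<union> {..0} = (UNIV :: real set)" by auto
    ultimately show ?thesis by simp
  next
    case 3
    then have "at x within {0..} = at x" by (intro at_within_interior) simp
    then show ?thesis using right[of x] 3 by simp
  qed
qed

lemma extend_dy:
  assumes h: "bsmooth h"
  shows "((\<lambda>y. extend n h (x, y)) has_real_derivative extend n (dy h) (x, y)) (at y)"
proof (cases "x \<le> 0")
  case False
  then show ?thesis using bsmooth_partials(2)[OF h] by (simp add: extend_def)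
next
  case True
  let ?t = "\<lambda>j y. w j * (- r j) ^ n * h (sqrt (- x * r j), y)"
  let ?t' = "\<lambda>j y. w j * (- r j) ^ n * dy h (sqrt (- x * r j), y)"
  have "((\<lambda>y. \<Sum>j. ?t j y) has_real_derivative (\<Sum>j. ?t' j y)) (at y)"
  proof (rule has_field_derivative_series'(2))
    show "(?t j has_real_derivative ?t' j y) (at y within UNIV)" for j y
      by (intro DERIV_cmult bsmooth_partials(2)[OF h])
    show "uniformly_convergent_on UNIV (\<lambda>N y. \<Sum>j<N. ?t' j y)"
      unfolding uniformly_convergent_on_def
      by (rule exI, rule uniform_terms(1)[OF bsmoothD(3)[OF h], where a = "\<lambda>j _. sqrt (- x * r j)" and b = "\<lambda>_ y. y"])
    show "Series.summable (\<lambda>j. ?t j 0)" by (rule uniform_terms(2)[OF h])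
  qed auto
  then show ?thesis using True by (simp add: extend_def series_def)
qed

text \<open>The derivatives of an extension are built from extensions of \<open>quot_dx h\<close>
  and \<open>dy h\<close>, which are even and of class \<open>bsmooth\<close> again; hence the
  induction on \<open>k\<close> leaves \<open>n\<close> and \<open>h\<close> free.\<close>

lemma Ck_extend: "bsmooth h \<Longrightarrow> even_fst h \<Longrightarrow> Ck_on k UNIV (extend n h)"
proof (induction k arbitrary: n h)
  case 0
  then show ?case by (simp add: continuous_extend)
next
  case (Suc k)
  note h = Suc.prems
  let ?x = "extend (Suc n) (quot_dx h)" and ?y = "extend n (dy h)"
  have cx: "Ck_on k UNIV ?x" and cy: "Ck_on k UNIV ?y"
    using quot_dx[OF h] bsmoothD(3)[OF h(1)] even_fst_dy[OF h] by (auto intro: Suc.IH)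
  show ?case
  proof (rule Ck_on_SucI[OF open_UNIV has_derivative_real_partials[OF extend_dx[OF h] extend_dy[OF h(1)]]])
    show "continuous_on UNIV ?y" by (rule continuous_extend[OF bsmoothD(3)[OF h(1)]])
    fix v :: "real \<times> real"
    have "Ck_on k UNIV (\<lambda>z. fst v * ?x z + snd v * ?y z)"
      by (intro Ck_on_add Ck_on_bilinear[OF _ bounded_bilinear_mult] Ck_on_const cx cy open_UNIV)
    then show "Ck_on k UNIV (\<lambda>z. (case v of (a, b) \<Rightarrow> a * ?x z + b * ?y z))"
      by (simp add: case_prod_unfold)
  qed
qed

end

theorem whitney_even:
  assumes h: "bsmooth h" "even_fst h"
  obtains H where "smooth_on UNIV H" "\<And>s v. h (s, v) = H (s\<^sup>2, v)"
proof -
  obtain w r :: "nat \<Rightarrow> real" where "moment_sequence w r"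
    using exists_moment_sequence unfolding moment_sequence_def by metis
  then interpret moment_sequence w r .
  have "h (s, v) = extend 0 h (s\<^sup>2, v)" for s v
    using h(2) by (cases "0 \<le> s") (auto simp: extend_def even_fst_def series_zero)
  then show ?thesis using that[of "extend 0 h"] Ck_extend[OF h] by (simp add: smooth_on_def)
qed

text \<open>The even part is a function of s^2 by \<open>whitney_even\<close>. The odd part is
  divided by \<open>s\<close> three times: \<open>d\<close> and \<open>d2\<close> vanish at s = 0 by
  parity, \<open>d1\<close> because the first derivative of \<open>F\<close> does. The quotient
  \<open>d3\<close> is even, hence again a function of s^2.\<close>

theorem even_odd_normal_form:
  assumes F: "bsmooth F" and F0: "\<And>v. dx F (0, v) = 0"
  obtains A B where "smooth_on UNIV A" "smooth_on UNIV B" "\<And>s v. F (s, v) = A (s\<^sup>2, v) + s ^ 3 * B (s\<^sup>2, v)"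
proof -
  define e where "e z = (1/2) * F z + (1/2) * F (- fst z, snd z)" for z
  define d where "d z = (1/2) * F z + (- 1/2) * F (- fst z, snd z)" for z
  have be: "bsmooth e" unfolding e_def[abs_def] by (rule bsmooth_combine[OF F F])
  have bd: "bsmooth d" unfolding d_def[abs_def] by (rule bsmooth_combine[OF F F])
  have ee: "even_fst e" by (simp add: even_fst_def e_def)
  have odd_d: "d (- s, v) = - 1 * d (s, v)" for s v by (simp add: d_def)
  define d1 where "d1 = ray_integral 0 (dx d)"
  define d2 where "d2 = ray_integral 0 (dx d1)"
  define d3 where "d3 = ray_integral 0 (dx d2)"
  have b: "bsmooth d1" "bsmooth d2" "bsmooth d3"
    unfolding d1_def d2_def d3_def by (intro bsmooth_ray_integral bsmoothD(2) bd)+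
  have even1: "d1 (- s, v) = 1 * d1 (s, v)" for s v
    unfolding d1_def by (rule ray_integral_reflect) (use dx_reflect(1)[OF bd odd_d] in simp)
  have odd2: "d2 (- s, v) = - 1 * d2 (s, v)" for s v
    unfolding d2_def by (rule ray_integral_reflect) (use dx_reflect(1)[OF b(1) even1] in simp)
  have even3: "d3 (- s, v) = 1 * d3 (s, v)" for s v
    unfolding d3_def by (rule ray_integral_reflect) (use dx_reflect(1)[OF b(2) odd2] in simp)
  have dd: "d (s, v) = s * d1 (s, v)" for s v
    using ray_integral_dx[OF bd, of s v] odd_d[of 0 v] by (simp add: d1_def)
  have d1_0: "d1 (0, v) = 0" for v
  proof -
    have "((\<lambda>s. F (- s, v)) has_real_derivative dx F (- 0, v) * (- 1)) (at 0)"
      by (rule DERIV_chain'[where f = uminus and g = "\<lambda>x. F (x, v)", OF _ bsmooth_partials(1)[OF F], THEN DERIV_cong])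
         (auto intro!: derivative_eq_intros)
    from DERIV_add[OF DERIV_cmult[OF bsmooth_partials(1)[OF F, of v 0], of "1/2"] DERIV_cmult[OF this, of "- 1/2"]]
    have "((\<lambda>s. d (s, v)) has_real_derivative 0) (at 0)" by (simp add: d_def F0)
    then have "dx d (0, v) = 0" using bsmooth_partials(1)[OF bd] DERIV_unique by blast
    then show ?thesis by (simp add: d1_def ray_integral_def)
  qed
  have d1: "d1 (s, v) = s * d2 (s, v)" for s v
    using ray_integral_dx[OF b(1), of s v] d1_0 by (simp add: d2_def)
  have d2: "d2 (s, v) = s * d3 (s, v)" for s v
    using ray_integral_dx[OF b(2), of s v] odd2[of 0 v] by (simp add: d3_def)
  obtain A where A: "smooth_on UNIV A" "\<And>s v. e (s, v) = A (s\<^sup>2, v)" using whitney_even[OF be ee] by blast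
  obtain B where B: "smooth_on UNIV B" "\<And>s v. d3 (s, v) = B (s\<^sup>2, v)"
    using whitney_even[OF b(3)] even3 by (auto simp: even_fst_def)
  have "F (s, v) = A (s\<^sup>2, v) + s ^ 3 * B (s\<^sup>2, v)" for s v
  proof -
    have "F (s, v) = e (s, v) + d (s, v)" by (simp add: e_def d_def)
    also have "d (s, v) = s ^ 3 * d3 (s, v)" by (simp add: dd d1 d2 power3_eq_cube)
    finally show ?thesis by (simp add: A(2) B(2))
  qed
  then show ?thesis using that A(1) B(1) by blast
qed

section \<open>Fronts in coordinates\<close>

lemma bounded_bilinear_cross3: "bounded_bilinear cross3"
  using bilinear_conv_bounded_bilinear bilinear_cross by blast

lemmas has_derivative_cross3 = bounded_bilinear.FDERIV[OF bounded_bilinear_cross3]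
lemmas has_vector_derivative_cross3 = bounded_bilinear.has_vector_derivative[OF bounded_bilinear_cross3]

lemma vec2_expand: "v = v $ 1 *\<^sub>R axis 1 1 + v $ 2 *\<^sub>R axis 2 1" for v :: "real ^ 2"
  by (simp add: vec_eq_iff forall_2 axis_def)

lemma linear_vec2: "linear f \<Longrightarrow> f v = v $ 1 *\<^sub>R f (axis 1 1) + v $ 2 *\<^sub>R f (axis 2 1)" for v :: "real ^ 2"
  by (subst vec2_expand) (simp add: linear_add linear_cmul)

lemma linear_vec2_inj:
  assumes "linear f" "\<And>a b. a *\<^sub>R f (axis 1 1) + b *\<^sub>R f (axis 2 1) = 0 \<Longrightarrow> a = 0 \<and> b = (0::real)"
  shows "inj (f :: real ^ 2 \<Rightarrow> 'a::real_vector)"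
  unfolding linear_injective_0[OF assms(1)]
proof (intro allI impI)
  fix v assume "f v = 0"
  then have "v $ 1 = 0 \<and> v $ 2 = 0" using assms(2) linear_vec2[OF assms(1), of v] by metis
  then show "v = 0" by (simp add: vec_eq_iff forall_2)
qed

lemma orthogonal_line_vec2:
  fixes a b :: real and h :: "real ^ 2"
  assumes "a * h $ 1 + b * h $ 2 = 0" "a \<noteq> 0 \<or> b \<noteq> 0"
  obtains c where "h = c *\<^sub>R vector [- b, a]"
proof (rule that)
  define c where "c = (a * h $ 2 - b * h $ 1) / (a\<^sup>2 + b\<^sup>2)"
  have n: "a\<^sup>2 + b\<^sup>2 \<noteq> 0" using assms(2) by (simp add: sum_power2_eq_zero_iff)
  have "(a\<^sup>2 + b\<^sup>2) * h $ 1 = - b * (a * h $ 2 - b * h $ 1)" "(a\<^sup>2 + b\<^sup>2) * h $ 2 = a * (a * h $ 2 - b * h $ 1)"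
    using assms(1) by algebra+
  then have "h $ 1 = c * (- b)" "h $ 2 = c * a"
    unfolding c_def using n by (simp_all add: field_simps)
  then show "h = c *\<^sub>R vector [- b, a]"
    by (simp add: vec_eq_iff forall_2)
qed

lemma cross3_det2:
  "cross3 (a $ 1 *\<^sub>R p + a $ 2 *\<^sub>R q) (b $ 1 *\<^sub>R p + b $ 2 *\<^sub>R q) = det (vector [a, b] :: real ^ 2 ^ 2) *\<^sub>R cross3 p q"
proof -
  have qp: "cross3 q p = - cross3 p q" by (rule cross_skew)
  have "cross3 (a $ 1 *\<^sub>R p + a $ 2 *\<^sub>R q) (b $ 1 *\<^sub>R p + b $ 2 *\<^sub>R q) =
      (a $ 1 * b $ 2) *\<^sub>R cross3 p q - (a $ 2 * b $ 1) *\<^sub>R cross3 p q"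
    by (simp add: cross_add_left cross_add_right cross_mult_left cross_mult_right qp mult.commute)
  then show ?thesis by (simp add: det_2 scaleR_diff_left mult.commute)
qed

text \<open>Both factors are orthogonal to \<open>m\<close>, so their cross product is parallel to
  \<open>m\<close>, and pairing with \<open>n\<close> gives the factor. Parallelism appears as m
  \<times> (p \<times> q) = 0 and is resolved by a further cross product with
  \<open>n\<close>.\<close>

lemma cross3_conormal:
  assumes "p \<bullet> m = 0" "q \<bullet> m = 0" "m \<bullet> n = 1"
  shows "cross3 p q = (cross3 p q \<bullet> n) *\<^sub>R m"
proof -
  have "cross3 m (cross3 p q) = 0" using assms(1,2) by (simp add: Lagrange inner_commute)
  then have "0 = cross3 n (cross3 m (cross3 p q))" by simp
  also have "\<dots> = (cross3 p q \<bullet> n) *\<^sub>R m - cross3 p q"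
    unfolding Lagrange[of n m] using assms(3) by (simp only: inner_commute[of n] scaleR_one)
  finally show ?thesis by simp
qed

lemma cross3_inner_det: "cross3 p q \<bullet> n = det (vector [p, q, n] :: real ^ 3 ^ 3)"
  by (simp add: cross3_simps)

text \<open>\<open>M\<close> is the covector dual to the unit normal \<open>N\<close>; using it instead of a metric keeps
  derivatives of the metric out of the computations.\<close>

locale conormal_front =
  fixes U :: "(real ^ 2) set" and F N M :: "real ^ 2 \<Rightarrow> real ^ 3"
  assumes open_U: "open U"
    and smooth_F: "smooth_on U F" and smooth_N: "smooth_on U N" and smooth_M: "smooth_on U M"
    and tangent_M: "x \<in> U \<Longrightarrow> frechet_derivative F (at x) v \<bullet> M x = 0"
    and M_N: "x \<in> U \<Longrightarrow> M x \<bullet> N x = 1"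
begin

definition D :: "real ^ 2 \<Rightarrow> real ^ 2 \<Rightarrow> real ^ 3" where
  "D x = frechet_derivative F (at x)"

text \<open>The Euclidean determinant, without the factor sqrt (det g) of the volume form. That
  factor is positive, so zeros and the signs of derivatives at zeros are the same; it is restored
  later by \<open>rho\<close>.\<close>

definition area :: "real ^ 2 \<Rightarrow> real" where
  "area x = det (vector [D x (axis 1 1), D x (axis 2 1), N x] :: real ^ 3 ^ 3)"

definition row :: "3 \<Rightarrow> real ^ 2 \<Rightarrow> real ^ 2 \<Rightarrow> real" where
  "row i x v = D x v $ i"

text \<open>The \<open>i\<close>-th row of the Jacobian matrix, turned by a right angle. It is
  smooth on all of \<open>U\<close> and annihilated by row \<open>i\<close>, but a null vector of dF
  only on the singular set. It may vanish, which is why \<open>i\<close> stays a parameter.\<close>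

definition null :: "3 \<Rightarrow> real ^ 2 \<Rightarrow> real ^ 2" where
  "null i x = vector [- row i x (axis 2 1), row i x (axis 1 1)]"

lemma F_has_derivative: "x \<in> U \<Longrightarrow> (F has_derivative D x) (at x)"
  unfolding D_def by (rule smooth_on_has_derivative[OF open_U smooth_F])

lemma linear_D: "x \<in> U \<Longrightarrow> linear (D x)"
  using F_has_derivative has_derivative_linear by blast

lemma smooth_D: "smooth_on U (\<lambda>x. D x v)"
  unfolding D_def by (rule smooth_on_frechet[OF smooth_F])

lemma smooth_area: "smooth_on U area"
  unfolding area_def by (intro smooth_on_det3 open_U smooth_D smooth_N)

lemma area_has_derivative: "x \<in> U \<Longrightarrow> (area has_derivative frechet_derivative area (at x)) (at x)"
  by (rule smooth_on_has_derivative[OF open_U smooth_area])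

lemma smooth_row: "smooth_on U (\<lambda>x. row i x v)"
  unfolding row_def by (intro smooth_on_vec_nth open_U smooth_D)

lemma smooth_null: "smooth_on U (null i)"
  unfolding null_def by (intro smooth_on_vector2 smooth_on_minus open_U smooth_row)

text \<open>Converts vanishing of \<open>area\<close> into linear dependence of image vectors, and
  gives access to the derivative of \<open>area\<close> through that of a cross product.\<close>

lemma cross3_D:
  assumes "x \<in> U"
  shows "cross3 (D x a) (D x b) = (det (vector [a, b] :: real ^ 2 ^ 2) * area x) *\<^sub>R M x"
proof -
  have "cross3 (D x (axis 1 1)) (D x (axis 2 1)) = area x *\<^sub>R M x"
    using cross3_conormal[OF tangent_M[OF assms] tangent_M[OF assms] M_N[OF assms]]
    by (metis D_def area_def cross3_inner_det)
  then show ?thesis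
    by (simp add: linear_vec2[OF linear_D[OF assms], of a] linear_vec2[OF linear_D[OF assms], of b] cross3_det2)
qed

lemma M_nonzero: "x \<in> U \<Longrightarrow> M x \<noteq> 0"
  using M_N by fastforce

lemma area_eq_0_iff: "x \<in> U \<Longrightarrow> area x = 0 \<longleftrightarrow> cross3 (D x (axis 1 1)) (D x (axis 2 1)) = 0"
  using cross3_D[of x "axis 1 1" "axis 2 1"] M_nonzero[of x] by (simp add: det_2 axis_def)

text \<open>By Lagrange's identity dF(null) is the double product e_i \<times> (F_v \<times> F_u),
  and F_v \<times> F_u vanishes with the area density.\<close>

lemma D_null:
  assumes x: "x \<in> U" and 0: "area x = 0"
  shows "D x (null i x) = 0"
proof -
  have "cross3 (axis i 1) (cross3 (D x (axis 2 1)) (D x (axis 1 1))) = D x (null i x)"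
    unfolding Lagrange using linear_vec2[OF linear_D[OF x], of "null i x"]
    by (simp add: null_def row_def inner_axis' inner_axis)
  then show ?thesis using cross3_D[OF x] 0 by simp
qed

lemma inj_D_iff:
  assumes x: "x \<in> U"
  shows "inj (D x) \<longleftrightarrow> area x \<noteq> 0"
proof
  assume "area x \<noteq> 0"
  show "inj (D x)"
  proof (rule linear_vec2_inj[OF linear_D[OF x]])
    fix a b :: real
    let ?p = "D x (axis 1 1)" and ?q = "D x (axis 2 1)"
    assume z: "a *\<^sub>R ?p + b *\<^sub>R ?q = 0"
    have "a *\<^sub>R cross3 ?p ?q = 0" "b *\<^sub>R cross3 ?p ?q = 0"
      using arg_cong[OF z, of "\<lambda>w. cross3 w ?q"] arg_cong[OF z, of "\<lambda>w. cross3 ?p w"]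
      by (simp_all add: cross_add_left cross_add_right cross_mult_left cross_mult_right)
    then show "a = 0 \<and> b = 0" using \<open>area x \<noteq> 0\<close> area_eq_0_iff[OF x] by simp
  qed
next
  assume inj: "inj (D x)"
  show "area x \<noteq> 0"
  proof
    assume 0: "area x = 0"
    have "null i x = 0" for i
      using D_null[OF x 0] inj[unfolded linear_injective_0[OF linear_D[OF x]]] by blast
    then have "D x (axis 1 1) = 0"
      by (simp add: null_def row_def vec_eq_iff forall_2)
    then have "(axis 1 1 :: real ^ 2) = 0"
      using inj[unfolded linear_injective_0[OF linear_D[OF x]]] by blast
    then show False by (simp add: axis_eq_0_iff)
  qed
qed

lemma linear_row: "x \<in> U \<Longrightarrow> linear (row i x)"
  unfolding row_def using linear_D by (auto simp: linear_iff)

lemma row_null: "x \<in> U \<Longrightarrow> row i x (null i x) = 0"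
  using linear_vec2[OF linear_row, of x i "null i x"] by (simp add: null_def)

lemma null_eq_0_iff: "x \<in> U \<Longrightarrow> null i x = 0 \<longleftrightarrow> (\<forall>v. row i x v = 0)"
proof (intro iffI allI)
  fix v assume "x \<in> U" "null i x = 0"
  then show "row i x v = 0"
    using linear_vec2[OF linear_row, of x i v] by (simp add: null_def vec_eq_iff[of "vector _"] forall_2)
qed (simp add: null_def vec_eq_iff forall_2)

lemma row_zero_null:
  assumes x: "x \<in> U" and "null i x \<noteq> 0" "row i x h = 0"
  obtains c where "h = c *\<^sub>R null i x"
proof -
  have "row i x (axis 1 1) * h $ 1 + row i x (axis 2 1) * h $ 2 = 0"
    using assms(3) linear_vec2[OF linear_row[OF x], of i h] by (simp add: mult.commute)
  moreover have "row i x (axis 1 1) \<noteq> 0 \<or> row i x (axis 2 1) \<noteq> 0"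
    using assms(2) by (auto simp: null_def vec_eq_iff forall_2)
  ultimately show ?thesis using orthogonal_line_vec2 that unfolding null_def by blast
qed

text \<open>If dF vanished at \<open>x\<close>, both factors of F_u \<times> F_v would vanish there
  and the product rule would give \<open>area\<close> a zero derivative. So dF has rank 1 at a
  nondegenerate singular point, and some row is available for describing its kernel.\<close>

lemma nonzero_row:
  assumes x: "x \<in> U" and a: "frechet_derivative area (at x) \<noteq> (\<lambda>_. 0)"
  obtains i where "null i x \<noteq> 0"
proof -
  have "\<exists>i. null i x \<noteq> 0"
  proof (rule ccontr)
    assume "\<not> ?thesis"
    then have z: "D x v = 0" for v using null_eq_0_iff[OF x] by (auto simp: row_def vec_eq_iff)
    have Dd: "((\<lambda>x. D x v) has_derivative frechet_derivative (\<lambda>x. D x v) (at x)) (at x)" for v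
      by (rule smooth_on_has_derivative[OF open_U smooth_D x])
    have "((\<lambda>x. cross3 (D x (axis 1 1)) (D x (axis 2 1)) \<bullet> N x) has_derivative (\<lambda>h. 0)) (at x)"
      using has_derivative_inner[OF has_derivative_cross3[OF Dd Dd] smooth_on_has_derivative[OF open_U smooth_N x],
          of "axis 1 1" "axis 2 1"] by (simp add: z)
    then have "(area has_derivative (\<lambda>h. 0)) (at x)" by (simp add: area_def[abs_def] cross3_inner_det)
    then show False using a frechet_derivative_at by fastforce
  qed
  then show ?thesis using that by blast
qed

end

section \<open>The normal form of a cuspidal edge\<close>

text \<open>Simultaneous induction with the cosine, each being the derivative of the other up to
  sign.\<close>

lemma smooth_on_sin: "smooth_on UNIV (sin :: real \<Rightarrow> real)"
proof -
  have "Ck_on k UNIV (sin :: real \<Rightarrow> real) \<and> Ck_on k UNIV (cos :: real \<Rightarrow> real)" for k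
  proof (induction k)
    case 0
    then show ?case by (auto intro: continuous_intros)
  next
    case (Suc k)
    have "Ck_on (Suc k) UNIV (sin :: real \<Rightarrow> real)"
    proof (rule Ck_on_SucI[where F' = "\<lambda>x h. h * cos x"])
      show "Ck_on k UNIV (\<lambda>x. v * cos x)" for v :: real
        using Suc by (intro Ck_on_bilinear[OF _ bounded_bilinear_mult] Ck_on_const) auto
    qed (auto intro!: derivative_eq_intros simp: mult.commute)
    moreover have "Ck_on (Suc k) UNIV (cos :: real \<Rightarrow> real)"
    proof (rule Ck_on_SucI[where F' = "\<lambda>x h. (- h) * sin x"])
      show "Ck_on k UNIV (\<lambda>x. (- v) * sin x)" for v :: real
        using Suc by (intro Ck_on_bilinear[OF _ bounded_bilinear_mult] Ck_on_const) auto
    qed (auto intro!: derivative_eq_intros)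
    ultimately show ?case by blast
  qed
  then show ?thesis by (simp add: smooth_on_def)
qed

lemma bounded_linear_vector2: "bounded_linear (\<lambda>z :: real \<times> real. vector [fst z, snd z] :: real ^ 2)"
  unfolding linear_conv_bounded_linear[symmetric]
  by (rule linearI) (simp_all add: vec_eq_iff forall_2)

lemma vector2_components: "(vector [z $ 1, z $ 2] :: real ^ 2) = z"
  by (simp add: vec_eq_iff forall_2)

lemma vector2_axis: "(vector [1, 0] :: real ^ 2) = axis 1 1" "(vector [0, 1] :: real ^ 2) = axis 2 1"
  "(vector [0, 0] :: real ^ 2) = 0"
  by (simp_all add: vec_eq_iff forall_2 axis_def)

lemma partial_derivatives_vector2:
  assumes "(f has_derivative f') (at (vector [s, v] :: real ^ 2))"
  shows "((\<lambda>s. f (vector [s, v])) has_vector_derivative f' (axis 1 1)) (at s)"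
    "((\<lambda>v. f (vector [s, v])) has_vector_derivative f' (axis 2 1)) (at v)"
proof -
  have lin: "f' (t *\<^sub>R w) = t *\<^sub>R f' w" for t w
    using has_derivative_linear[OF assms] linear_cmul by blast
  have e: "vector [s, v] = s *\<^sub>R axis 1 1 + v *\<^sub>R (axis 2 1 :: real ^ 2)" for s v :: real
    by (simp add: vec_eq_iff forall_2 axis_def)
  have "((\<lambda>s. vector [s, v] :: real ^ 2) has_derivative (\<lambda>t. t *\<^sub>R axis 1 1)) (at s)"
    unfolding e by (auto intro!: derivative_eq_intros)
  from has_derivative_compose[OF this assms] show "((\<lambda>s. f (vector [s, v])) has_vector_derivative f' (axis 1 1)) (at s)"
    by (simp add: has_vector_derivative_def lin)
  have "((\<lambda>v. vector [s, v] :: real ^ 2) has_derivative (\<lambda>t. t *\<^sub>R axis 2 1)) (at v)"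
    unfolding e by (auto intro!: derivative_eq_intros)
  from has_derivative_compose[OF this assms] show "((\<lambda>v. f (vector [s, v])) has_vector_derivative f' (axis 2 1)) (at v)"
    by (simp add: has_vector_derivative_def lin)
qed

lemma periodic_cusp_decomposition:
  fixes F :: "real \<times> real \<Rightarrow> real ^ 'n"
  assumes F: "smooth_on UNIV F" and p: "\<And>s v. F (s + 2 * pi, v) = F (s, v)" "\<And>s v. F (s, v + 2 * pi) = F (s, v)"
    and F0: "\<And>v. frechet_derivative F (at (0, v)) (1, 0) = 0"
  obtains A B :: "real \<times> real \<Rightarrow> real ^ 'n" where "smooth_on UNIV A" "smooth_on UNIV B"
    "\<And>s v. F (s, v) = A (s\<^sup>2, v) + s ^ 3 *\<^sub>R B (s\<^sup>2, v)"
proof -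
  have "\<exists>A B. smooth_on UNIV A \<and> smooth_on UNIV B \<and> (\<forall>s v. F (s, v) $ i = A (s\<^sup>2, v) + s ^ 3 * B (s\<^sup>2, v))" for i
  proof -
    let ?f = "\<lambda>z. F z $ i"
    have f: "smooth_on UNIV ?f" by (rule smooth_on_vec_nth[OF open_UNIV F])
    then have b: "bsmooth ?f" by (rule smooth_periodic_bsmooth) (simp_all add: p)
    have "dx ?f (0, v) = 0" for v
      unfolding dx_def using frechet_derivative_linear_comp[OF bounded_linear_vec_nth smooth_on_differentiable[OF open_UNIV F UNIV_I]]
      by (metis F0 zero_index)
    then show ?thesis using even_odd_normal_form[OF b] by metis
  qed
  then obtain A B where AB: "\<And>i. smooth_on UNIV (A i)" "\<And>i. smooth_on UNIV (B i)"
    "\<And>i s v. F (s, v) $ i = A i (s\<^sup>2, v) + s ^ 3 * B i (s\<^sup>2, v)" by metis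
  show ?thesis
  proof
    show "smooth_on UNIV (\<lambda>z. \<chi> i. A i z)" "smooth_on UNIV (\<lambda>z. \<chi> i. B i z)"
      by (auto intro!: smooth_on_vec AB)
    show "F (s, v) = (\<chi> i. A i (s\<^sup>2, v)) + s ^ 3 *\<^sub>R (\<chi> i. B i (s\<^sup>2, v))" for s v
      by (simp add: vec_eq_iff AB(3))
  qed
qed

text \<open>If \<open>b\<close> were orthogonal to \<open>m\<close>, then \<open>m'\<close> would be
  orthogonal to \<open>P\<close> and \<open>q\<close>, hence parallel to their cross product and so
  to \<open>m\<close>; as m' \<bullet> n = 0 and m \<bullet> n = 1, this forces m' = 0. In the
  application \<open>m'\<close> is the derivative of the conormal along the null direction, nonzero
  by the front condition.\<close>

lemma cusp_frame_independent:
  assumes "P \<bullet> m = 0" "q \<bullet> m = 0" "cross3 P q \<noteq> 0" "P \<bullet> m' = - 3 * (b \<bullet> m)" "q \<bullet> m' = 0"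
    "m' \<noteq> 0" "m' \<bullet> n = 0" "m \<bullet> n = 1"
  shows "b \<bullet> m \<noteq> 0"
proof
  assume "b \<bullet> m = 0"
  then have "cross3 m' (cross3 P q) = 0" using assms by (simp add: Lagrange inner_commute)
  then have "cross3 m' m = 0"
    using cross3_conormal[OF assms(1,2,8)] assms(3)
    by (metis cross_mult_right scaleR_eq_0_iff scaleR_zero_left)
  then have "0 = cross3 n (cross3 m' m)" by simp
  also have "\<dots> = m'" unfolding Lagrange[of n m'] using assms(7,8)
    by (simp only: inner_commute[of n] scaleR_one scaleR_zero_left diff_zero)
  finally show False using assms(6) by simp
qed

section \<open>Local diffeomorphisms and coordinates adapted to the singular curve\<close>

definition diffeo :: "'a::euclidean_space set \<Rightarrow> 'b::euclidean_space set \<Rightarrow> ('a \<Rightarrow> 'b) \<Rightarrow> ('b \<Rightarrow> 'a) \<Rightarrow> bool" where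
  "diffeo U V \<phi> \<psi> \<longleftrightarrow> open U \<and> open V \<and> homeomorphism U V \<phi> \<psi> \<and> smooth_on U \<phi> \<and> smooth_on V \<psi>"

lemma diffeo_sym: "diffeo U V \<phi> \<psi> \<Longrightarrow> diffeo V U \<psi> \<phi>"
  unfolding diffeo_def using homeomorphism_symD by blast

lemma diffeo_subset:
  assumes "diffeo U V \<phi> \<psi>" "open U'" "U' \<subseteq> U"
  shows "diffeo U' (\<phi> ` U') \<phi> \<psi>"
proof -
  have h: "homeomorphism U V \<phi> \<psi>" using assms(1) by (simp add: diffeo_def)
  have sub: "\<phi> ` U' \<subseteq> V" using h assms(3) by (auto simp: homeomorphism_def)
  have eq: "\<phi> ` U' = V \<inter> \<psi> -` U'"
    using h assms(3) by (auto simp: homeomorphism_def image_iff)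
  have "open (V \<inter> \<psi> -` U')"
    using assms h by (intro continuous_open_preimage) (auto simp: diffeo_def homeomorphism_def)
  then show ?thesis
    using assms sub homeomorphism_of_subsets[OF h assms(3)] eq
    by (auto simp: diffeo_def intro: smooth_on_subset)
qed

lemma local_diffeo:
  fixes F :: "real ^ 'n \<Rightarrow> real ^ 'n"
  assumes "open S" "x0 \<in> S" "smooth_on S F" "inj (frechet_derivative F (at x0))"
  obtains U V G where "diffeo U V F G" "U \<subseteq> S" "x0 \<in> U"
  using smooth_local_inverse[OF assms] smooth_on_subset[OF assms(3)] unfolding diffeo_def by metis

context conormal_front
begin

text \<open>\<open>area\<close> is completed by a linear function to a local coordinate system
  \<open>K\<close>; the curve is the preimage of the line on which the first coordinate
  vanishes.\<close>

lemma singular_curve_through: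
  assumes x0: "x0 \<in> U" "area x0 = 0" and a: "frechet_derivative area (at x0) \<noteq> (\<lambda>_. 0)"
  obtains T \<gamma> \<gamma>' where "open T" "0 \<in> T" "\<gamma> 0 = x0" "smooth_on T \<gamma>" "\<And>t. t \<in> T \<Longrightarrow> \<gamma> t \<in> U \<and> area (\<gamma> t) = 0"
    "(\<gamma> has_vector_derivative \<gamma>') (at 0)" "\<gamma>' \<noteq> 0"
proof -
  let ?a = "frechet_derivative area (at x0)"
  have lin: "linear ?a" using area_has_derivative[OF x0(1)] has_derivative_linear by blast
  define c d where "c = ?a (axis 1 1)" and "d = ?a (axis 2 1)"
  have av: "?a h = h $ 1 * c + h $ 2 * d" for h
    using linear_vec2[OF lin, of h] by (simp add: c_def d_def)
  have cd: "c \<noteq> 0 \<or> d \<noteq> 0" using a av by (auto simp: fun_eq_iff)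
  \<comment> \<open>The second gradient (-d, c) is the first one, (c, d), turned by a right angle,
    so the Jacobian determinant at \<open>x0\<close> is c^2 + d^2.\<close>
  define K where "K x = (vector [area x, - d * x $ 1 + c * x $ 2] :: real ^ 2)" for x
  have K: "smooth_on U K"
    unfolding K_def by (intro smooth_on_vector2 smooth_area smooth_on_add smooth_on_mult smooth_on_const
        smooth_on_vec_nth smooth_on_ident open_U)
  have KD: "(K has_derivative frechet_derivative K (at x)) (at x)" if "x \<in> U" for x
    by (rule smooth_on_has_derivative[OF open_U K that])
  have K1: "frechet_derivative K (at x0) h $ 1 = ?a h" for h
  proof -
    have "((\<lambda>x. K x $ 1) has_derivative (\<lambda>h. frechet_derivative K (at x0) h $ 1)) (at x0)"
      by (rule bounded_linear.has_derivative[OF bounded_linear_vec_nth KD[OF x0(1)]])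
    then have "(area has_derivative (\<lambda>h. frechet_derivative K (at x0) h $ 1)) (at x0)"
      by (simp add: K_def[abs_def])
    from has_derivative_unique[OF area_has_derivative[OF x0(1)] this] show ?thesis by simp
  qed
  have K2: "frechet_derivative K (at x0) h $ 2 = - d * h $ 1 + c * h $ 2" for h
  proof -
    have 1: "((\<lambda>x. K x $ 2) has_derivative (\<lambda>h. frechet_derivative K (at x0) h $ 2)) (at x0)"
      by (rule bounded_linear.has_derivative[OF bounded_linear_vec_nth KD[OF x0(1)]])
    have 2: "((\<lambda>x. K x $ 2) has_derivative (\<lambda>h. - d * h $ 1 + c * h $ 2)) (at x0)"
      unfolding K_def by (auto intro!: derivative_eq_intros bounded_linear.has_derivative[OF bounded_linear_vec_nth])
    show ?thesis using fun_cong[OF has_derivative_unique[OF 1 2], of h] .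
  qed
  have "inj (frechet_derivative K (at x0))"
    unfolding linear_injective_0[OF has_derivative_linear[OF KD[OF x0(1)]]]
  proof (intro allI impI)
    fix h assume z: "frechet_derivative K (at x0) h = 0"
    have e: "h $ 1 * c + h $ 2 * d = 0" "- d * h $ 1 + c * h $ 2 = 0"
      using K1[of h] K2[of h] z by (auto simp: av)
    have n: "c\<^sup>2 + d\<^sup>2 \<noteq> 0" using cd by (simp add: sum_power2_eq_zero_iff)
    have "(c\<^sup>2 + d\<^sup>2) * h $ 1 = 0" "(c\<^sup>2 + d\<^sup>2) * h $ 2 = 0" using e by algebra+
    then have "h $ 1 = 0" "h $ 2 = 0" unfolding mult_eq_0_iff using n by blast+
    then show "h = 0" by (simp add: vec_eq_iff forall_2)
  qed
  then obtain P Q Y where PQ: "diffeo P Q K Y" "P \<subseteq> U" "x0 \<in> P"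
    using local_diffeo[OF open_U x0(1) K] by blast
  define k where "k = K x0 $ 2"
  define line where "line t = (vector [0, k + t] :: real ^ 2)" for t
  define T where "T = line -` Q"
  define \<gamma> where "\<gamma> t = Y (line t)" for t
  have sl: "smooth_on UNIV line"
    unfolding line_def by (intro smooth_on_vector2 smooth_on_add smooth_on_const smooth_on_ident open_UNIV)
  have hom: "homeomorphism P Q K Y" and oQ: "open Q" and sY: "smooth_on Q Y" using PQ(1) by (auto simp: diffeo_def)
  have oT: "open T" unfolding T_def using oQ smooth_on_continuous[OF sl]
    by (simp add: continuous_on_open_vimage open_vimage)
  have l0: "line 0 = K x0" using x0(2) by (simp add: line_def k_def K_def vec_eq_iff forall_2)
  have T0: "0 \<in> T" using hom PQ(3) l0 by (auto simp: T_def homeomorphism_def)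
  have \<gamma>0: "\<gamma> 0 = x0" using hom PQ(3) l0 by (auto simp: \<gamma>_def homeomorphism_def)
  have s\<gamma>: "smooth_on T \<gamma>"
    unfolding \<gamma>_def by (rule smooth_on_compose[OF oT oQ sY smooth_on_subset[OF sl]]) (auto simp: T_def)
  have K\<gamma>: "K (\<gamma> t) = line t \<and> \<gamma> t \<in> P" if "t \<in> T" for t
    using hom that by (auto simp: \<gamma>_def T_def homeomorphism_def)
  have sing: "\<gamma> t \<in> U \<and> area (\<gamma> t) = 0" if "t \<in> T" for t
    using K\<gamma>[OF that] PQ(2) by (auto simp: K_def line_def vec_eq_iff forall_2)
  have d\<gamma>: "(\<gamma> has_vector_derivative vector_derivative \<gamma> (at 0)) (at 0)"
    using smooth_on_differentiable[OF oT s\<gamma> T0] vector_derivative_works by blast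
  \<comment> \<open>The second component of \<open>K\<close> equals k + t along the curve, so its
    derivative is 1.\<close>
  have "vector_derivative \<gamma> (at 0) \<noteq> 0"
  proof
    assume z: "vector_derivative \<gamma> (at 0) = 0"
    have "((\<lambda>t. - d * \<gamma> t $ 1 + c * \<gamma> t $ 2) has_vector_derivative 0) (at 0)"
      using d\<gamma> unfolding z by (auto intro!: derivative_eq_intros bounded_linear.has_vector_derivative[OF bounded_linear_vec_nth])
    moreover have "((\<lambda>t. - d * \<gamma> t $ 1 + c * \<gamma> t $ 2) has_vector_derivative 1) (at 0)"
    proof (rule has_vector_derivative_transform_within_open[OF _ oT T0])
      show "((\<lambda>t. k + t) has_vector_derivative 1) (at 0)" by (auto intro!: derivative_eq_intros)
      show "k + t = - d * \<gamma> t $ 1 + c * \<gamma> t $ 2" if "t \<in> T" for t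
        using K\<gamma>[OF that] by (simp add: K_def line_def vec_eq_iff forall_2)
    qed
    ultimately show False using vector_derivative_unique_at zero_neq_one by blast
  qed
  then show ?thesis using that oT T0 \<gamma>0 s\<gamma> sing d\<gamma> by blast
qed

text \<open>\<open>Z(s, v) = \<gamma>(\<delta> sin v) + \<delta> sin s \<cdot> n(\<gamma>(\<delta> sin v))\<close>, where \<open>\<gamma>\<close> is the singular curve and \<open>n\<close> the null field; the
  sines make \<open>Z\<close> globally defined and periodic, so that all its derivatives are bounded.\<close>

lemma adapted_coordinates:
  assumes x0: "x0 \<in> U" "area x0 = 0" and a: "frechet_derivative area (at x0) (null i x0) \<noteq> 0"
  obtains Z :: "real ^ 2 \<Rightarrow> real ^ 2" and \<delta> :: real
  where "smooth_on UNIV Z" "range Z \<subseteq> U" "Z 0 = x0" "\<delta> > 0"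
    "\<And>s v. Z (vector [s + 2 * pi, v]) = Z (vector [s, v])" "\<And>s v. Z (vector [s, v + 2 * pi]) = Z (vector [s, v])"
    "\<And>v. area (Z (vector [0, v])) = 0"
    "\<And>v. frechet_derivative Z (at (vector [0, v])) (axis 1 1) = \<delta> *\<^sub>R null i (Z (vector [0, v]))"
    "inj (frechet_derivative Z (at 0))"
proof -
  let ?a = "frechet_derivative area (at x0)"
  have lin: "linear ?a" using area_has_derivative[OF x0(1)] has_derivative_linear by blast
  obtain T \<gamma> \<gamma>' where T: "open T" "0 \<in> T" "\<gamma> 0 = x0" "smooth_on T \<gamma>" "\<And>t. t \<in> T \<Longrightarrow> \<gamma> t \<in> U \<and> area (\<gamma> t) = 0"
    "(\<gamma> has_vector_derivative \<gamma>') (at 0)" "\<gamma>' \<noteq> 0"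
    using singular_curve_through[OF x0] a by (metis (mono_tags, lifting))
  have a\<gamma>: "?a \<gamma>' = 0"
  proof -
    have "((\<lambda>t. area (\<gamma> t)) has_derivative (\<lambda>t. ?a (t *\<^sub>R \<gamma>'))) (at 0)"
      using has_derivative_compose[OF T(6)[unfolded has_vector_derivative_def]] area_has_derivative[OF x0(1)] T(3) by auto
    then have "((\<lambda>t. 0) has_derivative (\<lambda>t. ?a (t *\<^sub>R \<gamma>'))) (at 0)"
      by (rule has_derivative_transform_within_open[OF _ T(1,2)]) (use T(5) in auto)
    then have "(\<lambda>t. ?a (t *\<^sub>R \<gamma>')) = (\<lambda>t. 0)" using has_derivative_const has_derivative_unique by blast
    then show ?thesis by (metis scaleR_one)
  qed
  define X where "X z = \<gamma> (snd z) + fst z *\<^sub>R null i (\<gamma> (snd z))" for z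
  let ?P = "(UNIV :: real set) \<times> T"
  have oP: "open ?P" by (intro open_Times open_UNIV T)
  have s\<gamma>: "smooth_on ?P (\<lambda>z. \<gamma> (snd z))"
    by (rule smooth_on_compose[OF oP T(1,4) smooth_on_linear[OF oP bounded_linear_snd]]) auto
  have sX: "smooth_on ?P X"
    unfolding X_def
    by (intro smooth_on_add smooth_on_scaleR s\<gamma> oP smooth_on_linear bounded_linear_fst
        smooth_on_compose[OF oP open_U smooth_null s\<gamma>]) (use T(5) in auto)
  define W where "W = ?P \<inter> X -` U"
  have oW: "open W" unfolding W_def using smooth_on_continuous[OF sX] oP open_U by (rule continuous_open_preimage)
  have "(0, 0) \<in> W" using T(2,3) x0(1) by (simp add: W_def X_def)
  then obtain e where e: "e > 0" "ball (0, 0) e \<subseteq> W" using oW open_contains_ball by blast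
  \<comment> \<open>The point (\<delta> sin s, \<delta> sin v) then has norm at most 2 \<delta> <
    e.\<close>
  define \<delta> where "\<delta> = e / 3"
  have \<delta>: "\<delta> > 0" using e by (simp add: \<delta>_def)
  define S where "S z = (\<delta> * sin (z $ 1), \<delta> * sin (z $ 2))" for z :: "real ^ 2"
  have SW: "S z \<in> W" for z
  proof -
    have "norm (S z) \<le> \<bar>\<delta> * sin (z $ 1)\<bar> + \<bar>\<delta> * sin (z $ 2)\<bar>"
      unfolding S_def using norm_Pair_le by (metis real_norm_def)
    also have "\<dots> \<le> \<delta> + \<delta>" using \<delta> by (intro add_mono) (simp_all add: abs_mult)
    also have "\<dots> < e" using e by (simp add: \<delta>_def)
    finally show ?thesis using e(2) by (auto simp: dist_norm zero_prod_def[symmetric])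
  qed
  have sS: "smooth_on UNIV S"
    unfolding S_def
    by (intro smooth_on_Pair smooth_on_mult smooth_on_const open_UNIV
        smooth_on_compose[OF open_UNIV open_UNIV smooth_on_sin] smooth_on_vec_nth smooth_on_ident) auto
  have WP: "W \<subseteq> ?P" by (auto simp: W_def)
  define Z where "Z z = X (S z)" for z
  have sZ: "smooth_on UNIV Z"
    unfolding Z_def using SW by (intro smooth_on_compose[OF open_UNIV oW smooth_on_subset[OF sX WP] sS]) blast
  have ZD: "(Z has_derivative frechet_derivative Z (at z)) (at z)" for z
    by (rule smooth_on_has_derivative[OF open_UNIV sZ UNIV_I])
  have Zv: "Z (vector [s, v]) = \<gamma> (\<delta> * sin v) + (\<delta> * sin s) *\<^sub>R null i (\<gamma> (\<delta> * sin v))" for s v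
    by (simp add: Z_def X_def S_def)
  have inT: "\<delta> * sin v \<in> T" for v using SW[of "vector [0, v]"] by (simp add: S_def W_def)
  have Z1: "frechet_derivative Z (at (vector [0, v])) (axis 1 1) = \<delta> *\<^sub>R null i (Z (vector [0, v]))" for v
  proof -
    have "((\<lambda>s. Z (vector [s, v])) has_vector_derivative \<delta> *\<^sub>R null i (\<gamma> (\<delta> * sin v))) (at 0)"
      unfolding Zv by (auto intro!: derivative_eq_intros)
    from vector_derivative_unique_at[OF partial_derivatives_vector2(1)[OF ZD] this]
    show ?thesis by (simp add: Zv)
  qed
  have Z0: "Z 0 = x0" using Zv[of 0 0] T(3) by (simp add: vector2_axis)
  have Z2: "frechet_derivative Z (at 0) (axis 2 1) = \<delta> *\<^sub>R \<gamma>'"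
  proof -
    have "((\<lambda>v. \<delta> * sin v) has_vector_derivative \<delta>) (at 0)"
      by (auto intro!: derivative_eq_intros simp: has_real_derivative_iff_has_vector_derivative[symmetric])
    from vector_diff_chain_at[OF this, of \<gamma> \<gamma>'] T(6)
    have "((\<lambda>v. Z (vector [0, v])) has_vector_derivative \<delta> *\<^sub>R \<gamma>') (at 0)"
      unfolding Zv by (simp add: o_def)
    from vector_derivative_unique_at[OF partial_derivatives_vector2(2)[OF ZD] this]
    show ?thesis by (simp add: vector2_axis)
  qed
  \<comment> \<open>The derivative of \<open>area\<close> kills \<open>\<gamma>'\<close> but not the
    null vector, so the two partial derivatives of \<open>Z\<close> are independent.\<close>
  have "inj (frechet_derivative Z (at 0))"
  proof (rule linear_vec2_inj[OF has_derivative_linear[OF ZD]])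
    fix b c :: real
    assume "b *\<^sub>R frechet_derivative Z (at 0) (axis 1 1) + c *\<^sub>R frechet_derivative Z (at 0) (axis 2 1) = 0"
    then have z: "(b * \<delta>) *\<^sub>R null i x0 + (c * \<delta>) *\<^sub>R \<gamma>' = 0"
      using Z1[of 0] Z2 Z0 by (simp add: vector2_axis)
    from arg_cong[OF this, of ?a] have "b * \<delta> * ?a (null i x0) = 0"
      by (simp add: linear_add[OF lin] linear_cmul[OF lin] linear_0[OF lin] a\<gamma>)
    then have b: "b = 0" using \<delta> a by simp
    then show "b = 0 \<and> c = 0" using z \<delta> T(7) by simp
  qed
  moreover have "range Z \<subseteq> U" using SW by (auto simp: Z_def W_def)
  moreover have "area (Z (vector [0, v])) = 0" for v using T(5)[OF inT] by (simp add: Zv)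
  ultimately show ?thesis using that[of Z \<delta>] sZ Z0 \<delta> Z1 by (simp add: Zv)
qed

end

definition cusp :: "real ^ 2 \<Rightarrow> real ^ 3" where
  "cusp z = vector [(z $ 1)\<^sup>2, (z $ 1) ^ 3, z $ 2]"

lemma smooth_cusp: "open S \<Longrightarrow> smooth_on S cusp"
  unfolding cusp_def by (intro smooth_on_vector3 smooth_on_power smooth_on_vec_nth smooth_on_ident)

lemma square_chain:
  fixes G :: "real \<times> real \<Rightarrow> 'a::real_normed_vector"
  assumes "smooth_on UNIV G"
  shows "((\<lambda>s. G (s\<^sup>2, v)) has_vector_derivative (2 * s) *\<^sub>R frechet_derivative G (at (s\<^sup>2, v)) (1, 0)) (at s)"
proof -
  have d: "(G has_derivative frechet_derivative G (at (s\<^sup>2, v))) (at (s\<^sup>2, v))"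
    by (rule smooth_on_has_derivative[OF open_UNIV assms UNIV_I])
  have "((\<lambda>s. (s\<^sup>2, v)) has_derivative (\<lambda>t. t *\<^sub>R (2 * s) *\<^sub>R (1, 0))) (at s)"
    by (auto intro!: derivative_eq_intros simp: algebra_simps)
  from has_derivative_compose[OF this d] show ?thesis
    using linear_cmul[OF has_derivative_linear[OF d]] by (simp only: has_vector_derivative_def)
qed

lemma snd_chain:
  fixes G :: "real \<times> real \<Rightarrow> 'a::real_normed_vector"
  assumes "smooth_on UNIV G"
  shows "((\<lambda>v. G (s, v)) has_vector_derivative frechet_derivative G (at (s, v)) (0, 1)) (at v)"
proof -
  have d: "(G has_derivative frechet_derivative G (at (s, v))) (at (s, v))"
    by (rule smooth_on_has_derivative[OF open_UNIV assms UNIV_I])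
  have "((\<lambda>v. (s, v)) has_derivative (\<lambda>t. t *\<^sub>R (0, 1))) (at v)"
    by (auto intro!: derivative_eq_intros)
  from has_derivative_compose[OF this d] show ?thesis
    using linear_cmul[OF has_derivative_linear[OF d]] by (simp only: has_vector_derivative_def)
qed

lemma det2_eq_0:
  assumes "det (vector [p, q] :: real ^ 2 ^ 2) = 0"
  shows "q $ 1 *\<^sub>R p - p $ 1 *\<^sub>R q = 0" "q $ 2 *\<^sub>R p - p $ 2 *\<^sub>R q = 0"
  using assms by (simp_all add: det_2 vec_eq_iff forall_2 algebra_simps)

lemma inj_det2_neq_0:
  assumes "linear (f :: real ^ 2 \<Rightarrow> real ^ 2)" "inj f"
  shows "det (vector [f (axis 1 1), f (axis 2 1)] :: real ^ 2 ^ 2) \<noteq> 0"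
proof
  let ?p = "f (axis 1 1)" and ?q = "f (axis 2 1)"
  assume "det (vector [?p, ?q] :: real ^ 2 ^ 2) = 0"
  from det2_eq_0[OF this] have "f (?q $ k *\<^sub>R axis 1 1 - ?p $ k *\<^sub>R axis 2 1) = 0" for k
    using exhaust_2[of k] by (auto simp: linear_diff[OF assms(1)] linear_cmul[OF assms(1)])
  then have "?q $ k *\<^sub>R axis 1 1 - ?p $ k *\<^sub>R (axis 2 1 :: real ^ 2) = 0" for k
    using assms(2)[unfolded linear_injective_0[OF assms(1)]] by blast
  then have "?p $ k = 0" for k
    by (simp add: vec_eq_iff forall_2 axis_def)
  then have "?p = 0" by (simp add: vec_eq_iff)
  then have "(axis 1 1 :: real ^ 2) = 0" using assms(2)[unfolded linear_injective_0[OF assms(1)]] by blast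
  then show False by (simp add: axis_eq_0_iff)
qed

text \<open>Serves to cancel a factor \<open>s\<close> at s = 0: two expressions for s g(s) are
  differentiated there and compared.\<close>

lemma derivative_times_identity:
  fixes g :: "real \<Rightarrow> 'a::real_normed_vector"
  assumes "(g has_vector_derivative g') (at 0)"
  shows "((\<lambda>s. s *\<^sub>R g s) has_vector_derivative g 0) (at 0)"
  using has_vector_derivative_scaleR[OF DERIV_ident assms] by simp

context conormal_front
begin

text \<open>With \<open>Z\<close> the adapted coordinates, F \<circ> Z = \<Theta> \<circ> cusp for
  \<Theta>(x, y, z) = A(x, z) + y B(x, z), so the local inverses of \<open>Z\<close> and
  \<open>\<Theta>\<close> are the required coordinates. The main point is that d\<Theta> is
  invertible at 0. Its columns are P(0)/2, B(0, 0) and q(0): transversality of the null direction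
  makes P(0) and q(0) independent, and the hypotheses on the derivative of \<open>M\<close> keep
  B(0, 0) out of their plane. The set \<open>V\<close> keeps the target coordinates inside a given
  chart.\<close>

theorem cuspidal_normal_form:
  assumes x0: "x0 \<in> U" "area x0 = 0"
    and \<eta>: "D x0 \<eta> = 0" "frechet_derivative area (at x0) \<eta> \<noteq> 0"
    and M\<eta>: "frechet_derivative M (at x0) \<eta> \<noteq> 0" "frechet_derivative M (at x0) \<eta> \<bullet> N x0 = 0"
    and V: "open V" "F x0 \<in> V"
  obtains U1 U2 \<phi> \<phi>' V1 V2 \<psi> \<psi>' where "diffeo U1 U2 \<phi> \<phi>'" "x0 \<in> U1" "U1 \<subseteq> U" "\<phi> x0 = 0"
    "diffeo V1 V2 \<psi> \<psi>'" "F ` U1 \<subseteq> V1" "V1 \<subseteq> V" "\<psi> (F x0) = 0" "\<And>x. x \<in> U1 \<Longrightarrow> \<psi> (F x) = cusp (\<phi> x)"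
proof -
  have M_D: "(M has_derivative frechet_derivative M (at x)) (at x)" if "x \<in> U" for x
    by (rule smooth_on_has_derivative[OF open_U smooth_M that])
  have linA: "linear (frechet_derivative area (at x0))"
    using area_has_derivative[OF x0(1)] has_derivative_linear by blast
  have linM: "linear (frechet_derivative M (at x0))" using M_D[OF x0(1)] has_derivative_linear by blast
  have "frechet_derivative area (at x0) \<noteq> (\<lambda>_. 0)" using \<eta>(2) by auto
  then obtain i where i: "null i x0 \<noteq> 0" using nonzero_row[OF x0(1)] by blast
  define e where "e = null i x0"
  \<comment> \<open>The kernel of dF lies in that of its nonzero row, the line spanned by
    \<open>e\<close>; so the hypotheses on \<open>\<eta>\<close> pass to \<open>e\<close>.\<close>
  obtain c where c: "\<eta> = c *\<^sub>R e"
    using row_zero_null[OF x0(1) i] \<eta>(1) unfolding e_def row_def by (metis zero_index)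
  have ae: "frechet_derivative area (at x0) e \<noteq> 0" and me: "frechet_derivative M (at x0) e \<noteq> 0"
    and mn: "frechet_derivative M (at x0) e \<bullet> N x0 = 0"
    using \<eta>(2) M\<eta> by (auto simp: c linear_cmul[OF linA] linear_cmul[OF linM])
  obtain Z :: "real ^ 2 \<Rightarrow> real ^ 2" and \<delta> :: real where sZ: "smooth_on UNIV Z" and ZU: "range Z \<subseteq> U" and Z0: "Z 0 = x0"
    and \<delta>: "\<delta> > 0" and per: "\<And>s v. Z (vector [s + 2 * pi, v]) = Z (vector [s, v])"
      "\<And>s v. Z (vector [s, v + 2 * pi]) = Z (vector [s, v])"
    and Zsing: "\<And>v. area (Z (vector [0, v])) = 0"
    and Zs0: "\<And>v. frechet_derivative Z (at (vector [0, v])) (axis 1 1) = \<delta> *\<^sub>R null i (Z (vector [0, v]))"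
    and Zinj: "inj (frechet_derivative Z (at 0))"
    using adapted_coordinates[OF x0 ae[unfolded e_def]] by blast
  let ?DZ = "\<lambda>z. frechet_derivative Z (at z)"
  have ZD: "(Z has_derivative ?DZ z) (at z)" for z by (rule smooth_on_has_derivative[OF open_UNIV sZ UNIV_I])
  have inU: "Z z \<in> U" for z using ZU by blast
  have FZ: "((\<lambda>z. F (Z z)) has_derivative (\<lambda>h. D (Z z) (?DZ z h))) (at z)" for z
    by (rule has_derivative_compose[OF ZD F_has_derivative[OF inU]])
  define Ft where "Ft z = F (Z (vector [fst z, snd z]))" for z :: "real \<times> real"
  have sP: "smooth_on UNIV (\<lambda>z :: real \<times> real. vector [fst z, snd z] :: real ^ 2)"
    by (rule smooth_on_linear[OF open_UNIV bounded_linear_vector2])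
  have sFZ: "smooth_on UNIV (\<lambda>z. F (Z z))"
    by (rule smooth_on_compose[OF open_UNIV open_U smooth_F sZ ZU])
  have sFt: "smooth_on UNIV Ft"
    unfolding Ft_def by (rule smooth_on_compose[OF open_UNIV open_UNIV sFZ sP]) simp
  have FtD: "frechet_derivative Ft (at z) h = D (Z (vector [fst z, snd z])) (?DZ (vector [fst z, snd z]) (vector [fst h, snd h]))" for z h
  proof -
    have "(Ft has_derivative (\<lambda>h. D (Z (vector [fst z, snd z])) (?DZ (vector [fst z, snd z]) (vector [fst h, snd h])))) (at z)"
      unfolding Ft_def by (rule has_derivative_compose[OF bounded_linear_imp_has_derivative[OF bounded_linear_vector2] FZ])
    from fun_cong[OF frechet_derivative_at[OF this], of h] show ?thesis by simp
  qed
  have Ft0: "frechet_derivative Ft (at (0, v)) (1, 0) = 0" for v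
    using D_null[OF inU Zsing] by (simp add: FtD vector2_axis Zs0 linear_cmul[OF linear_D[OF inU]])
  obtain A B :: "real \<times> real \<Rightarrow> real ^ 3" where sA: "smooth_on UNIV A" and sB: "smooth_on UNIV B"
    and AB: "\<And>s v. Ft (s, v) = A (s\<^sup>2, v) + s ^ 3 *\<^sub>R B (s\<^sup>2, v)"
    using periodic_cusp_decomposition[OF sFt _ _ Ft0] by (auto simp: Ft_def per)
  let ?d1 = "\<lambda>G s. frechet_derivative G (at (s\<^sup>2, 0)) (1, 0) :: real ^ 3"
  let ?d2 = "\<lambda>G s. frechet_derivative G (at (s\<^sup>2, 0)) (0, 1) :: real ^ 3"
  \<comment> \<open>The s-derivative of A(s^2, v) + s^3 B(s^2, v) at v = 0, divided by
    \<open>s\<close>; below, \<open>q\<close> is the v-derivative.\<close>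
  define P where "P s = 2 *\<^sub>R ?d1 A s + (3 * s) *\<^sub>R B (s\<^sup>2, 0) + (2 * s ^ 3) *\<^sub>R ?d1 B s" for s :: real
  define q where "q s = ?d2 A s + s ^ 3 *\<^sub>R ?d2 B s" for s :: real
  define z where "z s = Z (vector [s, 0])" for s
  define Zs where "Zs s = ?DZ (vector [s, 0]) (axis 1 1)" for s
  define Zv where "Zv s = ?DZ (vector [s, 0]) (axis 2 1)" for s
  define m where "m s = M (z s)" for s
  have zU: "z s \<in> U" for s by (simp add: z_def inU)
  have z0: "z 0 = x0" by (simp add: z_def vector2_axis Z0)
  have zD: "(z has_vector_derivative Zs s) (at s)" for s
    unfolding z_def Zs_def by (rule partial_derivatives_vector2(1)[OF ZD])
  have sq0: "((\<lambda>s. G (s\<^sup>2, 0)) has_vector_derivative 0) (at 0)" if "smooth_on UNIV G"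
    for G :: "real \<times> real \<Rightarrow> real ^ 3" using square_chain[OF that, of 0 0] by simp
  have Fs: "D (z s) (Zs s) = s *\<^sub>R P s" for s
  proof -
    have 1: "((\<lambda>s. Ft (s, 0)) has_vector_derivative D (z s) (Zs s)) (at s)"
      unfolding z_def Zs_def Ft_def using partial_derivatives_vector2(1)[OF FZ] by simp
    have 2: "((\<lambda>s. A (s\<^sup>2, 0) + s ^ 3 *\<^sub>R B (s\<^sup>2, 0)) has_vector_derivative s *\<^sub>R P s) (at s)"
      by (rule has_vector_derivative_eq_rhs[OF has_vector_derivative_add[OF square_chain[OF sA]
            has_vector_derivative_scaleR[OF DERIV_power[OF DERIV_ident] square_chain[OF sB]]]])
         (simp add: P_def algebra_simps power2_eq_square power3_eq_cube)
    show ?thesis using vector_derivative_unique_at[OF 1[unfolded AB] 2] .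
  qed
  have Fv: "D (z s) (Zv s) = q s" for s
  proof -
    have 1: "((\<lambda>v. Ft (s, v)) has_vector_derivative D (z s) (Zv s)) (at 0)"
      unfolding z_def Zv_def Ft_def using partial_derivatives_vector2(2)[OF FZ] by simp
    have 2: "((\<lambda>v. A (s\<^sup>2, v) + s ^ 3 *\<^sub>R B (s\<^sup>2, v)) has_vector_derivative q s) (at 0)"
      unfolding q_def by (intro has_vector_derivative_add snd_chain[OF sA]
          bounded_linear.has_vector_derivative[OF bounded_linear_scaleR_right snd_chain[OF sB]])
    show ?thesis using vector_derivative_unique_at[OF 1[unfolded AB] 2] .
  qed
  \<comment> \<open>Functions of s^2 have derivative 0 at s = 0, which leaves only the contribution
    of 3 s B.\<close>
  have P': "(P has_vector_derivative 3 *\<^sub>R B (0, 0)) (at 0)"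
  proof -
    have "((\<lambda>s. 2 *\<^sub>R ?d1 A s + (3 * s) *\<^sub>R B (s\<^sup>2, 0) + (2 * s ^ 3) *\<^sub>R ?d1 B s) has_vector_derivative
        (2 *\<^sub>R 0 + ((3 * 0) *\<^sub>R 0 + (3 * 1) *\<^sub>R B (0\<^sup>2, 0)) + ((2 * 0 ^ 3) *\<^sub>R 0 + 0 *\<^sub>R ?d1 B 0))) (at 0)"
      by (intro has_vector_derivative_add has_vector_derivative_scaleR sq0 sA sB smooth_on_frechet
          bounded_linear.has_vector_derivative[OF bounded_linear_scaleR_right])
         (auto intro!: derivative_eq_intros)
    then show ?thesis by (simp add: P_def[abs_def])
  qed
  have q': "(q has_vector_derivative 0) (at 0)"
  proof -
    have "((\<lambda>s. ?d2 A s + s ^ 3 *\<^sub>R ?d2 B s) has_vector_derivative (0 + (0 ^ 3 *\<^sub>R 0 + 0 *\<^sub>R ?d2 B 0))) (at 0)"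
      by (intro has_vector_derivative_add has_vector_derivative_scaleR sq0 sA sB smooth_on_frechet)
         (auto intro!: derivative_eq_intros)
    then show ?thesis by (simp add: q_def[abs_def])
  qed
  have Zs_0: "Zs 0 = \<delta> *\<^sub>R e" using Zs0[of 0] by (simp add: Zs_def e_def vector2_axis Z0)
  define m' where "m' = frechet_derivative M (at x0) (\<delta> *\<^sub>R e)"
  have chain0: "((\<lambda>s. G (z s)) has_vector_derivative G' (\<delta> *\<^sub>R e)) (at 0)"
    if "(G has_derivative G') (at x0)" for G :: "real ^ 2 \<Rightarrow> 'z::real_normed_vector" and G'
    using vector_derivative_diff_chain_within[OF zD[of 0], of G G'] that
    by (simp add: z0 Zs_0 o_def has_derivative_at_withinI)
  have mD: "(m has_vector_derivative m') (at 0)"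
    unfolding m_def[abs_def] m'_def by (rule chain0[OF M_D[OF x0(1)]])
  have m0: "m 0 = M x0" by (simp add: m_def z0)
  \<comment> \<open>For nonzero \<open>s\<close> this is tangency divided by \<open>s\<close>; the
    value at 0 is reached by differentiating s (P \<bullet> m) = 0 there.\<close>
  have Pm: "P s \<bullet> m s = 0" for s
  proof -
    have ne: "s * (P s \<bullet> m s) = 0" for s
      using tangent_M[OF zU, of s "Zs s", folded D_def] by (simp add: Fs m_def)
    have "((\<lambda>s. P s \<bullet> m s) has_vector_derivative P 0 \<bullet> m' + 3 *\<^sub>R B (0, 0) \<bullet> m 0) (at 0)"
      by (rule bounded_bilinear.has_vector_derivative[OF bounded_bilinear_inner P' mD])
    from derivative_times_identity[OF this] have "((\<lambda>s. 0) has_vector_derivative P 0 \<bullet> m 0) (at (0::real))"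
      using ne by simp
    from vector_derivative_unique_at[OF this has_vector_derivative_const] have "P 0 \<bullet> m 0 = 0" .
    then show ?thesis using ne[of s] by (cases "s = 0") auto
  qed
  \<comment> \<open>Differentiating P \<bullet> m = 0 relates the conormal component of B(0, 0) to
    the derivative of the conormal.\<close>
  have Pm': "P 0 \<bullet> m' = - 3 * (B (0, 0) \<bullet> M x0)"
  proof -
    have "((\<lambda>s. P s \<bullet> m s) has_vector_derivative P 0 \<bullet> m' + 3 *\<^sub>R B (0, 0) \<bullet> m 0) (at 0)"
      by (rule bounded_bilinear.has_vector_derivative[OF bounded_bilinear_inner P' mD])
    from vector_derivative_unique_at[OF this[unfolded Pm] has_vector_derivative_const]
    show ?thesis by (simp add: m0)
  qed
  have qm: "q s \<bullet> m s = 0" for s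
    using tangent_M[OF zU, of s "Zv s", folded D_def] by (simp add: Fv m_def)
  have qm': "q 0 \<bullet> m' = 0"
  proof -
    have "((\<lambda>s. q s \<bullet> m s) has_vector_derivative q 0 \<bullet> m' + 0 \<bullet> m 0) (at 0)"
      by (rule bounded_bilinear.has_vector_derivative[OF bounded_bilinear_inner q' mD])
    from vector_derivative_unique_at[OF this[unfolded qm] has_vector_derivative_const] show ?thesis by simp
  qed
  define E where "E s = det (vector [Zs s, Zv s] :: real ^ 2 ^ 2)" for s
  have sE: "smooth_on UNIV E"
  proof -
    have v: "smooth_on UNIV (\<lambda>s. vector [s, 0] :: real ^ 2)"
      by (intro smooth_on_vector2 smooth_on_const smooth_on_ident open_UNIV)
    have "smooth_on UNIV (\<lambda>s. ?DZ (vector [s, 0]) w)" for w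
      by (rule smooth_on_compose[OF open_UNIV open_UNIV smooth_on_frechet[OF sZ] v]) simp
    then show ?thesis unfolding E_def Zs_def Zv_def by (intro smooth_on_det2 open_UNIV)
  qed
  have ED: "(E has_vector_derivative vector_derivative E (at 0)) (at 0)"
    using smooth_on_differentiable[OF open_UNIV sE UNIV_I] vector_derivative_works by blast
  have E0: "E 0 \<noteq> 0"
    unfolding E_def Zs_def Zv_def vector2_axis by (rule inj_det2_neq_0[OF has_derivative_linear[OF ZD] Zinj])
  have cross: "s *\<^sub>R cross3 (P s) (q s) = (E s * area (z s)) *\<^sub>R m s" for s
    using cross3_D[OF zU, of s "Zs s" "Zv s"] by (simp add: Fs Fv E_def m_def cross_mult_left)
  \<comment> \<open>Both sides of \<open>cross\<close> vanish at s = 0. Their derivatives there give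
    P(0) \<times> q(0) on the left, while on the right only the term differentiating
    \<open>area\<close> survives.\<close>
  have cross0: "cross3 (P 0) (q 0) = (E 0 * frechet_derivative area (at x0) (\<delta> *\<^sub>R e)) *\<^sub>R M x0"
  proof -
    note d1 = derivative_times_identity[OF has_vector_derivative_cross3[OF P' q']]
    have "((\<lambda>s. (E s * area (z s)) *\<^sub>R m s) has_vector_derivative
      ((E 0 * area (z 0)) *\<^sub>R m' + (E 0 * frechet_derivative area (at x0) (\<delta> *\<^sub>R e) + vector_derivative E (at 0) * area (z 0)) *\<^sub>R m 0)) (at 0)"
      by (intro bounded_bilinear.has_vector_derivative[OF bounded_bilinear_scaleR]
          bounded_bilinear.has_vector_derivative[OF bounded_bilinear_mult] mD ED chain0 area_has_derivative x0)
    from vector_derivative_unique_at[OF d1[unfolded cross] this] show ?thesis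
      by (simp add: z0 x0 m0)
  qed
  have cross_ne: "cross3 (P 0) (q 0) \<noteq> 0"
    using E0 \<delta> ae M_nonzero[OF x0(1)] by (simp add: cross0 linear_cmul[OF linA])
  have b: "B (0, 0) \<bullet> M x0 \<noteq> 0"
  proof (rule cusp_frame_independent[OF _ _ cross_ne Pm' qm' _ _ M_N[OF x0(1)]])
    show "P 0 \<bullet> M x0 = 0" "q 0 \<bullet> M x0 = 0" using Pm[of 0] qm[of 0] by (simp_all add: m0)
    show "m' \<noteq> 0" "m' \<bullet> N x0 = 0" using me mn \<delta> by (simp_all add: m'_def linear_cmul[OF linM])
  qed
  define \<Theta> where "\<Theta> w = A (w $ 1, w $ 3) + w $ 2 *\<^sub>R B (w $ 1, w $ 3)" for w :: "real ^ 3"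
  have s13: "smooth_on UNIV (\<lambda>w :: real ^ 3. (w $ 1, w $ 3))"
    by (intro smooth_on_Pair smooth_on_vec_nth smooth_on_ident open_UNIV)
  have s\<Theta>: "smooth_on UNIV \<Theta>"
    unfolding \<Theta>_def
    by (intro smooth_on_add smooth_on_scaleR smooth_on_vec_nth smooth_on_ident open_UNIV
        smooth_on_compose[OF open_UNIV open_UNIV sA s13] smooth_on_compose[OF open_UNIV open_UNIV sB s13]) auto
  have \<Theta>D: "frechet_derivative \<Theta> (at 0) h = (h $ 1 / 2) *\<^sub>R P 0 + h $ 3 *\<^sub>R q 0 + h $ 2 *\<^sub>R B (0, 0)" for h
  proof -
    have dG: "((\<lambda>w :: real ^ 3. G (w $ 1, w $ 3)) has_derivative (\<lambda>h. frechet_derivative G (at (0, 0)) (h $ 1, h $ 3))) (at 0)"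
      if "smooth_on UNIV G" for G :: "real \<times> real \<Rightarrow> real ^ 3"
    proof (rule has_derivative_compose[of "\<lambda>w :: real ^ 3. (w $ 1, w $ 3)" "\<lambda>h. (h $ 1, h $ 3)"])
      show "((\<lambda>w :: real ^ 3. (w $ 1, w $ 3)) has_derivative (\<lambda>h. (h $ 1, h $ 3))) (at 0)"
        by (intro has_derivative_Pair bounded_linear_imp_has_derivative bounded_linear_vec_nth)
      show "(G has_derivative frechet_derivative G (at (0, 0))) (at ((0::real ^ 3) $ 1, (0::real ^ 3) $ 3))"
        using smooth_on_has_derivative[OF open_UNIV that UNIV_I] by simp
    qed
    have n2: "((\<lambda>w :: real ^ 3. w $ 2) has_derivative (\<lambda>h. h $ 2)) (at 0)"
      by (intro bounded_linear_imp_has_derivative bounded_linear_vec_nth)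
    have "((\<lambda>w :: real ^ 3. A (w $ 1, w $ 3) + w $ 2 *\<^sub>R B (w $ 1, w $ 3)) has_derivative (\<lambda>h. frechet_derivative A (at (0, 0)) (h $ 1, h $ 3) + h $ 2 *\<^sub>R B (0, 0))) (at 0)"
      by (rule has_derivative_eq_rhs[OF has_derivative_add[OF dG[OF sA] has_derivative_scaleR[OF n2 dG[OF sB]]]]) simp
    from fun_cong[OF frechet_derivative_at[OF this], of h]
    have eq: "frechet_derivative \<Theta> (at 0) h = frechet_derivative A (at (0, 0)) (h $ 1, h $ 3) + h $ 2 *\<^sub>R B (0, 0)"
      by (simp add: \<Theta>_def[abs_def])
    have linDA: "linear (frechet_derivative A (at (0, 0)))"
      using smooth_on_has_derivative[OF open_UNIV sA UNIV_I] has_derivative_linear by blast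
    have "frechet_derivative A (at (0, 0)) (h $ 1 *\<^sub>R (1, 0) + h $ 3 *\<^sub>R (0, 1)) = (h $ 1 / 2) *\<^sub>R P 0 + h $ 3 *\<^sub>R q 0"
      unfolding linear_add[OF linDA] linear_cmul[OF linDA] by (simp add: P_def q_def)
    then show ?thesis unfolding eq by simp
  qed
  have \<Theta>inj: "inj (frechet_derivative \<Theta> (at 0))"
    unfolding linear_injective_0[OF has_derivative_linear[OF smooth_on_has_derivative[OF open_UNIV s\<Theta> UNIV_I]]]
  proof (intro allI impI)
    fix h assume "frechet_derivative \<Theta> (at 0) h = 0"
    then have h: "(h $ 1 / 2) *\<^sub>R P 0 + h $ 3 *\<^sub>R q 0 + h $ 2 *\<^sub>R B (0, 0) = 0" by (simp add: \<Theta>D)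
    \<comment> \<open>Pairing with the conormal removes the tangent vectors P(0) and q(0); cross
      products with these then separate the other two coefficients.\<close>
    have h2: "h $ 2 = 0"
      using arg_cong[OF h, of "\<lambda>w. w \<bullet> M x0"] Pm[of 0] qm[of 0] b by (simp add: inner_add_left m0)
    have "(h $ 1 / 2) *\<^sub>R cross3 (P 0) (q 0) = 0" "h $ 3 *\<^sub>R cross3 (P 0) (q 0) = 0"
      using arg_cong[OF h, of "\<lambda>w. cross3 w (q 0)"] arg_cong[OF h, of "\<lambda>w. cross3 (P 0) w"]
      by (simp_all add: h2 cross_add_left cross_add_right cross_mult_left cross_mult_right del: scaleR_eq_0_iff)
    then have "h $ 1 = 0" "h $ 3 = 0" using cross_ne by simp_all
    then show "h = 0" using h2 by (simp add: vec_eq_iff forall_3)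
  qed
  obtain U\<Theta> V\<Theta> \<psi> where \<Theta>: "diffeo U\<Theta> V\<Theta> \<Theta> \<psi>" "0 \<in> U\<Theta>"
    by (rule local_diffeo[OF open_UNIV UNIV_I s\<Theta> \<Theta>inj])
  obtain UZ VZ \<phi> where ZZ: "diffeo UZ VZ Z \<phi>" "0 \<in> UZ"
    by (rule local_diffeo[OF open_UNIV UNIV_I sZ Zinj])
  have h\<Theta>: "homeomorphism U\<Theta> V\<Theta> \<Theta> \<psi>" "open U\<Theta>" "open V\<Theta>" and hZ: "homeomorphism UZ VZ Z \<phi>" "open VZ"
    and s\<phi>: "smooth_on VZ \<phi>"
    using \<Theta>(1) ZZ(1) by (simp_all add: diffeo_def)
  have Z\<phi>: "Z (\<phi> x) = x" if "x \<in> VZ" for x using hZ that by (auto simp: homeomorphism_def)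
  have \<phi>0: "\<phi> x0 = 0" "x0 \<in> VZ" using hZ ZZ(2) Z0 by (auto simp: homeomorphism_def)
  have VZU: "VZ \<subseteq> U"
  proof
    fix x assume "x \<in> VZ"
    then show "x \<in> U" using inU[of "\<phi> x"] Z\<phi>[of x] by simp
  qed
  have F\<Theta>: "F x = \<Theta> (cusp (\<phi> x))" if "x \<in> VZ" for x
  proof -
    have "F x = Ft (\<phi> x $ 1, \<phi> x $ 2)" by (simp add: Ft_def vector2_components Z\<phi>[OF that])
    then show ?thesis by (simp add: AB \<Theta>_def cusp_def)
  qed
  \<comment> \<open>The neighbourhood is cut down twice, so that the cusp lands where
    \<open>\<Theta>\<close> is invertible and \<open>F\<close> lands in \<open>V\<close>.\<close>
  define U0 where "U0 = VZ \<inter> (\<lambda>x. cusp (\<phi> x)) -` U\<Theta>"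
  define U1 where "U1 = U0 \<inter> F -` V"
  have "smooth_on VZ (\<lambda>x. cusp (\<phi> x))"
    by (rule smooth_on_compose[OF hZ(2) open_UNIV smooth_cusp[OF open_UNIV] s\<phi>]) simp
  then have oU0: "open U0"
    unfolding U0_def using continuous_open_preimage[OF smooth_on_continuous hZ(2) h\<Theta>(2)] by blast
  have "continuous_on U0 F"
    using smooth_on_continuous[OF smooth_F] VZU by (auto simp: U0_def intro: continuous_on_subset)
  then have oU1: "open U1" unfolding U1_def using continuous_open_preimage oU0 V(1) by blast
  have cusp0: "cusp 0 = 0" by (simp add: cusp_def vec_eq_iff forall_3)
  have FV: "F x \<in> V\<Theta> \<and> \<psi> (F x) = cusp (\<phi> x)" if "x \<in> U1" for x
    using that h\<Theta>(1) F\<Theta>[of x] by (auto simp: U1_def U0_def homeomorphism_def)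
  have x01: "x0 \<in> U1" using \<phi>0 cusp0 \<Theta>(2) V(2) by (simp add: U1_def U0_def)
  show ?thesis
  proof
    show "diffeo U1 (\<phi> ` U1) \<phi> Z"
      by (rule diffeo_subset[OF diffeo_sym[OF ZZ(1)] oU1]) (auto simp: U1_def U0_def)
    show "diffeo (V\<Theta> \<inter> V) (\<psi> ` (V\<Theta> \<inter> V)) \<psi> \<Theta>"
      by (rule diffeo_subset[OF diffeo_sym[OF \<Theta>(1)]]) (use h\<Theta>(3) V(1) in auto)
    show "F ` U1 \<subseteq> V\<Theta> \<inter> V" using FV by (auto simp: U1_def)
    show "\<psi> (F x0) = 0" using FV[OF x01] \<phi>0(1) cusp0 by simp
  qed (use x01 FV \<phi>0 VZU in \<open>auto simp: U1_def U0_def\<close>)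
qed

end

section \<open>The singular curvature in coordinates\<close>

text \<open>The component along the first vector drops out of the determinant. Hence, when a
  velocity is a scalar function times a frame vector, the derivative of that function never has to
  be known.\<close>

lemma det3_linear_mod:
  fixes p q n :: "real ^ 3"
  shows "det (vector [a *\<^sub>R p, b *\<^sub>R p + c *\<^sub>R q, n] :: real ^ 3 ^ 3) = a * c * det (vector [p, q, n] :: real ^ 3 ^ 3)"
  by (simp add: det_3 algebra_simps)

context conormal_front
begin

text \<open>The covector \<open>row i\<close> as a vector, divided by its squared length, which
  equals that of \<open>null i\<close>; so row \<open>i\<close> takes the value 1 on it, and its
  image \<open>frame\<close> has \<open>i\<close>-th coordinate 1.\<close>

definition sect :: "3 \<Rightarrow> real ^ 2 \<Rightarrow> real ^ 2" where
  "sect i x = (1 / (null i x \<bullet> null i x)) *\<^sub>R vector [row i x (axis 1 1), row i x (axis 2 1)]"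

definition frame :: "3 \<Rightarrow> real ^ 2 \<Rightarrow> real ^ 3" where
  "frame i x = sect i x $ 1 *\<^sub>R D x (axis 1 1) + sect i x $ 2 *\<^sub>R D x (axis 2 1)"

definition turn :: "real ^ 2 \<Rightarrow> real ^ 2" where
  "turn x = vector [frechet_derivative area (at x) (axis 2 1), - frechet_derivative area (at x) (axis 1 1)]"

definition regular :: "3 \<Rightarrow> (real ^ 2) set" where
  "regular i = {x \<in> U. null i x \<noteq> 0}"

lemma open_regular: "open (regular i)"
proof -
  have "open (U \<inter> null i -` (- {0}))"
    by (intro continuous_open_preimage smooth_on_continuous[OF smooth_null] open_U) auto
  moreover have "U \<inter> null i -` (- {0}) = regular i" by (auto simp: regular_def)
  ultimately show ?thesis by simp
qed

lemma regularD: "x \<in> regular i \<Longrightarrow> x \<in> U" "x \<in> regular i \<Longrightarrow> null i x \<noteq> 0"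
  by (auto simp: regular_def)

lemma smooth_sect: "smooth_on (regular i) (sect i)"
proof -
  have "smooth_on (regular i) (\<lambda>x. inverse (null i x \<bullet> null i x))"
    using regularD(2)
    by (intro smooth_on_inverse smooth_on_inner smooth_on_subset[OF smooth_null] open_regular)
       (auto simp: regular_def)
  then show ?thesis
    unfolding sect_def divide_inverse mult_1
    by (intro smooth_on_scaleR smooth_on_vector2 open_regular smooth_on_subset[OF smooth_row]) (auto simp: regular_def)
qed

lemma smooth_frame: "smooth_on (regular i) (frame i)"
  unfolding frame_def
  by (intro smooth_on_add smooth_on_scaleR smooth_on_vec_nth smooth_sect open_regular smooth_on_subset[OF smooth_D])
     (auto simp: regular_def)

lemma frame_eq: "x \<in> U \<Longrightarrow> frame i x = D x (sect i x)"
  using linear_vec2[OF linear_D, of x "sect i x"] by (simp add: frame_def)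

lemma row_sect:
  assumes "x \<in> regular i"
  shows "row i x (sect i x) = 1"
proof -
  have n: "null i x \<bullet> null i x = (row i x (axis 1 1))\<^sup>2 + (row i x (axis 2 1))\<^sup>2"
    by (simp add: null_def inner_vec_def sum_2 power2_eq_square)
  have "null i x \<bullet> null i x \<noteq> 0" using regularD(2)[OF assms] by simp
  then show ?thesis
    using linear_vec2[OF linear_row[OF regularD(1)[OF assms]], of i "sect i x"]
    by (simp add: sect_def n power2_eq_square flip: add_divide_distrib)
qed

text \<open>\<open>v\<close> differs from a multiple of \<open>sect i x\<close> by a vector in the
  kernel of row \<open>i\<close>, and on the singular set dF kills that vector too.\<close>

lemma D_eq_frame:
  assumes x: "x \<in> regular i" and 0: "area x = 0"
  shows "D x v = row i x v *\<^sub>R frame i x"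
proof -
  note xU = regularD(1)[OF x]
  have "row i x (v - row i x v *\<^sub>R sect i x) = 0"
    by (simp add: linear_diff[OF linear_row[OF xU]] linear_cmul[OF linear_row[OF xU]] row_sect[OF x])
  then obtain c where c: "v - row i x v *\<^sub>R sect i x = c *\<^sub>R null i x"
    using row_zero_null[OF xU regularD(2)[OF x]] by blast
  have "D x (v - row i x v *\<^sub>R sect i x) = 0"
    unfolding c linear_cmul[OF linear_D[OF xU]] D_null[OF xU 0] by simp
  then show ?thesis
    by (simp add: linear_diff[OF linear_D[OF xU]] linear_cmul[OF linear_D[OF xU]] frame_eq[OF xU])
qed

lemma frame_nonzero: "x \<in> regular i \<Longrightarrow> frame i x \<noteq> 0"
  using row_sect frame_eq regularD(1) by (fastforce simp: row_def)

text \<open>On the singular set dF(turn) is \<open>row i x (turn x)\<close> times the frame, so the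
  middle vector is the covariant derivative of the frame along \<open>turn\<close>. The expression
  itself makes sense on all of \<open>regular i\<close>, which is what allows taking limits.\<close>

definition curvature_numerator :: "(real ^ 2 \<Rightarrow> real ^ 3 \<Rightarrow> real ^ 3 \<Rightarrow> real ^ 3) \<Rightarrow> 3 \<Rightarrow> real ^ 2 \<Rightarrow> real" where
  "curvature_numerator \<Gamma> i x = det (vector [frame i x,
     frechet_derivative (frame i) (at x) (turn x) + row i x (turn x) *\<^sub>R \<Gamma> x (frame i x) (frame i x), N x] :: real ^ 3 ^ 3)"

lemma area_deriv: "x \<in> U \<Longrightarrow> frechet_derivative area (at x) h =
    h $ 1 * frechet_derivative area (at x) (axis 1 1) + h $ 2 * frechet_derivative area (at x) (axis 2 1)"
  using linear_vec2[OF has_derivative_linear[OF area_has_derivative], of x h] by simp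

text \<open>Fixes the orientation: \<open>area\<close> increases to the left of \<open>turn\<close>.
  For a positive pair formed by a tangent and a null vector, the derivative of \<open>area\<close>
  along the latter therefore tells whether the tangent points along \<open>turn\<close> or against
  it.\<close>

lemma det_turn: "x \<in> U \<Longrightarrow> det (vector [turn x, h] :: real ^ 2 ^ 2) = frechet_derivative area (at x) h"
  using area_deriv[of x h] by (simp add: turn_def det_2)

lemma singular_tangent:
  assumes x: "x \<in> U" and a: "frechet_derivative area (at x) \<noteq> (\<lambda>_. 0)" and h: "frechet_derivative area (at x) h = 0"
  obtains c where "h = c *\<^sub>R turn x"
proof -
  let ?c = "frechet_derivative area (at x) (axis 1 1)" and ?d = "frechet_derivative area (at x) (axis 2 1)"
  have "?c \<noteq> 0 \<or> ?d \<noteq> 0"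
  proof (rule ccontr)
    assume "\<not> ?thesis"
    then have "frechet_derivative area (at x) v = 0" for v using area_deriv[OF x, of v] by simp
    then show False using a by auto
  qed
  moreover have "?c * h $ 1 + ?d * h $ 2 = 0" using h area_deriv[OF x, of h] by (simp add: mult.commute)
  ultimately obtain c where c: "h = c *\<^sub>R vector [- ?d, ?c]" 
    using orthogonal_line_vec2[of ?c h ?d] by blast
  then have "h = (- c) *\<^sub>R turn x" by (simp add: turn_def vec_eq_iff forall_2)
  then show ?thesis using that by blast
qed

text \<open>On the singular set dF takes values in the multiples of the frame, so the image curve
  has velocity \<rho> times the frame. This holds on an interval and may be differentiated once
  more; \<open>b\<close> is the derivative of \<rho>.\<close>

lemma singular_curve_derivatives:
  assumes I: "open I" "0 \<in> I" and \<gamma>: "smooth_on I \<gamma>" and sing: "\<And>t. t \<in> I \<Longrightarrow> \<gamma> t \<in> U \<and> area (\<gamma> t) = 0"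
    and reg: "\<gamma> 0 \<in> regular i"
  defines "x \<equiv> \<gamma> 0" and "v \<equiv> vector_derivative \<gamma> (at (0::real))"
  obtains b where "vector_derivative (F \<circ> \<gamma>) (at 0) = row i x v *\<^sub>R frame i x"
    "vector_derivative (\<lambda>s. vector_derivative (F \<circ> \<gamma>) (at s)) (at 0) =
      b *\<^sub>R frame i x + row i x v *\<^sub>R frechet_derivative (frame i) (at x) v"
    "frechet_derivative area (at x) v = 0"
proof -
  define J where "J = I \<inter> \<gamma> -` regular i"
  have oJ: "open J" unfolding J_def
    by (rule continuous_open_preimage[OF smooth_on_continuous[OF \<gamma>] I(1) open_regular])
  have J0: "0 \<in> J" using I(2) reg by (simp add: J_def)
  have s\<gamma>: "smooth_on J \<gamma>" using \<gamma> by (rule smooth_on_subset) (simp add: J_def)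
  let ?v = "\<lambda>s. vector_derivative \<gamma> (at s)"
  have d\<gamma>: "(\<gamma> has_vector_derivative ?v s) (at s)" if "s \<in> J" for s
    using smooth_on_differentiable[OF oJ s\<gamma> that] vector_derivative_works by blast
  have sv: "smooth_on J ?v"
  proof (rule smooth_on_cong[OF oJ smooth_on_frechet[OF s\<gamma>, of 1]])
    show "frechet_derivative \<gamma> (at s) 1 = ?v s" if "s \<in> J" for s
      using frechet_derivative_eq_vector_derivative[OF smooth_on_differentiable[OF oJ s\<gamma> that]] by simp
  qed
  have JU: "\<gamma> s \<in> U" "\<gamma> s \<in> regular i" "area (\<gamma> s) = 0" if "s \<in> J" for s
    using that sing by (auto simp: J_def)
  define \<rho> where "\<rho> s = row i (\<gamma> s) (?v s)" for s
  have s\<rho>: "smooth_on J \<rho>"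
  proof (rule smooth_on_cong[OF oJ])
    have "smooth_on J (\<lambda>s. row i (\<gamma> s) w)" for w
      by (rule smooth_on_compose[OF oJ open_U smooth_row s\<gamma>]) (use JU in auto)
    then show "smooth_on J (\<lambda>s. ?v s $ 1 * row i (\<gamma> s) (axis 1 1) + ?v s $ 2 * row i (\<gamma> s) (axis 2 1))"
      by (intro smooth_on_add smooth_on_mult smooth_on_vec_nth sv oJ)
    show "?v s $ 1 * row i (\<gamma> s) (axis 1 1) + ?v s $ 2 * row i (\<gamma> s) (axis 2 1) = \<rho> s" if "s \<in> J" for s
      using linear_vec2[OF linear_row[OF JU(1)[OF that]], of i "?v s"] by (simp add: \<rho>_def)
  qed
  have chain: "((G \<circ> \<gamma>) has_vector_derivative G' (?v s)) (at s)" if "s \<in> J" "(G has_derivative G') (at (\<gamma> s))"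
    for G :: "real ^ 2 \<Rightarrow> 'z::real_normed_vector" and G' s
    using vector_derivative_diff_chain_within[OF d\<gamma>[OF that(1)], of G G'] has_derivative_at_withinI[OF that(2)]
    by simp
  have F': "vector_derivative (F \<circ> \<gamma>) (at s) = \<rho> s *\<^sub>R frame i (\<gamma> s)" if s: "s \<in> J" for s
    using vector_derivative_at[OF chain[OF s F_has_derivative[OF JU(1)[OF s]]]] D_eq_frame[OF JU(2)[OF s] JU(3)[OF s]]
    by (simp add: \<rho>_def)
  define b where "b = vector_derivative \<rho> (at 0)"
  have \<rho>': "(\<rho> has_real_derivative b) (at 0)"
    using smooth_on_differentiable[OF oJ s\<rho> J0] unfolding b_def has_real_derivative_iff_has_vector_derivative
    by (simp add: vector_derivative_works)
  have fr: "(frame i has_derivative frechet_derivative (frame i) (at x)) (at (\<gamma> 0))"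
    unfolding x_def by (rule smooth_on_has_derivative[OF open_regular smooth_frame JU(2)[OF J0]])
  have "((\<lambda>s. \<rho> s *\<^sub>R (frame i \<circ> \<gamma>) s) has_vector_derivative
      (\<rho> 0 *\<^sub>R frechet_derivative (frame i) (at x) (?v 0) + b *\<^sub>R (frame i \<circ> \<gamma>) 0)) (at 0)"
    by (rule has_vector_derivative_scaleR[OF \<rho>' chain[OF J0 fr]])
  then have "((\<lambda>s. vector_derivative (F \<circ> \<gamma>) (at s)) has_vector_derivative
      (\<rho> 0 *\<^sub>R frechet_derivative (frame i) (at x) (?v 0) + b *\<^sub>R (frame i \<circ> \<gamma>) 0)) (at 0)"
    by (rule has_vector_derivative_transform_within_open[OF _ oJ J0]) (simp add: F')
  from vector_derivative_at[OF this]
  have 2: "vector_derivative (\<lambda>s. vector_derivative (F \<circ> \<gamma>) (at s)) (at 0) =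
      b *\<^sub>R frame i x + row i x v *\<^sub>R frechet_derivative (frame i) (at x) v"
    by (simp add: \<rho>_def x_def v_def add.commute)
  have 1: "((area \<circ> \<gamma>) has_vector_derivative frechet_derivative area (at x) v) (at 0)"
    unfolding x_def v_def by (rule chain[OF J0 area_has_derivative[OF JU(1)[OF J0]]])
  have "((\<lambda>s. 0) has_vector_derivative frechet_derivative area (at x) v) (at (0::real))"
    by (rule has_vector_derivative_transform_within_open[OF 1 oJ J0]) (simp add: JU(3))
  from vector_derivative_unique_at[OF this has_vector_derivative_const]
  have 3: "frechet_derivative area (at x) v = 0" .
  have "vector_derivative (F \<circ> \<gamma>) (at 0) = row i x v *\<^sub>R frame i x"
    using F'[OF J0] by (simp add: \<rho>_def x_def v_def)
  then show ?thesis using that 2 3 by blast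
qed

text \<open>The velocity is c times \<open>turn\<close>, where c has the sign of the derivative of
  \<open>area\<close> along \<open>\<eta>\<close> because the pair of velocity and
  \<open>\<eta>\<close> is positive. With r = row i x (turn x), the numerator scales by c^3 r^2 and
  the denominator by |c|^3 |r|^3; the sign factor turns c^3 into |c|^3, and the parametrization
  disappears.\<close>

lemma singular_curve_curvature:
  assumes I: "open I" "0 \<in> I" and \<gamma>: "smooth_on I \<gamma>" and sing: "\<And>t. t \<in> I \<Longrightarrow> \<gamma> t \<in> U \<and> area (\<gamma> t) = 0"
    and reg: "\<gamma> 0 \<in> regular i" and a: "frechet_derivative area (at (\<gamma> 0)) \<noteq> (\<lambda>_. 0)"
    and \<eta>: "D (\<gamma> 0) \<eta> = 0" "det (vector [vector_derivative \<gamma> (at 0), \<eta>] :: real ^ 2 ^ 2) > 0"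
    and bil: "bilinear (\<Gamma> (\<gamma> 0))"
  defines "x \<equiv> \<gamma> 0" and "\<sigma>' \<equiv> vector_derivative (F \<circ> \<gamma>) (at 0)"
    and "\<sigma>'' \<equiv> vector_derivative (\<lambda>s. vector_derivative (F \<circ> \<gamma>) (at s)) (at (0::real))"
  shows "row i x (turn x) \<noteq> 0"
    "sgn (frechet_derivative area (at x) \<eta>) * det (vector [\<sigma>', \<sigma>'' + \<Gamma> x \<sigma>' \<sigma>', N x] :: real ^ 3 ^ 3) /
      sqrt (\<sigma>' \<bullet> (G *v \<sigma>')) ^ 3 =
      curvature_numerator \<Gamma> i x / (\<bar>row i x (turn x)\<bar> * sqrt (frame i x \<bullet> (G *v frame i x)) ^ 3)"
proof -
  define v where "v = vector_derivative \<gamma> (at (0::real))"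
  let ?e = "frame i x" and ?de = "frechet_derivative (frame i) (at x)"
  have xr: "x \<in> regular i" and xU: "x \<in> U" using reg regularD(1) by (auto simp: x_def)
  obtain b where b: "\<sigma>' = row i x v *\<^sub>R ?e" "\<sigma>'' = b *\<^sub>R ?e + row i x v *\<^sub>R ?de v" and av: "frechet_derivative area (at x) v = 0"
    using singular_curve_derivatives[OF I \<gamma> sing reg] unfolding x_def v_def \<sigma>'_def \<sigma>''_def by blast
  obtain c where c: "v = c *\<^sub>R turn x" using singular_tangent[OF xU _ av] a by (auto simp: x_def)
  have lin: "linear (row i x)" "linear (D x)" using linear_row[OF xU] linear_D[OF xU] by auto
  have linde: "linear ?de"
    using has_derivative_linear[OF smooth_on_has_derivative[OF open_regular smooth_frame xr]] .
  have d: "det (vector [v, \<eta>] :: real ^ 2 ^ 2) = c * frechet_derivative area (at x) \<eta>"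
    by (simp add: c det_turn[OF xU, symmetric] det_2 algebra_simps)
  have pos: "c * frechet_derivative area (at x) \<eta> > 0" using \<eta>(2) d by (simp add: v_def)
  then have c0: "c \<noteq> 0" by auto
  have sgn: "sgn (frechet_derivative area (at x) \<eta>) = sgn c"
    using pos by (auto simp: zero_less_mult_iff)
  define r where "r = row i x (turn x)"
  \<comment> \<open>Otherwise \<open>turn x\<close> and \<open>\<eta>\<close> would both be
    multiples of \<open>null i x\<close>, against the positive determinant.\<close>
  show r0: "row i x (turn x) \<noteq> 0"
  proof
    assume "row i x (turn x) = 0"
    then obtain k where k: "turn x = k *\<^sub>R null i x" using row_zero_null[OF xU regularD(2)[OF xr]] by blast
    have "row i x \<eta> = 0" using \<eta>(1) by (simp add: row_def x_def)
    then obtain l where l: "\<eta> = l *\<^sub>R null i x" using row_zero_null[OF xU regularD(2)[OF xr]] by blast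
    have "det (vector [v, \<eta>] :: real ^ 2 ^ 2) = 0" by (simp add: c k l det_2)
    then have "c * frechet_derivative area (at x) \<eta> = 0" using d by simp
    then show False using pos by linarith
  qed
  have rv: "row i x v = c * r" by (simp add: c r_def linear_cmul[OF lin(1)])
  have s1: "\<sigma>' = (c * r) *\<^sub>R ?e" by (simp add: b rv)
  have \<Gamma>: "\<Gamma> x \<sigma>' \<sigma>' = (c * r * (c * r)) *\<^sub>R \<Gamma> x ?e ?e"
    using bil unfolding s1 by (simp add: x_def bilinear_lmul bilinear_rmul)
  have "\<sigma>'' + \<Gamma> x \<sigma>' \<sigma>' = b *\<^sub>R ?e + (c * r * c) *\<^sub>R (?de (turn x) + r *\<^sub>R \<Gamma> x ?e ?e)"
    unfolding b(2) \<Gamma> rv by (simp add: c linear_cmul[OF linde] algebra_simps)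
  then have num: "det (vector [\<sigma>', \<sigma>'' + \<Gamma> x \<sigma>' \<sigma>', N x] :: real ^ 3 ^ 3) = c * r * (c * r * c) * curvature_numerator \<Gamma> i x"
    unfolding s1 by (simp only: det3_linear_mod curvature_numerator_def r_def)
  have "\<sigma>' \<bullet> (G *v \<sigma>') = (c * r)\<^sup>2 * (?e \<bullet> (G *v ?e))"
    unfolding s1 by (simp add: matrix_vector_mult_scaleR power2_eq_square)
  then have den: "sqrt (\<sigma>' \<bullet> (G *v \<sigma>')) = \<bar>c\<bar> * \<bar>r\<bar> * sqrt (?e \<bullet> (G *v ?e))"
    by (simp add: real_sqrt_mult abs_mult)
  have "sgn c * (c * r * (c * r * c)) = \<bar>c\<bar> ^ 3 * \<bar>r\<bar>\<^sup>2"
    by (cases "0 < c") (auto simp: sgn_if power3_eq_cube power2_eq_square)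
  then have eq: "sgn c * (c * r * (c * r * c) * curvature_numerator \<Gamma> i x) = \<bar>c\<bar> ^ 3 * \<bar>r\<bar>\<^sup>2 * curvature_numerator \<Gamma> i x"
    by (metis mult.assoc)
  \<comment> \<open>For S = 0 both sides are 0, because division by zero has the value 0.\<close>
  have fin: "a ^ 3 * b\<^sup>2 * K / (a * b * S) ^ 3 = K / (b * S ^ 3)" if "a \<noteq> 0" "b \<noteq> 0" for a b K S :: real
    using that by (cases "S = 0") (simp_all add: field_simps power3_eq_cube power2_eq_square)
  have "\<bar>c\<bar> \<noteq> 0" "\<bar>r\<bar> \<noteq> 0" using c0 r0 by (simp_all add: r_def)
  note fin = fin[OF this]
  show "sgn (frechet_derivative area (at x) \<eta>) * det (vector [\<sigma>', \<sigma>'' + \<Gamma> x \<sigma>' \<sigma>', N x] :: real ^ 3 ^ 3) /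
      sqrt (\<sigma>' \<bullet> (G *v \<sigma>')) ^ 3 =
      curvature_numerator \<Gamma> i x / (\<bar>row i x (turn x)\<bar> * sqrt (frame i x \<bullet> (G *v frame i x)) ^ 3)"
    unfolding sgn num den r_def[symmetric] eq fin ..
qed

text \<open>With \<open>X = sect i x\<close> and the null vector \<open>n\<close>, symmetry of the second derivative turns the
  derivative of the frame \<open>dF X\<close> along \<open>n\<close> into the derivative of \<open>dF n\<close> along \<open>X\<close>, which is read off
  from the area density \<open>det (dF X, dF n, N) = det (X, n) area\<close>.\<close>

lemma curvature_numerator_neg:
  assumes x: "x \<in> regular i" and 0: "area x = 0" and a: "frechet_derivative area (at x) \<noteq> (\<lambda>_. 0)"
    and r: "row i x (turn x) = 0"
  shows "curvature_numerator \<Gamma> i x < 0"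
proof -
  note xU = regularD(1)[OF x]
  let ?a = "frechet_derivative area (at x)" and ?n = "null i x" and ?X = "sect i x" and ?e = "frame i x"
  obtain k where k: "turn x = k *\<^sub>R ?n" using row_zero_null[OF xU regularD(2)[OF x] r] by blast
  define Q where "Q u v = frechet_derivative (\<lambda>y. D y u) (at x) v" for u v
  have DQ: "((\<lambda>y. D y u) has_derivative Q u) (at x)" for u
    unfolding Q_def by (rule smooth_on_has_derivative[OF open_U smooth_D xU])
  have linQ1: "linear (Q u)" for u using DQ has_derivative_linear by blast
  have Qsym: "Q u v = Q v u" for u v
    unfolding Q_def D_def by (rule mixed_derivatives_eq[OF open_U smooth_F xU])
  have linQ2: "linear (\<lambda>u. Q u v)" for v
  proof -
    have "(\<lambda>u. Q u v) = Q v" using Qsym by blast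
    then show ?thesis using linQ1 by simp
  qed
  have N_D: "(N has_derivative frechet_derivative N (at x)) (at x)"
    by (rule smooth_on_has_derivative[OF open_U smooth_N xU])
  have sD: "(sect i has_derivative frechet_derivative (sect i) (at x)) (at x)"
    by (rule smooth_on_has_derivative[OF open_regular smooth_sect x])
  let ?s = "\<lambda>h. frechet_derivative (sect i) (at x) h"
  have "(frame i has_derivative (\<lambda>h. (?X $ 1 *\<^sub>R Q (axis 1 1) h + ?s h $ 1 *\<^sub>R D x (axis 1 1)) +
      (?X $ 2 *\<^sub>R Q (axis 2 1) h + ?s h $ 2 *\<^sub>R D x (axis 2 1)))) (at x)"
    unfolding frame_def
    by (intro has_derivative_add has_derivative_scaleR DQ bounded_linear.has_derivative[OF bounded_linear_vec_nth sD])
  from fun_cong[OF frechet_derivative_at[OF this], of ?n]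
  have "frechet_derivative (frame i) (at x) ?n = (?X $ 1 *\<^sub>R Q (axis 1 1) ?n + ?s ?n $ 1 *\<^sub>R D x (axis 1 1)) +
      (?X $ 2 *\<^sub>R Q (axis 2 1) ?n + ?s ?n $ 2 *\<^sub>R D x (axis 2 1))" by simp
  also have "\<dots> = Q ?X ?n + D x (?s ?n)"
    using linear_vec2[of "\<lambda>u. Q u ?n" ?X, OF linQ2] linear_vec2[OF linear_D[OF xU], of "?s ?n"] by simp
  \<comment> \<open>Up to a multiple of the frame, which the determinant ignores, only the second
    derivative of the map remains.\<close>
  finally have de: "frechet_derivative (frame i) (at x) ?n = row i x (?s ?n) *\<^sub>R ?e + 1 *\<^sub>R Q ?X ?n"
    using D_eq_frame[OF x 0] by simp
  have linde: "linear (frechet_derivative (frame i) (at x))"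
    using has_derivative_linear[OF smooth_on_has_derivative[OF open_regular smooth_frame x]] .
  have "curvature_numerator \<Gamma> i x = det (vector [1 *\<^sub>R ?e, (k * row i x (?s ?n)) *\<^sub>R ?e + k *\<^sub>R Q ?X ?n, N x] :: real ^ 3 ^ 3)"
    unfolding curvature_numerator_def r k linear_cmul[OF linde] de
    by (simp add: scaleR_add_right row_null[OF xU] linear_cmul[OF linear_row[OF xU]])
  then have num: "curvature_numerator \<Gamma> i x = k * det (vector [?e, Q ?X ?n, N x] :: real ^ 3 ^ 3)"
    unfolding det3_linear_mod by simp
  have Dn: "D x ?n = 0" by (rule D_null[OF xU 0])
  \<comment> \<open>\<open>?X\<close> and \<open>?n\<close> are frozen at \<open>x\<close>, so one
    and the same function is differentiated by the product rule here and as a constant multiple of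
    \<open>area\<close> in \<open>R\<close>.\<close>
  have L: "((\<lambda>y. cross3 (D y ?X) (D y ?n) \<bullet> N y) has_derivative
     (\<lambda>h. cross3 (D x ?X) (D x ?n) \<bullet> frechet_derivative N (at x) h + (cross3 (D x ?X) (Q ?n h) + cross3 (Q ?X h) (D x ?n)) \<bullet> N x)) (at x)"
    by (rule has_derivative_inner[OF has_derivative_cross3[OF DQ DQ] N_D])
  have R: "((\<lambda>y. cross3 (D y ?X) (D y ?n) \<bullet> N y) has_derivative (\<lambda>h. det (vector [?X, ?n] :: real ^ 2 ^ 2) * ?a h)) (at x)"
  proof (rule has_derivative_transform_within_open[OF _ open_U xU])
    show "((\<lambda>y. det (vector [?X, ?n] :: real ^ 2 ^ 2) * area y) has_derivative (\<lambda>h. det (vector [?X, ?n] :: real ^ 2 ^ 2) * ?a h)) (at x)"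
      by (intro has_derivative_mult_right area_has_derivative xU)
    show "det (vector [?X, ?n] :: real ^ 2 ^ 2) * area y = cross3 (D y ?X) (D y ?n) \<bullet> N y" if "y \<in> U" for y
      using cross3_D[OF that, of ?X ?n] M_N[OF that] by simp
  qed
  have "cross3 ?e (Q ?X ?n) \<bullet> N x = det (vector [?X, ?n] :: real ^ 2 ^ 2) * ?a ?X"
    using fun_cong[OF has_derivative_unique[OF L R], of ?X] Dn Qsym[of ?n ?X] frame_eq[OF xU, of i] by simp
  then have "curvature_numerator \<Gamma> i x = k * det (vector [?X, ?n] :: real ^ 2 ^ 2) * ?a ?X"
    unfolding num cross3_inner_det by simp
  also have "k * det (vector [?X, ?n] :: real ^ 2 ^ 2) = det (vector [?X, turn x] :: real ^ 2 ^ 2)"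
    unfolding k by (simp add: det_2 algebra_simps)
  also have "\<dots> = - ?a ?X" using det_turn[OF xU, of ?X] by (simp add: det_2 mult.commute)
  finally have eq: "curvature_numerator \<Gamma> i x = - (?a ?X)\<^sup>2" by (simp add: power2_eq_square)
  \<comment> \<open>The kernel of the derivative of \<open>area\<close> is spanned by
    \<open>turn x\<close>, on which row \<open>i\<close> vanishes, whereas row \<open>i\<close> is 1
    on \<open>?X\<close>.\<close>
  have "?a ?X \<noteq> 0"
  proof
    assume "?a ?X = 0"
    then obtain l where "?X = l *\<^sub>R turn x" using singular_tangent[OF xU a] by blast
    then have "row i x ?X = 0" using r linear_cmul[OF linear_row[OF xU]] by simp
    then show False using row_sect[OF x] by simp
  qed
  then show ?thesis unfolding eq by simp
qed

lemma smooth_turn: "smooth_on U turn"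
  unfolding turn_def by (intro smooth_on_vector2 smooth_on_minus smooth_on_frechet smooth_area open_U)

lemma continuous_row_turn: "continuous_on U (\<lambda>x. row i x (turn x))"
proof -
  have "continuous_on U (\<lambda>x. turn x $ 1 *\<^sub>R row i x (axis 1 1) + turn x $ 2 *\<^sub>R row i x (axis 2 1))"
    by (intro continuous_intros smooth_on_continuous[OF smooth_turn] smooth_on_continuous[OF smooth_row])
  then show ?thesis
    by (rule continuous_on_eq) (use linear_vec2[OF linear_row] in metis)
qed

text \<open>Continuity of \<Gamma> is available for fixed arguments only, while it is evaluated on
  the moving frame; bilinearity reduces this to the finitely many pairs of basis vectors.\<close>

lemma continuous_curvature_numerator:
  assumes bil: "\<And>x. x \<in> U \<Longrightarrow> bilinear (\<Gamma> x)" and cont: "\<And>X Y. continuous_on U (\<lambda>x. \<Gamma> x X Y)"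
  shows "continuous_on (regular i) (curvature_numerator \<Gamma> i)"
proof -
  have sub: "regular i \<subseteq> U" by (auto simp: regular_def)
  have e: "continuous_on (regular i) (frame i)" by (rule smooth_on_continuous[OF smooth_frame])
  have \<Gamma>e: "\<Gamma> x v v = (\<Sum>j\<in>UNIV. \<Sum>l\<in>UNIV. (v $ j * v $ l) *\<^sub>R \<Gamma> x (axis j 1) (axis l 1))" if "x \<in> U" for x v
  proof -
    have v: "v = (\<Sum>j\<in>UNIV. v $ j *\<^sub>R axis j 1)" by (simp add: basis_expansion[symmetric] flip: scalar_mult_eq_scaleR)
    have l: "linear (\<lambda>a. \<Gamma> x a b)" "linear (\<Gamma> x b)" for b using bil[OF that] by (auto simp: bilinear_def)
    have "\<Gamma> x v v = \<Gamma> x (\<Sum>j\<in>UNIV. v $ j *\<^sub>R axis j 1) (\<Sum>l\<in>UNIV. v $ l *\<^sub>R axis l 1)" using v by simp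
    also have "\<dots> = (\<Sum>l\<in>UNIV. \<Sum>j\<in>UNIV. (v $ j * v $ l) *\<^sub>R \<Gamma> x (axis j 1) (axis l 1))"
      by (simp add: linear_sum[OF l(1)] linear_sum[OF l(2)] linear_cmul[OF l(1)] linear_cmul[OF l(2)]
          scaleR_sum_right mult.commute)
    finally show ?thesis by (subst sum.swap)
  qed
  have g: "continuous_on (regular i) (\<lambda>x. \<Gamma> x (frame i x) (frame i x))"
  proof (rule continuous_on_eq)
    show "continuous_on (regular i) (\<lambda>x. \<Sum>j\<in>UNIV. \<Sum>l\<in>UNIV. (frame i x $ j * frame i x $ l) *\<^sub>R \<Gamma> x (axis j 1) (axis l 1))"
      by (intro continuous_intros e continuous_on_subset[OF cont sub])
  qed (use \<Gamma>e sub in auto)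
  have d: "continuous_on (regular i) (\<lambda>x. frechet_derivative (frame i) (at x) (turn x))"
  proof (rule continuous_on_eq)
    show "continuous_on (regular i) (\<lambda>x. turn x $ 1 *\<^sub>R frechet_derivative (frame i) (at x) (axis 1 1) +
        turn x $ 2 *\<^sub>R frechet_derivative (frame i) (at x) (axis 2 1))"
      by (intro continuous_intros continuous_on_subset[OF smooth_on_continuous[OF smooth_turn] sub]
          smooth_on_continuous[OF smooth_on_frechet[OF smooth_frame]])
    show "turn x $ 1 *\<^sub>R frechet_derivative (frame i) (at x) (axis 1 1) +
        turn x $ 2 *\<^sub>R frechet_derivative (frame i) (at x) (axis 2 1) = frechet_derivative (frame i) (at x) (turn x)"
      if "x \<in> regular i" for x
      using linear_vec2[OF has_derivative_linear[OF smooth_on_has_derivative[OF open_regular smooth_frame that]]] by metis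
  qed
  show ?thesis
    unfolding curvature_numerator_def cross3_inner_det[symmetric]
    by (intro continuous_intros continuous_on_cross e d g continuous_on_subset[OF continuous_row_turn sub]
        continuous_on_subset[OF smooth_on_continuous[OF smooth_N] sub])
qed

end

section \<open>Charts\<close>

lemma cinv_coord: "is_chart c \<Longrightarrow> q \<in> chart_dom c \<Longrightarrow> cinv c (coord c q) = q"
  by (simp add: is_chart_def homeomorphism_def)

lemma coord_cinv: "is_chart c \<Longrightarrow> x \<in> coord c ` chart_dom c \<Longrightarrow> coord c (cinv c x) = x"
  by (auto simp: is_chart_def homeomorphism_def)

lemma cinv_in_dom: "is_chart c \<Longrightarrow> x \<in> coord c ` chart_dom c \<Longrightarrow> cinv c x \<in> chart_dom c"
  using cinv_coord by fastforce

lemma coord_image_iff: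
  assumes "is_chart c" "W \<subseteq> chart_dom c"
  shows "x \<in> coord c ` W \<longleftrightarrow> x \<in> coord c ` chart_dom c \<and> cinv c x \<in> W"
proof
  assume "x \<in> coord c ` W"
  then obtain q where q: "q \<in> W" "x = coord c q" by blast
  then show "x \<in> coord c ` chart_dom c \<and> cinv c x \<in> W"
    using assms cinv_coord[OF assms(1)] by auto
next
  assume "x \<in> coord c ` chart_dom c \<and> cinv c x \<in> W"
  then show "x \<in> coord c ` W" using coord_cinv[OF assms(1)] by (metis imageI)
qed

lemma open_coord_image:
  assumes "is_chart c" "open W" "W \<subseteq> chart_dom c"
  shows "open (coord c ` W)"
proof -
  have "openin (top_of_set (coord c ` chart_dom c)) (coord c ` W)"
    using assms by (intro homeomorphism_imp_open_map[of "chart_dom c" _ "coord c" "cinv c"] open_subset)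
      (simp_all add: is_chart_def)
  then show ?thesis using assms(1) openin_open_trans by (auto simp: is_chart_def)
qed

lemma open_cinv_image:
  assumes "is_chart c" "open W" "W \<subseteq> coord c ` chart_dom c"
  shows "open (cinv c ` W)"
proof -
  have h: "homeomorphism (coord c ` chart_dom c) (chart_dom c) (cinv c) (coord c)"
    using assms(1) homeomorphism_symD by (auto simp: is_chart_def)
  have "openin (top_of_set (chart_dom c)) (cinv c ` W)"
    using assms by (intro homeomorphism_imp_open_map[OF h] open_subset)
  then show ?thesis using assms(1) openin_open_trans by (auto simp: is_chart_def)
qed

lemma smoothly_compatible_sym: "smoothly_compatible c d \<Longrightarrow> smoothly_compatible d c"
  by (auto simp: smoothly_compatible_def Int_commute)

lemma open_overlap: "is_chart c \<Longrightarrow> is_chart d \<Longrightarrow> open (coord c ` (chart_dom c \<inter> chart_dom d))"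
  by (rule open_coord_image) (auto simp: is_chart_def)

lemma transition_coord: "is_chart c \<Longrightarrow> q \<in> chart_dom c \<Longrightarrow> transition c d (coord c q) = coord d q"
  by (simp add: transition_def cinv_coord)

abbreviation transition_deriv :: "('m, 'n::finite) chart \<Rightarrow> ('m, 'n) chart \<Rightarrow> 'm \<Rightarrow> real ^ 'n \<Rightarrow> real ^ 'n" where
  "transition_deriv c d q \<equiv> frechet_derivative (transition c d) (at (coord c q))"

lemma transition_has_derivative:
  assumes "is_chart c" "is_chart d" "smoothly_compatible c d" "q \<in> chart_dom c" "q \<in> chart_dom d"
  shows "(transition c d has_derivative transition_deriv c d q) (at (coord c q))"
  using assms by (intro smooth_on_has_derivative[OF open_overlap[OF assms(1,2)]]) (auto simp: smoothly_compatible_def)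

lemma transition_deriv_inverse:
  assumes c: "is_chart c" "is_chart d" "smoothly_compatible c d" and q: "q \<in> chart_dom c" "q \<in> chart_dom d"
  shows "transition_deriv d c q (transition_deriv c d q v) = v"
proof -
  have "((\<lambda>x. transition d c (transition c d x)) has_derivative (\<lambda>v. transition_deriv d c q (transition_deriv c d q v))) (at (coord c q))"
    using has_derivative_compose[OF transition_has_derivative[OF c q]]
      transition_has_derivative[OF c(2,1) smoothly_compatible_sym[OF c(3)] q(2,1)] transition_coord[OF c(1) q(1)]
    by metis
  then have "((\<lambda>x. x) has_derivative (\<lambda>v. transition_deriv d c q (transition_deriv c d q v))) (at (coord c q))"
    by (rule has_derivative_transform_within_open[OF _ open_overlap[OF c(1,2)]])
       (use q c in \<open>auto simp: transition_coord\<close>)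
  from has_derivative_unique[OF this has_derivative_ident] show ?thesis by metis
qed

lemma transition_deriv_linear:
  "is_chart c \<Longrightarrow> is_chart d \<Longrightarrow> smoothly_compatible c d \<Longrightarrow> q \<in> chart_dom c \<Longrightarrow> q \<in> chart_dom d \<Longrightarrow> linear (transition_deriv c d q)"
  using transition_has_derivative has_derivative_linear by blast

lemma transition_deriv_eq_0_iff:
  assumes "is_chart c" "is_chart d" "smoothly_compatible c d" "q \<in> chart_dom c" "q \<in> chart_dom d"
  shows "transition_deriv c d q v = 0 \<longleftrightarrow> v = 0"
  using transition_deriv_inverse[OF assms] transition_deriv_linear[OF assms]
    transition_deriv_linear[OF assms(2,1) smoothly_compatible_sym[OF assms(3)] assms(5,4)] linear_0 by metis

text \<open>The chain rule. Continuity of \<open>f\<close> ensures that the factorization through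
  the old charts holds on an open set around the point.\<close>

lemma local_rep_change:
  assumes c: "is_chart c" "is_chart c'" "smoothly_compatible c' c" and d: "is_chart d" "is_chart d'" "smoothly_compatible d d'"
    and f: "continuous_on (chart_dom c) f"
    and q: "q \<in> chart_dom c" "q \<in> chart_dom c'" "f q \<in> chart_dom d" "f q \<in> chart_dom d'"
    and L: "(local_rep c d f has_derivative L) (at (coord c q))"
  shows "(local_rep c' d' f has_derivative (\<lambda>v. transition_deriv d d' (f q) (L (transition_deriv c' c q v)))) (at (coord c' q))"
proof -
  define W where "W = (chart_dom c \<inter> chart_dom c') \<inter> f -` (chart_dom d \<inter> chart_dom d')"
  have "open W"
    unfolding W_def using c d continuous_on_subset[OF f]
    by (intro continuous_open_preimage) (auto simp: is_chart_def)
  then have oW: "open (coord c' ` W)" using open_coord_image[OF c(2)] by (auto simp: W_def)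
  have "(local_rep c d f has_derivative L) (at (transition c' c (coord c' q)))"
    using L transition_coord[OF c(2) q(2)] by simp
  note 1 = has_derivative_compose[OF transition_has_derivative[OF c(2,1,3) q(2,1)] this]
  have "local_rep c d f (transition c' c (coord c' q)) = coord d (f q)"
    using transition_coord[OF c(2) q(2)] cinv_coord[OF c(1) q(1)] by (simp add: local_rep_def)
  then have "(transition d d' has_derivative transition_deriv d d' (f q)) (at (local_rep c d f (transition c' c (coord c' q))))"
    using transition_has_derivative[OF d q(3,4)] by simp
  note 2 = has_derivative_compose[OF 1 this]
  show ?thesis
  proof (rule has_derivative_transform_within_open[OF 2 oW])
    show "coord c' q \<in> coord c' ` W" using q by (auto simp: W_def)
    fix x assume "x \<in> coord c' ` W"
    then obtain r where "r \<in> W" "x = coord c' r" by blast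
    then show "transition d d' (local_rep c d f (transition c' c x)) = local_rep c' d' f x"
      using c d by (auto simp: W_def local_rep_def transition_def cinv_coord)
  qed
qed

text \<open>A chart of the atlas followed by a diffeomorphism of its coordinates. Since
  \<open>cinv\<close> is an \<open>inv_into\<close>, it has to be identified with
  \<open>cinv c \<circ> \<psi>\<close> before smoothness of the transition maps can be read
  off.\<close>

lemma smooth_chart_diffeo:
  fixes A :: "('m::topological_space, 'n::finite) chart set"
  assumes A: "\<forall>c\<in>A. is_chart c" "\<forall>c\<in>A. \<forall>d\<in>A. smoothly_compatible c d" and c: "c \<in> A"
    and dif: "diffeo U V \<phi> \<psi>" and U: "U \<subseteq> coord c ` chart_dom c"
  defines "\<Phi> \<equiv> (cinv c ` U, \<phi> \<circ> coord c)"
  shows "smooth_chart A \<Phi>"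
proof -
  have cc: "is_chart c" using A c by blast
  have hom: "homeomorphism U V \<phi> \<psi>" and oU: "open U" and oV: "open V" and s: "smooth_on U \<phi>" "smooth_on V \<psi>"
    using dif by (auto simp: diffeo_def)
  have dom: "chart_dom \<Phi> = cinv c ` U" and co: "coord \<Phi> = \<phi> \<circ> coord c" by (simp_all add: \<Phi>_def)
  have sub: "cinv c ` U \<subseteq> chart_dom c" using U cinv_in_dom[OF cc] by blast
  have cU: "coord c (cinv c x) = x" if "x \<in> U" for x using that U coord_cinv[OF cc] by blast
  have h1: "homeomorphism (cinv c ` U) U (coord c) (cinv c)"
  proof (rule homeomorphism_of_subsets[of "chart_dom c" "coord c ` chart_dom c"])
    show "homeomorphism (chart_dom c) (coord c ` chart_dom c) (coord c) (cinv c)"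
      using cc by (simp add: is_chart_def)
    show "coord c ` cinv c ` U = U" by (simp add: image_image cU cong: image_cong)
  qed (fact sub U)+
  have h2: "homeomorphism (cinv c ` U) V (\<phi> \<circ> coord c) (cinv c \<circ> \<psi>)"
    by (rule homeomorphism_compose[OF h1 hom])
  then have img: "coord \<Phi> ` chart_dom \<Phi> = V" unfolding dom co by (rule homeomorphism_image1)
  have inv: "cinv \<Phi> x = cinv c (\<psi> x)" if "x \<in> V" for x
  proof -
    have inj: "inj_on (coord \<Phi>) (chart_dom \<Phi>)"
      unfolding dom co by (rule inj_on_inverseI[where g = "cinv c \<circ> \<psi>"]) (rule homeomorphism_apply1[OF h2])
    have mem: "(cinv c \<circ> \<psi>) x \<in> chart_dom \<Phi>"
      unfolding dom using homeomorphism_image2[OF h2] that by blast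
    have "coord \<Phi> ((cinv c \<circ> \<psi>) x) = x"
      unfolding co by (rule homeomorphism_apply2[OF h2 that])
    then show ?thesis unfolding cinv_def[of \<Phi>] using inv_into_f_f[OF inj mem] by simp
  qed
  have ch: "is_chart \<Phi>"
    unfolding is_chart_def img
  proof (intro conjI)
    show "open (chart_dom \<Phi>)" unfolding dom by (rule open_cinv_image[OF cc oU U])
    show "homeomorphism (chart_dom \<Phi>) V (coord \<Phi>) (cinv \<Phi>)"
      unfolding dom co by (rule homeomorphism_cong[OF h2]) (use inv in auto)
  qed (rule oV)
  have "smoothly_compatible \<Phi> d" if d: "d \<in> A" for d
  proof -
    have cd: "is_chart d" "smoothly_compatible c d" using A c d by auto
    let ?W = "chart_dom \<Phi> \<inter> chart_dom d"
    have W: "?W \<subseteq> chart_dom c" using sub dom by auto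
    have o1: "open (coord \<Phi> ` ?W)" by (rule open_overlap[OF ch cd(1)])
    have o2: "open (coord d ` ?W)" using open_overlap[OF cd(1) ch] by (simp add: Int_commute)
    have WV: "coord \<Phi> ` ?W \<subseteq> V" using img by blast
    have \<psi>W: "\<psi> (coord \<Phi> r) = coord c r" if "r \<in> ?W" for r
      using that hom cU unfolding dom co by (auto simp: homeomorphism_def)
    have s1: "smooth_on (coord \<Phi> ` ?W) (\<lambda>x. transition c d (\<psi> x))"
      using cd(2) \<psi>W W
      by (intro smooth_on_compose[OF o1 open_overlap[OF cc cd(1)] _ smooth_on_subset[OF s(2) WV]])
         (auto simp: smoothly_compatible_def)
    have "smooth_on (coord \<Phi> ` ?W) (transition \<Phi> d)"
      by (rule smooth_on_cong[OF o1 s1]) (use inv WV in \<open>auto simp: transition_def\<close>)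
    moreover have s2: "smooth_on (coord d ` ?W) (\<lambda>x. \<phi> (transition d c x))"
    proof (rule smooth_on_compose[OF o2 oU s(1)])
      have "smooth_on (coord d ` (chart_dom c \<inter> chart_dom d)) (transition d c)"
        using cd(2) by (auto simp: smoothly_compatible_def)
      then show "smooth_on (coord d ` ?W) (transition d c)"
        by (rule smooth_on_subset) (use W in auto)
      show "transition d c ` coord d ` ?W \<subseteq> U"
        using cU transition_coord[OF cd(1), of _ c] dom by auto
    qed
    have "smooth_on (coord d ` ?W) (transition d \<Phi>)"
      by (rule smooth_on_cong[OF o2 s2]) (auto simp: transition_def co)
    ultimately show ?thesis by (simp add: smoothly_compatible_def)
  qed
  then show ?thesis
    using ch sub c unfolding smooth_chart_def dom carrier_def by blast
qed

text \<open>Applying \<open>T\<close> to every row is multiplication from the right by the transpose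
  of its matrix.\<close>

lemma matrix_rows_mult3:
  assumes "linear T"
  shows "det (vector [T X, T Y, T Z] :: real ^ 3 ^ 3) = det (matrix T) * det (vector [X, Y, Z] :: real ^ 3 ^ 3)"
proof -
  have "vector [T X, T Y, T Z] = (vector [X, Y, Z] :: real ^ 3 ^ 3) ** transpose (matrix T)"
    by (simp add: vec_eq_iff forall_3 matrix_matrix_mult_def transpose_def matrix_vector_mult_def mult.commute
        flip: matrix_works[OF assms[folded linear_matrix_vector_mul_eq]])
  then show ?thesis by (simp add: det_mul)
qed

lemma matrix_rows_mult2:
  assumes "linear T"
  shows "det (vector [T X, T Y] :: real ^ 2 ^ 2) = det (matrix T) * det (vector [X, Y] :: real ^ 2 ^ 2)"
proof -
  have "vector [T X, T Y] = (vector [X, Y] :: real ^ 2 ^ 2) ** transpose (matrix T)"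
    by (simp add: vec_eq_iff forall_2 matrix_matrix_mult_def transpose_def matrix_vector_mult_def mult.commute
        flip: matrix_works[OF assms[folded linear_matrix_vector_mul_eq]])
  then show ?thesis by (simp add: det_mul)
qed

text \<open>The segment from the identity to \<open>G\<close> consists of matrices with positive
  quadratic form, hence invertible ones; the determinant starts at 1 and cannot change sign along
  it.\<close>

lemma det_positive_definite:
  fixes G :: "real ^ 'n ^ 'n"
  assumes "\<And>X. X \<noteq> 0 \<Longrightarrow> X \<bullet> (G *v X) > 0"
  shows "det G > 0"
proof -
  define H where "H t = (1 - t) *\<^sub>R mat 1 + t *\<^sub>R G" for t :: real
  have ne: "det (H t) \<noteq> 0" if "0 \<le> t" "t \<le> 1" for t
  proof -
    have "H t *v X \<noteq> 0" if X: "X \<noteq> 0" for X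
    proof -
      have "X \<bullet> (H t *v X) = (1 - t) * (X \<bullet> X) + t * (X \<bullet> (G *v X))"
        by (simp add: H_def matrix_vector_mult_add_rdistrib scaleR_matrix_vector_assoc[symmetric] inner_add_right)
      also have "\<dots> > 0"
        using assms[OF X] X \<open>0 \<le> t\<close> \<open>t \<le> 1\<close>
        by (cases "t = 0") (auto intro!: add_nonneg_pos mult_nonneg_nonneg)
      finally show ?thesis by auto
    qed
    then show ?thesis
      using matrix_left_invertible_ker invertible_det_nz invertible_left_inverse by metis
  qed
  have "continuous_on {0..1} (\<lambda>t. det (H t))"
    unfolding det_def H_def by (intro continuous_intros)
  moreover have "det (H 0) = 1" "H 1 = G" by (simp_all add: H_def)
  ultimately show ?thesis
    using ne IVT2'[of "\<lambda>t. det (H t)" 1 0 0] by (metis less_eq_real_def linorder_not_less order.refl zero_less_one)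
qed

section \<open>Fronts between manifolds\<close>

text \<open>A fixed pair of charts in which the computations near a point are done; other pairs are
  compared with it by the lemmas on change of charts.\<close>

locale front_chart =
  fixes A :: "('m::{t2_space,second_countable_topology}, 2) chart set"
    and B :: "('n::{t2_space,second_countable_topology}, 3) chart set"
    and g :: "'n metric_comp" and f :: "'m \<Rightarrow> 'n" and \<nu> :: "('m, 'n) field_along"
    and c :: "('m, 2) chart" and d :: "('n, 3) chart"
  assumes A: "oriented_manifold A" and B: "oriented_manifold B" and g: "riemannian_metric B g"
    and front: "front A B g f \<nu>" and cA: "c \<in> A" and dB: "d \<in> B"
begin

definition U :: "(real ^ 2) set" where "U = coord c ` (chart_dom c \<inter> f -` chart_dom d)"

definition rep :: "real ^ 2 \<Rightarrow> real ^ 3" where "rep = local_rep c d f"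

definition nrm :: "real ^ 2 \<Rightarrow> real ^ 3" where "nrm x = \<nu> d (cinv c x)"

definition gm :: "real ^ 2 \<Rightarrow> real ^ 3 ^ 3" where "gm x = g d (f (cinv c x))"

text \<open>The covector g(\<nu>, -), represented by a vector through the Euclidean inner
  product.\<close>

definition conormal :: "real ^ 2 \<Rightarrow> real ^ 3" where "conormal x = gm x *v nrm x"

lemma charts: "is_chart c" "is_chart d"
  using A B cA dB by (auto simp: oriented_manifold_def)

lemma continuous_f: "continuous_on (carrier A) f"
  using front by (simp add: front_def smooth_map_def)

lemma dom_carrier: "c' \<in> A \<Longrightarrow> chart_dom c' \<subseteq> carrier A"
  by (auto simp: carrier_def)

lemma open_dom: "open (chart_dom c \<inter> f -` chart_dom d)"
  using charts continuous_on_subset[OF continuous_f dom_carrier[OF cA]]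
  by (intro continuous_open_preimage) (auto simp: is_chart_def)

lemma open_U': "open U"
  unfolding U_def by (rule open_coord_image[OF charts(1) open_dom]) simp

lemma U_iff: "x \<in> U \<longleftrightarrow> x \<in> coord c ` chart_dom c \<and> f (cinv c x) \<in> chart_dom d"
  unfolding U_def using coord_image_iff[OF charts(1), of "chart_dom c \<inter> f -` chart_dom d" x] cinv_in_dom[OF charts(1)]
  by auto

lemma coord_in_U: "q \<in> chart_dom c \<Longrightarrow> f q \<in> chart_dom d \<Longrightarrow> coord c q \<in> U"
  by (auto simp: U_def)

lemma U_D: "x \<in> U \<Longrightarrow> cinv c x \<in> chart_dom c" "x \<in> U \<Longrightarrow> coord c (cinv c x) = x" "x \<in> U \<Longrightarrow> f (cinv c x) \<in> chart_dom d"
  using U_iff cinv_in_dom[OF charts(1)] coord_cinv[OF charts(1)] by blast+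

lemma smooth_rep: "smooth_on U rep"
  using front cA dB by (simp add: front_def smooth_map_def U_def rep_def)

lemma smooth_nrm: "smooth_on U nrm"
proof -
  have "smooth_on U (\<nu> d \<circ> cinv c)"
    using front cA dB by (simp add: front_def smooth_field_along_def U_def)
  then show ?thesis by (simp add: nrm_def[abs_def] o_def)
qed

lemma gm_rep: "x \<in> U \<Longrightarrow> g d (cinv d (rep x)) = gm x"
  using cinv_coord[OF charts(2) U_D(3)] by (simp add: rep_def local_rep_def gm_def)

lemma rep_in: "rep ` U \<subseteq> coord d ` chart_dom d"
  using U_D(3) by (auto simp: rep_def local_rep_def)

lemma smooth_g: "smooth_on (coord d ` chart_dom d) (\<lambda>y. g d (cinv d y))"
  using g dB by (simp add: riemannian_metric_def)

lemma open_target: "open (coord d ` chart_dom d)"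
  using charts(2) by (simp add: is_chart_def)

lemma smooth_gm: "smooth_on U gm"
  by (rule smooth_on_cong[OF open_U' smooth_on_compose[OF open_U' open_target smooth_g smooth_rep rep_in]])
     (rule gm_rep)

lemma gm_sym: "x \<in> U \<Longrightarrow> X \<bullet> (gm x *v Y) = Y \<bullet> (gm x *v X)"
  using g dB U_D(3)[of x] by (simp add: riemannian_metric_def metric_def gm_def)

lemma gm_pos: "x \<in> U \<Longrightarrow> X \<noteq> 0 \<Longrightarrow> X \<bullet> (gm x *v X) > 0"
  using g dB U_D(3)[of x] by (simp add: riemannian_metric_def metric_def gm_def)

lemma front_at:
  assumes "x \<in> U"
  shows "nrm x \<bullet> conormal x = 1" "frechet_derivative rep (at x) v \<bullet> conormal x = 0"
    "inj (frechet_derivative (\<lambda>x. (rep x, nrm x)) (at x))"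
proof -
  have "\<forall>q\<in>chart_dom c. f q \<in> chart_dom d \<longrightarrow>
        metric g d (f q) (\<nu> d q) (\<nu> d q) = 1 \<and>
        (\<forall>X. metric g d (f q) (frechet_derivative (local_rep c d f) (at (coord c q)) X) (\<nu> d q) = 0) \<and>
        inj (frechet_derivative (\<lambda>x. (local_rep c d f x, \<nu> d (cinv c x))) (at (coord c q)))"
    using front cA dB by (simp add: front_def)
  from bspec[OF this U_D(1)[OF assms]] U_D(2,3)[OF assms]
  show "nrm x \<bullet> conormal x = 1" "frechet_derivative rep (at x) v \<bullet> conormal x = 0"
    "inj (frechet_derivative (\<lambda>x. (rep x, nrm x)) (at x))"
    by (simp_all add: metric_def conormal_def nrm_def[abs_def] gm_def rep_def)
qed

end

sublocale front_chart \<subseteq> conormal_front U rep nrm conormal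
proof
  show "smooth_on U conormal"
    unfolding conormal_def by (intro smooth_on_matrix_vector open_U' smooth_gm smooth_nrm)
  show "conormal x \<bullet> nrm x = 1" if "x \<in> U" for x using front_at(1)[OF that] by (simp add: inner_commute)
qed (fact open_U' smooth_rep smooth_nrm front_at)+

context front_chart
begin

text \<open>The metric depends on \<open>x\<close> only through \<open>rep\<close>, so its
  derivative along a null vector vanishes, and the conormal changes by \<open>gm\<close> times the
  derivative of the normal; the latter is nonzero as (f, \<nu>) is an immersion. Differentiating
  conormal \<bullet> nrm = 1 gives two terms that are equal by symmetry of the metric, so each is
  0.\<close>

lemma conormal_immersion:
  assumes x: "x \<in> U" and X: "D x X = 0" "X \<noteq> 0"
  shows "frechet_derivative conormal (at x) X \<noteq> 0" "frechet_derivative conormal (at x) X \<bullet> nrm x = 0"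
proof -
  let ?n = "frechet_derivative nrm (at x)" and ?m = "frechet_derivative conormal (at x)"
  have nD: "(nrm has_derivative ?n) (at x)" by (rule smooth_on_has_derivative[OF open_U smooth_N x])
  have mD: "(conormal has_derivative ?m) (at x)" by (rule smooth_on_has_derivative[OF open_U smooth_M x])
  have "((\<lambda>x. (rep x, nrm x)) has_derivative (\<lambda>v. (D x v, ?n v))) (at x)"
    by (rule has_derivative_Pair[OF F_has_derivative[OF x] nD])
  from frechet_derivative_at[OF this] have "inj (\<lambda>v. (D x v, ?n v))" using front_at(3)[OF x] by simp
  moreover have "D x 0 = 0" "?n 0 = 0"
    using linear_0[OF linear_D[OF x]] linear_0[OF has_derivative_linear[OF nD]] by simp_all
  ultimately have n: "?n X \<noteq> 0" using X unfolding inj_def by (metis (no_types, lifting))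
  let ?y = "rep x"
  have gD: "((\<lambda>y. g d (cinv d y)) has_derivative frechet_derivative (\<lambda>y. g d (cinv d y)) (at ?y)) (at ?y)"
    by (rule smooth_on_has_derivative[OF open_target smooth_g]) (use rep_in x in blast)
  have "((\<lambda>x. g d (cinv d (rep x))) has_derivative (\<lambda>v. frechet_derivative (\<lambda>y. g d (cinv d y)) (at ?y) (D x v))) (at x)"
    by (rule has_derivative_compose[OF F_has_derivative[OF x] gD])
  then have gmD: "(gm has_derivative (\<lambda>v. frechet_derivative (\<lambda>y. g d (cinv d y)) (at ?y) (D x v))) (at x)"
    by (rule has_derivative_transform_within_open[OF _ open_U x]) (rule gm_rep)
  have bb: "bounded_bilinear (\<lambda>(G :: real ^ 3 ^ 3) (v :: real ^ 3). G *v v)"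
    by (rule bilinear_conv_bounded_bilinear[THEN iffD1])
       (auto simp: bilinear_def linear_iff matrix_vector_mult_add_rdistrib matrix_vector_right_distrib
        scaleR_matrix_vector_assoc matrix_vector_mult_scaleR)
  have "(conormal has_derivative (\<lambda>v. gm x *v ?n v + frechet_derivative (\<lambda>y. g d (cinv d y)) (at ?y) (D x v) *v nrm x)) (at x)"
    unfolding conormal_def[abs_def] by (rule bounded_bilinear.FDERIV[OF bb gmD nD])
  from fun_cong[OF has_derivative_unique[OF mD this], of X]
  have m: "?m X = gm x *v ?n X"
    using X(1) linear_0[OF has_derivative_linear[OF gD]] by simp
  show "?m X \<noteq> 0" using gm_pos[OF x n] by (auto simp: m)
  have "((\<lambda>y. conormal y \<bullet> nrm y) has_derivative (\<lambda>v. conormal x \<bullet> ?n v + ?m v \<bullet> nrm x)) (at x)"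
    by (rule has_derivative_inner[OF mD nD])
  then have "((\<lambda>y. 1) has_derivative (\<lambda>v. conormal x \<bullet> ?n v + ?m v \<bullet> nrm x)) (at x)"
    by (rule has_derivative_transform_within_open[OF _ open_U x]) (simp add: M_N)
  from fun_cong[OF has_derivative_unique[OF this has_derivative_const], of X]
  have "conormal x \<bullet> ?n X + ?m X \<bullet> nrm x = 0" .
  moreover have "conormal x \<bullet> ?n X = ?m X \<bullet> nrm x"
    using gm_sym[OF x, of "nrm x" "?n X"] by (simp add: m conormal_def inner_commute)
  ultimately show "?m X \<bullet> nrm x = 0" by simp
qed

definition rho :: "real ^ 2 \<Rightarrow> real" where "rho x = sqrt (det (gm x))"

lemma det_gm_pos: "x \<in> U \<Longrightarrow> det (gm x) > 0"
  using det_positive_definite gm_pos by blast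

lemma rho_pos: "x \<in> U \<Longrightarrow> rho x > 0"
  using det_gm_pos by (simp add: rho_def)

lemma smooth_det_gm: "smooth_on U (\<lambda>x. det (gm x))"
  by (intro smooth_on_det smooth_on_vec_nth open_U smooth_gm)

lemma rho_differentiable: "x \<in> U \<Longrightarrow> rho differentiable at x"
  unfolding rho_def
  using has_derivative_real_sqrt[OF det_gm_pos smooth_on_has_derivative[OF open_U smooth_det_gm]]
  by (auto simp: differentiable_def)

lemma area_density_eq: "x \<in> U \<Longrightarrow> area_density g f \<nu> c d x = rho x * area x"
  by (simp only: area_density_def volume_form_def Let_def area_def D_def rho_def gm_def nrm_def flip: rep_def)

text \<open>On the singular set the term with the derivative of \<open>rho\<close> drops
  out.\<close>

lemma area_density_derivative:
  assumes x: "x \<in> U" and 0: "area x = 0"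
  shows "(area_density g f \<nu> c d has_derivative (\<lambda>h. rho x * frechet_derivative area (at x) h)) (at x)"
proof -
  have "((\<lambda>x. rho x * area x) has_derivative (\<lambda>h. rho x * frechet_derivative area (at x) h + frechet_derivative rho (at x) h * area x)) (at x)"
    using rho_differentiable[OF x] area_has_derivative[OF x]
    by (intro has_derivative_mult) (simp_all add: frechet_derivative_works)
  then have "(area_density g f \<nu> c d has_derivative (\<lambda>h. rho x * frechet_derivative area (at x) h + frechet_derivative rho (at x) h * area x)) (at x)"
    by (rule has_derivative_transform_within_open[OF _ open_U x]) (simp add: area_density_eq)
  then show ?thesis by (simp add: 0)
qed

section \<open>Change of charts and the criterion for cuspidal edges\<close>

lemma change_facts:
  assumes c': "c' \<in> A" and d': "d' \<in> B"
  shows "is_chart c'" "is_chart d'" "smoothly_compatible c' c" "smoothly_compatible c c'"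
    "smoothly_compatible d d'" "smoothly_compatible d' d"
  using A B cA dB c' d' by (auto simp: oriented_manifold_def)

text \<open>The new charts are only required to be compatible with \<open>c\<close> and
  \<open>d\<close>. This covers the normal form charts of a cuspidal edge, which may lie outside the
  atlases.\<close>

lemma rep_change:
  assumes c': "is_chart c'" "smoothly_compatible c' c" and d': "is_chart d'" "smoothly_compatible d d'"
    and q: "q \<in> chart_dom c" "q \<in> chart_dom c'" "f q \<in> chart_dom d" "f q \<in> chart_dom d'"
  shows "(local_rep c' d' f has_derivative (\<lambda>v. transition_deriv d d' (f q) (D (coord c q) (transition_deriv c' c q v)))) (at (coord c' q))"
  using local_rep_change[OF charts(1) c'(1,2) charts(2) d'(1,2) continuous_on_subset[OF continuous_f dom_carrier[OF cA]] q]
    F_has_derivative[OF coord_in_U[OF q(1,3)]] by (simp add: rep_def)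

lemma rep_change_kernel:
  assumes c': "is_chart c'" "smoothly_compatible c' c" and d': "is_chart d'" "smoothly_compatible d d'"
    and q: "q \<in> chart_dom c" "q \<in> chart_dom c'" "f q \<in> chart_dom d" "f q \<in> chart_dom d'"
  shows "frechet_derivative (local_rep c' d' f) (at (coord c' q)) v = 0 \<longleftrightarrow> D (coord c q) (transition_deriv c' c q v) = 0"
  using frechet_derivative_at[OF rep_change[OF assms], symmetric]
    transition_deriv_eq_0_iff[OF charts(2) d'(1,2) q(3,4)] by simp

lemma rep_change_inj:
  assumes c': "is_chart c'" "smoothly_compatible c' c" and d': "is_chart d'" "smoothly_compatible d d'"
    and q: "q \<in> chart_dom c" "q \<in> chart_dom c'" "f q \<in> chart_dom d" "f q \<in> chart_dom d'"
  shows "inj (frechet_derivative (local_rep c' d' f) (at (coord c' q))) \<longleftrightarrow> area (coord c q) \<noteq> 0"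
proof -
  have l: "linear (frechet_derivative (local_rep c' d' f) (at (coord c' q)))"
    using rep_change[OF assms] frechet_derivative_at has_derivative_linear by metis
  have z: "transition_deriv c' c q v = 0 \<longleftrightarrow> v = 0" for v
    by (rule transition_deriv_eq_0_iff[OF c'(1) charts(1) c'(2) q(2,1)])
  have s: "\<exists>v. w = transition_deriv c' c q v" for w
    using transition_deriv_inverse[OF charts(1) c'(1) smoothly_compatible_sym[OF c'(2)] q(1,2)] by metis
  have "inj (frechet_derivative (local_rep c' d' f) (at (coord c' q))) \<longleftrightarrow> inj (D (coord c q))"
    unfolding linear_injective_0[OF l] linear_injective_0[OF linear_D[OF coord_in_U[OF q(1,3)]]] rep_change_kernel[OF assms]
    using z s by metis
  then show ?thesis using inj_D_iff[OF coord_in_U[OF q(1,3)]] by simp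
qed

text \<open>The definition asks for some pair of charts; \<open>rep_change_inj\<close> makes the
  condition independent of the pair.\<close>

lemma singular_set_iff:
  assumes q: "q \<in> chart_dom c" "f q \<in> chart_dom d"
  shows "q \<in> singular_set A B f \<longleftrightarrow> area (coord c q) = 0"
proof
  assume "q \<in> singular_set A B f"
  then obtain c' d' where *: "c' \<in> A" "d' \<in> B" "q \<in> chart_dom c'" "f q \<in> chart_dom d'"
    "\<not> inj (frechet_derivative (local_rep c' d' f) (at (coord c' q)))"
    unfolding singular_set_def by blast
  note cf = change_facts[OF *(1,2)]
  show "area (coord c q) = 0" using rep_change_inj[OF cf(1,3,2,5) q(1) *(3) q(2) *(4)] *(5) by blast
next
  assume "area (coord c q) = 0"
  then have "\<not> inj (frechet_derivative (local_rep c d f) (at (coord c q)))"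
    using inj_D_iff[OF coord_in_U[OF q]] by (simp add: D_def flip: rep_def)
  then show "q \<in> singular_set A B f" unfolding singular_set_def using cA dB q by blast
qed

text \<open>The criterion that the null direction be transversal to the singular curve. It carries
  the coordinate normal form over to charts of the two manifolds, and is used at the peak in
  contrapositive form.\<close>

lemma cuspidal_edgeI:
  assumes q: "q \<in> chart_dom c" "f q \<in> chart_dom d" and 0: "area (coord c q) = 0"
    and \<eta>: "D (coord c q) \<eta> = 0" "frechet_derivative area (at (coord c q)) \<eta> \<noteq> 0"
  shows "cuspidal_edge A B f q"
proof -
  let ?x = "coord c q"
  have x: "?x \<in> U" by (rule coord_in_U[OF q])
  have "linear (frechet_derivative area (at ?x))" using area_has_derivative[OF x] has_derivative_linear by blast
  then have "\<eta> \<noteq> 0" using \<eta>(2) linear_0 by blast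
  note im = conormal_immersion[OF x \<eta>(1) this]
  have r: "rep ?x \<in> coord d ` chart_dom d" using rep_in x by blast
  have ch: "\<forall>c\<in>A. is_chart c" "\<forall>c\<in>A. \<forall>d\<in>A. smoothly_compatible c d" "\<forall>c\<in>B. is_chart c" "\<forall>c\<in>B. \<forall>d\<in>B. smoothly_compatible c d"
    using A B by (auto simp: oriented_manifold_def)
  obtain U1 U2 \<phi> \<phi>' V1 V2 \<psi> \<psi>' where nf: "diffeo U1 U2 \<phi> \<phi>'" "?x \<in> U1" "U1 \<subseteq> U" "\<phi> ?x = 0"
    "diffeo V1 V2 \<psi> \<psi>'" "rep ` U1 \<subseteq> V1" "V1 \<subseteq> coord d ` chart_dom d" "\<psi> (rep ?x) = 0"
    "\<And>x. x \<in> U1 \<Longrightarrow> \<psi> (rep x) = cusp (\<phi> x)"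
    by (rule cuspidal_normal_form[OF x 0 \<eta> im open_target r]) (rule that)
  define \<Phi> where "\<Phi> = (cinv c ` U1, \<phi> \<circ> coord c)"
  define \<Psi> where "\<Psi> = (cinv d ` V1, \<psi> \<circ> coord d)"
  have U1: "U1 \<subseteq> coord c ` chart_dom c" using nf(3) U_iff by blast
  have s: "smooth_chart A \<Phi>" "smooth_chart B \<Psi>"
    unfolding \<Phi>_def \<Psi>_def
    by (rule smooth_chart_diffeo[OF ch(1,2) cA nf(1) U1], rule smooth_chart_diffeo[OF ch(3,4) dB nf(5,7)])
  have mem: "q \<in> chart_dom \<Phi>" using nf(2) cinv_coord[OF charts(1) q(1)] by (force simp: \<Phi>_def)
  have fm: "f (cinv c x) = cinv d (rep x) \<and> coord d (f (cinv c x)) = rep x" if "x \<in> U1" for x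
    using that nf(3) U_D(3)[of x] cinv_coord[OF charts(2)] by (auto simp: rep_def local_rep_def)
  then have fm2: "coord d (f (cinv c x)) = rep x" if "x \<in> U1" for x using that by blast
  have cx: "coord c (cinv c x) = x" if "x \<in> U1" for x using that nf(3) U_D(2) by blast
  have qx: "cinv c ?x = q" by (rule cinv_coord[OF charts(1) q(1)])
  have "f q = cinv d (rep ?x)" using fm[OF nf(2)] qx by simp
  then have fq: "f q \<in> chart_dom \<Psi>" using nf(2,6) by (auto simp: \<Psi>_def)
  have "coord d (f q) = rep ?x" using fm[OF nf(2)] unfolding qx by blast
  then have "coord \<Psi> (f q) = 0" by (simp add: \<Psi>_def nf(8))
  moreover have "f ` chart_dom \<Phi> \<subseteq> chart_dom \<Psi>" using fm nf(6) by (auto simp: \<Phi>_def \<Psi>_def)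
  moreover have "\<forall>x\<in>chart_dom \<Phi>. coord \<Psi> (f x) = vector [(coord \<Phi> x $ 1)^2, (coord \<Phi> x $ 1)^3, coord \<Phi> x $ 2]"
    using fm2 cx nf(9) by (auto simp: \<Phi>_def \<Psi>_def cusp_def)
  moreover have "coord \<Phi> q = 0" using nf(4) by (simp add: \<Phi>_def)
  ultimately show ?thesis unfolding cuspidal_edge_def using s mem fq by blast
qed

end

section \<open>The singular curvature at a cuspidal edge and its independence of choices\<close>

lemma cusp_has_derivative:
  "(cusp has_derivative (\<lambda>h. vector [2 * z $ 1 * h $ 1, 3 * (z $ 1)\<^sup>2 * h $ 1, h $ 2])) (at z)"
proof -
  have n: "((\<lambda>z :: real ^ 2. z $ k) has_derivative (\<lambda>h. h $ k)) (at z)" for k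
    by (rule bounded_linear_imp_has_derivative[OF bounded_linear_vec_nth])
  have e: "cusp = (\<lambda>z. (z $ 1)\<^sup>2 *\<^sub>R axis 1 1 + (z $ 1) ^ 3 *\<^sub>R axis 2 1 + z $ 2 *\<^sub>R axis 3 1)"
    by (simp add: cusp_def fun_eq_iff vec_eq_iff forall_3 axis_def)
  show ?thesis
    unfolding e
    by (rule has_derivative_eq_rhs[OF has_derivative_add[OF has_derivative_add[OF
            has_derivative_scaleR_left[OF has_derivative_power[OF n]]
            has_derivative_scaleR_left[OF has_derivative_power[OF n]]] has_derivative_scaleR_left[OF n]]])
       (simp add: fun_eq_iff vec_eq_iff forall_3 axis_def algebra_simps)
qed

lemma cusp_derivative_eq_0_iff: "frechet_derivative cusp (at z) h = 0 \<longleftrightarrow> z $ 1 * h $ 1 = 0 \<and> h $ 2 = 0"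
  using frechet_derivative_at[OF cusp_has_derivative, of z, symmetric]
  by (auto simp: vec_eq_iff forall_3)

lemma vector_derivative_cong_open:
  assumes "open I" "t \<in> I" "\<And>s. s \<in> I \<Longrightarrow> h s = k s"
  shows "vector_derivative h (at t) = vector_derivative k (at t)"
proof -
  have "(h has_vector_derivative y) (at t) \<longleftrightarrow> (k has_vector_derivative y) (at t)" for y
    using has_vector_derivative_transform_within_open[OF _ assms(1,2), of h y k]
      has_vector_derivative_transform_within_open[OF _ assms(1,2), of k y h] assms(3) by metis
  then show ?thesis by (simp add: vector_derivative_def)
qed

text \<open>To be applied to a transition map: the last term is the inhomogeneous term that the
  components of a connection acquire under a change of charts.\<close>

lemma second_derivative_along_curve:
  fixes \<tau> :: "'a::euclidean_space \<Rightarrow> 'b::real_normed_vector" and y z :: "real \<Rightarrow> 'a"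
  assumes S: "open S" "smooth_on S \<tau>" and I: "open I" "t \<in> I" "\<And>s. s \<in> I \<Longrightarrow> y s \<in> S"
    and y: "(y has_vector_derivative z t) (at t)" and z: "(z has_vector_derivative a) (at t)"
  shows "((\<lambda>s. frechet_derivative \<tau> (at (y s)) (z s)) has_vector_derivative
    frechet_derivative \<tau> (at (y t)) a + frechet_derivative (\<lambda>x. frechet_derivative \<tau> (at x) (z t)) (at (y t)) (z t)) (at t)"
proof -
  let ?T = "\<lambda>x. frechet_derivative \<tau> (at x)"
  have lin: "linear (?T x)" if "x \<in> S" for x
    using smooth_on_has_derivative[OF S that] has_derivative_linear by blast
  have expand: "?T x v = (\<Sum>b\<in>Basis. (v \<bullet> b) *\<^sub>R ?T x b)" if "x \<in> S" for x v
    by (subst euclidean_representation[of v, symmetric]) (simp only: linear_sum[OF lin[OF that]] linear_cmul[OF lin[OF that]])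
  have TD: "((\<lambda>x. ?T x v) has_derivative frechet_derivative (\<lambda>x. ?T x v) (at (y t))) (at (y t))" for v
    by (rule smooth_on_has_derivative[OF S(1) smooth_on_frechet[OF S(2)] I(3)[OF I(2)]])
  have chain: "((\<lambda>s. ?T (y s) v) has_vector_derivative frechet_derivative (\<lambda>x. ?T x v) (at (y t)) (z t)) (at t)" for v
    using vector_derivative_diff_chain_within[OF y has_derivative_at_withinI[OF TD]] by (simp add: o_def)
  have inner: "((\<lambda>s. z s \<bullet> b) has_real_derivative a \<bullet> b) (at t)" for b
    unfolding has_real_derivative_iff_has_vector_derivative
    by (rule bounded_linear.has_vector_derivative[OF bounded_linear_inner_left z])
  have "((\<lambda>s. \<Sum>b\<in>Basis. (z s \<bullet> b) *\<^sub>R ?T (y s) b) has_vector_derivative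
      (\<Sum>b\<in>Basis. (z t \<bullet> b) *\<^sub>R frechet_derivative (\<lambda>x. ?T x b) (at (y t)) (z t) + (a \<bullet> b) *\<^sub>R ?T (y t) b)) (at t)"
    by (intro has_vector_derivative_sum has_vector_derivative_scaleR inner chain)
  then have 1: "((\<lambda>s. ?T (y s) (z s)) has_vector_derivative
      (\<Sum>b\<in>Basis. (z t \<bullet> b) *\<^sub>R frechet_derivative (\<lambda>x. ?T x b) (at (y t)) (z t) + (a \<bullet> b) *\<^sub>R ?T (y t) b)) (at t)"
    by (rule has_vector_derivative_transform_within_open[OF _ I(1,2)]) (simp add: expand[OF I(3), symmetric])
  have "((\<lambda>x. \<Sum>b\<in>Basis. (z t \<bullet> b) *\<^sub>R ?T x b) has_derivative
      (\<lambda>h. \<Sum>b\<in>Basis. (z t \<bullet> b) *\<^sub>R frechet_derivative (\<lambda>x. ?T x b) (at (y t)) h)) (at (y t))"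
    by (intro has_derivative_sum bounded_linear.has_derivative[OF bounded_linear_scaleR_right] TD)
  then have "((\<lambda>x. ?T x (z t)) has_derivative
      (\<lambda>h. \<Sum>b\<in>Basis. (z t \<bullet> b) *\<^sub>R frechet_derivative (\<lambda>x. ?T x b) (at (y t)) h)) (at (y t))"
    by (rule has_derivative_transform_within_open[OF _ S(1) I(3)[OF I(2)]]) (simp add: expand[symmetric])
  from fun_cong[OF has_derivative_unique[OF TD this], of "z t"]
  have 2: "frechet_derivative (\<lambda>x. ?T x (z t)) (at (y t)) (z t) =
      (\<Sum>b\<in>Basis. (z t \<bullet> b) *\<^sub>R frechet_derivative (\<lambda>x. ?T x b) (at (y t)) (z t))" .
  show ?thesis
    by (rule has_vector_derivative_eq_rhs[OF 1]) (simp only: sum.distrib 2 expand[OF I(3)[OF I(2)], of a] add.commute)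
qed

context front_chart
begin

text \<open>The existence half for the definite description of the singular curvature. In the normal
  form the singular set is the line on which the first coordinate vanishes and the first axis is
  null; both are carried to the chart \<open>c\<close> by the transition map.\<close>

lemma cuspidal_edge_structure:
  assumes cusp: "cuspidal_edge A B f q" and q: "q \<in> chart_dom c" "f q \<in> chart_dom d"
  obtains \<epsilon> \<gamma> \<eta> where "singular_curve A B f c d q \<epsilon> \<gamma>" "null_field f c d \<epsilon> \<gamma> \<eta>"
proof -
  obtain \<Phi> \<Psi> where \<Phi>: "smooth_chart A \<Phi>" and \<Psi>: "smooth_chart B \<Psi>"
    and q\<Phi>: "q \<in> chart_dom \<Phi>" "coord \<Phi> q = 0" and f\<Psi>: "f ` chart_dom \<Phi> \<subseteq> chart_dom \<Psi>"
    and normal: "\<And>x. x \<in> chart_dom \<Phi> \<Longrightarrow> coord \<Psi> (f x) = cusp (coord \<Phi> x)"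
    using cusp unfolding cuspidal_edge_def cusp_def by blast
  have ch: "is_chart \<Phi>" "is_chart \<Psi>" and co\<Phi>: "smoothly_compatible \<Phi> c" and co\<Psi>: "smoothly_compatible \<Psi> d"
    using \<Phi> \<Psi> cA dB unfolding smooth_chart_def by blast+
  note co = co\<Phi> smoothly_compatible_sym[OF co\<Psi>]
  define W0 where "W0 = chart_dom \<Phi> \<inter> (chart_dom c \<inter> f -` chart_dom d)"
  have oW0: "open W0" unfolding W0_def using ch open_dom by (auto simp: is_chart_def)
  have oO: "open (coord \<Phi> ` W0)" by (rule open_coord_image[OF ch(1) oW0]) (simp add: W0_def)
  have "0 \<in> coord \<Phi> ` W0" using q q\<Phi> by (force simp: W0_def)
  then obtain \<epsilon> where \<epsilon>: "\<epsilon> > 0" "ball 0 \<epsilon> \<subseteq> coord \<Phi> ` W0" using oO open_contains_ball by blast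
  have pt: "cinv \<Phi> z \<in> chart_dom \<Phi> \<and> cinv \<Phi> z \<in> chart_dom c \<and> f (cinv \<Phi> z) \<in> chart_dom d \<and>
      f (cinv \<Phi> z) \<in> chart_dom \<Psi> \<and> coord \<Phi> (cinv \<Phi> z) = z" if z: "z \<in> ball 0 \<epsilon>" for z
  proof -
    obtain r where "r \<in> W0" "z = coord \<Phi> r" using z \<epsilon>(2) by blast
    then show ?thesis using f\<Psi> by (auto simp: W0_def cinv_coord[OF ch(1)])
  qed
  have frech: "frechet_derivative (local_rep \<Phi> \<Psi> f) (at z) = frechet_derivative cusp (at z)" if z: "z \<in> ball 0 \<epsilon>" for z
  proof (rule frechet_derivative_transform_within_open[symmetric])
    show "cusp differentiable at z" using cusp_has_derivative differentiable_def by blast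
    show "open (ball (0 :: real ^ 2) \<epsilon>)" "z \<in> ball 0 \<epsilon>" using z by auto
    show "cusp x = local_rep \<Phi> \<Psi> f x" if "x \<in> ball 0 \<epsilon>" for x
      using normal pt[OF that] by (simp add: local_rep_def)
  qed
  have kernel: "D (coord c (cinv \<Phi> z)) (transition_deriv \<Phi> c (cinv \<Phi> z) v) = 0 \<longleftrightarrow> z $ 1 * v $ 1 = 0 \<and> v $ 2 = 0"
    if z: "z \<in> ball 0 \<epsilon>" for z v
    using rep_change_kernel[OF ch(1) co(1) ch(2) co(2), of "cinv \<Phi> z" v] pt[OF z] frech[OF z] cusp_derivative_eq_0_iff[of z v] by simp
  have sing: "cinv \<Phi> z \<in> singular_set A B f \<longleftrightarrow> z $ 1 = 0" if z: "z \<in> ball 0 \<epsilon>" for z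
  proof -
    have l: "linear (frechet_derivative cusp (at z))"
      using has_derivative_linear[OF cusp_has_derivative, of z]
      unfolding frechet_derivative_at[OF cusp_has_derivative, of z] .
    have "cinv \<Phi> z \<in> singular_set A B f \<longleftrightarrow> \<not> inj (frechet_derivative cusp (at z))"
      using rep_change_inj[OF ch(1) co(1) ch(2) co(2), of "cinv \<Phi> z"] pt[OF z] frech[OF z] singular_set_iff[of "cinv \<Phi> z"] by simp
    also have "\<dots> \<longleftrightarrow> z $ 1 = 0"
      unfolding linear_injective_0[OF l] cusp_derivative_eq_0_iff
      by (auto simp: vec_eq_iff forall_2 intro!: exI[of _ "axis 1 1"]) (auto simp: axis_def)
    finally show ?thesis .
  qed
  define line where "line t = (vector [0, t] :: real ^ 2)" for t
  have line_ball: "line t \<in> ball 0 \<epsilon> \<longleftrightarrow> t \<in> {-\<epsilon><..<\<epsilon>}" for t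
    by (auto simp: line_def norm_vec_def L2_set_def sum_2)
  have s_line: "smooth_on {-\<epsilon><..<\<epsilon>} line"
    unfolding line_def by (intro smooth_on_vector2 smooth_on_const smooth_on_ident) auto
  define \<gamma> where "\<gamma> t = cinv \<Phi> (line t)" for t
  let ?J = "\<lambda>t. frechet_derivative (transition \<Phi> c) (at (line t))"
  have sT: "smooth_on (coord \<Phi> ` (chart_dom \<Phi> \<inter> chart_dom c)) (transition \<Phi> c)"
    using co(1) by (simp add: smoothly_compatible_def)
  have line_in: "line ` {-\<epsilon><..<\<epsilon>} \<subseteq> coord \<Phi> ` (chart_dom \<Phi> \<inter> chart_dom c)"
  proof -
    have "coord \<Phi> ` W0 \<subseteq> coord \<Phi> ` (chart_dom \<Phi> \<inter> chart_dom c)" by (auto simp: W0_def)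
    then show ?thesis using line_ball \<epsilon>(2) by blast
  qed
  have p\<gamma>: "\<gamma> t \<in> chart_dom \<Phi>" "\<gamma> t \<in> chart_dom c" "f (\<gamma> t) \<in> chart_dom d" "coord \<Phi> (\<gamma> t) = line t"
    "line t \<in> ball 0 \<epsilon>" if "t \<in> {-\<epsilon><..<\<epsilon>}" for t
    using that line_ball pt by (auto simp: \<gamma>_def)
  have J: "(transition \<Phi> c has_derivative ?J t) (at (line t))" if t: "t \<in> {-\<epsilon><..<\<epsilon>}" for t
    using transition_has_derivative[OF ch(1) charts(1) co(1) p\<gamma>(1,2)[OF t]] p\<gamma>(4)[OF t] by simp
  have J0: "?J t v = 0 \<longleftrightarrow> v = 0" if t: "t \<in> {-\<epsilon><..<\<epsilon>}" for t v
    using transition_deriv_eq_0_iff[OF ch(1) charts(1) co(1) p\<gamma>(1,2)[OF t]] p\<gamma>(4)[OF t] by simp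
  have c\<gamma>: "coord c \<circ> \<gamma> = (\<lambda>t. transition \<Phi> c (line t))" by (simp add: fun_eq_iff \<gamma>_def transition_def)
  have vd: "vector_derivative (coord c \<circ> \<gamma>) (at t) = ?J t (axis 2 1)" if t: "t \<in> {-\<epsilon><..<\<epsilon>}" for t
    unfolding c\<gamma> using vector_derivative_at[OF partial_derivatives_vector2(2)[OF J[OF t, unfolded line_def]]]
    by (simp add: line_def)
  have sJ: "smooth_on {-\<epsilon><..<\<epsilon>} (\<lambda>t. ?J t v)" for v
    by (rule smooth_on_compose[OF _ open_overlap[OF ch(1) charts(1)] smooth_on_frechet[OF sT] s_line line_in]) simp
  \<comment> \<open>The transition from \<open>\<Phi>\<close> may reverse the orientation.
    Multiplying the null vector by this determinant makes its determinant with the velocity a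
    square.\<close>
  define s where "s t = det (vector [?J t (axis 2 1), ?J t (axis 1 1)] :: real ^ 2 ^ 2)" for t
  define \<eta> where "\<eta> t = s t *\<^sub>R ?J t (axis 1 1)" for t
  have s0: "s t \<noteq> 0" if t: "t \<in> {-\<epsilon><..<\<epsilon>}" for t
  proof -
    have l: "linear (?J t)" using J[OF t] has_derivative_linear by blast
    have "inj (?J t)" unfolding linear_injective_0[OF l] using J0[OF t] by blast
    from inj_det2_neq_0[OF l this] show ?thesis by (simp add: s_def det_2 mult.commute)
  qed
  have "singular_curve A B f c d q \<epsilon> \<gamma>"
    unfolding singular_curve_def
  proof (intro conjI ballI exI)
    show "\<epsilon> > 0" by (rule \<epsilon>)
    show "\<gamma> 0 = q" using q\<Phi> cinv_coord[OF ch(1) q\<Phi>(1)] by (simp add: \<gamma>_def line_def vector2_axis)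
    show "inj_on \<gamma> {-\<epsilon><..<\<epsilon>}"
    proof (rule inj_onI)
      fix a b assume "a \<in> {-\<epsilon><..<\<epsilon>}" "b \<in> {-\<epsilon><..<\<epsilon>}" "\<gamma> a = \<gamma> b"
      then have "line a = line b" using p\<gamma>(4) by metis
      then show "a = b" by (simp add: line_def vec_eq_iff forall_2)
    qed
    show "\<gamma> ` {-\<epsilon><..<\<epsilon>} \<subseteq> chart_dom c" "f ` \<gamma> ` {-\<epsilon><..<\<epsilon>} \<subseteq> chart_dom d" using p\<gamma> by auto
    show "smooth_on {-\<epsilon><..<\<epsilon>} (coord c \<circ> \<gamma>)"
      unfolding c\<gamma> by (rule smooth_on_compose[OF _ open_overlap[OF ch(1) charts(1)] sT s_line line_in]) simp
    show "vector_derivative (coord c \<circ> \<gamma>) (at t) \<noteq> 0" if "t \<in> {-\<epsilon><..<\<epsilon>}" for t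
      using J0[OF that] vd[OF that] by (simp add: axis_eq_0_iff)
    show "open (cinv \<Phi> ` ball 0 \<epsilon>)"
      by (rule open_cinv_image[OF ch(1)]) (use \<epsilon>(2) in \<open>auto simp: W0_def\<close>)
    show "q \<in> cinv \<Phi> ` ball 0 \<epsilon>" using \<epsilon>(1) cinv_coord[OF ch(1) q\<Phi>(1)] q\<Phi>(2) by (force intro!: image_eqI[of _ _ 0])
    show "cinv \<Phi> ` ball 0 \<epsilon> \<inter> singular_set A B f = \<gamma> ` {-\<epsilon><..<\<epsilon>}"
    proof (intro equalityI subsetI)
      fix r assume "r \<in> cinv \<Phi> ` ball 0 \<epsilon> \<inter> singular_set A B f"
      then obtain z where z: "z \<in> ball 0 \<epsilon>" "r = cinv \<Phi> z" "z $ 1 = 0" using sing by auto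
      then have "z = line (z $ 2)" by (simp add: line_def vec_eq_iff forall_2)
      then show "r \<in> \<gamma> ` {-\<epsilon><..<\<epsilon>}" using z line_ball[of "z $ 2"] by (auto simp: \<gamma>_def intro!: image_eqI[of _ _ "z $ 2"])
    next
      fix r assume "r \<in> \<gamma> ` {-\<epsilon><..<\<epsilon>}"
      then obtain t where t: "t \<in> {-\<epsilon><..<\<epsilon>}" "r = cinv \<Phi> (line t)" by (auto simp: \<gamma>_def)
      then show "r \<in> cinv \<Phi> ` ball 0 \<epsilon> \<inter> singular_set A B f"
        using sing[of "line t"] line_ball[of t] by (auto simp: line_def)
    qed
  qed
  moreover have "null_field f c d \<epsilon> \<gamma> \<eta>"
    unfolding null_field_def
  proof (intro conjI ballI)
    show "smooth_on {-\<epsilon><..<\<epsilon>} \<eta>"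
      unfolding \<eta>_def s_def by (intro smooth_on_scaleR smooth_on_det2 sJ) auto
    fix t assume t: "t \<in> {-\<epsilon><..<\<epsilon>}"
    have "D (coord c (\<gamma> t)) (?J t (axis 1 1)) = 0"
      using kernel[OF p\<gamma>(5)[OF t], of "axis 1 1"] p\<gamma>(4)[OF t] by (simp add: \<gamma>_def line_def axis_def)
    then show "frechet_derivative (local_rep c d f) (at (coord c (\<gamma> t))) (\<eta> t) = 0"
      using linear_cmul[OF linear_D[OF coord_in_U[OF p\<gamma>(2,3)[OF t]]]] by (simp add: \<eta>_def D_def flip: rep_def)
    have "det (vector [vector_derivative (coord c \<circ> \<gamma>) (at t), \<eta> t] :: real ^ 2 ^ 2) = s t * s t"
      by (simp add: vd[OF t] \<eta>_def s_def det_2 algebra_simps)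
    then show "det (vector [vector_derivative (coord c \<circ> \<gamma>) (at t), \<eta> t] :: real ^ 2 ^ 2) > 0"
      using s0[OF t] by (auto simp: zero_less_mult_iff)
  qed
  ultimately show ?thesis using that by blast
qed

text \<open>Invariance of the metric gives det (g d) = (det T)^2 det (g d'). The square root of the
  first factor is det T, without absolute value, because the atlas is oriented.\<close>

lemma volume_change:
  assumes d': "d' \<in> B" and y: "y \<in> chart_dom d" "y \<in> chart_dom d'"
  shows "volume_form g d' y (transition_deriv d d' y X) (transition_deriv d d' y Y) (transition_deriv d d' y Z) = volume_form g d y X Y Z"
    "metric g d' y (transition_deriv d d' y X) (transition_deriv d d' y Y) = metric g d y X Y"
proof -
  let ?T = "transition_deriv d d' y"
  have ch: "is_chart d'" "smoothly_compatible d d'" and pos: "det (matrix ?T) > 0"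
    using B dB d' y by (auto simp: oriented_manifold_def)
  have l: "linear ?T" by (rule transition_deriv_linear[OF charts(2) ch y])
  have m: "metric g d' y (?T X) (?T Y) = metric g d y X Y" for X Y
    using g dB d' y unfolding riemannian_metric_def Let_def by blast
  show "metric g d' y (?T X) (?T Y) = metric g d y X Y" by (rule m)
  have T: "?T v = matrix ?T *v v" for v by (rule matrix_works[OF l[folded linear_matrix_vector_mul_eq], symmetric])
  have ip: "X \<bullet> (g d y *v Y) = X \<bullet> ((transpose (matrix ?T) ** g d' y ** matrix ?T) *v Y)" for X Y
  proof -
    have "X \<bullet> (g d y *v Y) = (matrix ?T *v X) \<bullet> (g d' y *v (matrix ?T *v Y))"
      using m[of X Y] by (simp add: metric_def flip: T)
    also have "\<dots> = X \<bullet> (transpose (matrix ?T) *v (g d' y *v (matrix ?T *v Y)))"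
      by (simp only: dot_lmul_matrix[symmetric] vector_transpose_matrix)
    finally show ?thesis by (simp add: matrix_vector_mul_assoc matrix_mul_assoc)
  qed
  have mv: "g d y *v Y = (transpose (matrix ?T) ** g d' y ** matrix ?T) *v Y" for Y
    by (rule vector_eq_ldot[THEN iffD1], rule allI, rule ip)
  have "g d y = transpose (matrix ?T) ** g d' y ** matrix ?T" unfolding matrix_eq by (intro allI mv)
  then have "det (g d y) = (det (matrix ?T))\<^sup>2 * det (g d' y)" by (simp add: det_mul power2_eq_square)
  then have "sqrt (det (g d y)) = det (matrix ?T) * sqrt (det (g d' y))"
    using pos by (simp add: real_sqrt_mult)
  then show "volume_form g d' y (?T X) (?T Y) (?T Z) = volume_form g d y X Y Z"
    unfolding volume_form_def matrix_rows_mult3[OF l] by simp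
qed

lemma nrm_change:
  "d' \<in> B \<Longrightarrow> q \<in> chart_dom c \<Longrightarrow> f q \<in> chart_dom d \<Longrightarrow> f q \<in> chart_dom d' \<Longrightarrow> \<nu> d' q = transition_deriv d d' (f q) (\<nu> d q)"
  using front dB dom_carrier[OF cA] unfolding front_def smooth_field_along_def by blast

lemma area_density_change:
  assumes c': "c' \<in> A" and d': "d' \<in> B"
    and q: "q \<in> chart_dom c" "q \<in> chart_dom c'" "f q \<in> chart_dom d" "f q \<in> chart_dom d'"
  shows "area_density g f \<nu> c' d' (coord c' q) = det (matrix (transition_deriv c' c q)) * area_density g f \<nu> c d (coord c q)"
proof -
  note cf = change_facts[OF c' d']
  let ?T = "transition_deriv d d' (f q)" and ?J = "transition_deriv c' c q" and ?D = "D (coord c q)"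
  have lJ: "linear ?J" by (rule transition_deriv_linear[OF cf(1) charts(1) cf(3) q(2,1)])
  have lD: "linear ?D" by (rule linear_D[OF coord_in_U[OF q(1,3)]])
  have "frechet_derivative (local_rep c' d' f) (at (coord c' q)) = (\<lambda>v. ?T (?D (?J v)))"
    by (rule frechet_derivative_at[OF rep_change[OF cf(1,3,2,5) q], symmetric])
  then have "area_density g f \<nu> c' d' (coord c' q) =
      volume_form g d' (f q) (?T (?D (?J (axis 1 1)))) (?T (?D (?J (axis 2 1)))) (?T (\<nu> d q))"
    unfolding area_density_def Let_def cinv_coord[OF cf(1) q(2)] nrm_change[OF d' q(1,3,4)] by simp
  also have "\<dots> = volume_form g d (f q) (?D (?J (axis 1 1))) (?D (?J (axis 2 1))) (\<nu> d q)"
    by (rule volume_change(1)[OF d' q(3,4)])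
  also have "\<dots> = sqrt (det (g d (f q))) * (cross3 (?D (?J (axis 1 1))) (?D (?J (axis 2 1))) \<bullet> \<nu> d q)"
    by (simp add: volume_form_def cross3_inner_det)
  also have "cross3 (?D (?J (axis 1 1))) (?D (?J (axis 2 1))) =
      det (vector [?J (axis 1 1), ?J (axis 2 1)] :: real ^ 2 ^ 2) *\<^sub>R cross3 (?D (axis 1 1)) (?D (axis 2 1))"
    unfolding linear_vec2[OF lD, of "?J _"] by (rule cross3_det2)
  also have "det (vector [?J (axis 1 1), ?J (axis 2 1)] :: real ^ 2 ^ 2) = det (matrix ?J)"
    unfolding matrix_rows_mult2[OF lJ] by (simp add: det_2 axis_def)
  also have "sqrt (det (g d (f q))) * (det (matrix ?J) *\<^sub>R cross3 (?D (axis 1 1)) (?D (axis 2 1)) \<bullet> \<nu> d q) =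
      det (matrix ?J) * area_density g f \<nu> c d (coord c q)"
    unfolding area_density_def Let_def cinv_coord[OF charts(1) q(1)] volume_form_def cross3_inner_det[symmetric] rep_def[symmetric] D_def
    by simp
  finally show ?thesis .
qed

text \<open>The density is multiplied by a positive function whose derivative does not contribute
  where the density vanishes; its own derivative is thus scaled by a positive factor and keeps its
  sign.\<close>

lemma area_density_derivative_change:
  assumes c': "c' \<in> A" and d': "d' \<in> B"
    and q: "q \<in> chart_dom c" "q \<in> chart_dom c'" "f q \<in> chart_dom d" "f q \<in> chart_dom d'"
    and 0: "area (coord c q) = 0"
  shows "sgn (frechet_derivative (area_density g f \<nu> c' d') (at (coord c' q)) v) =
    sgn (frechet_derivative area (at (coord c q)) (transition_deriv c' c q v))"
proof -
  note cf = change_facts[OF c' d']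
  let ?J = "transition c' c" and ?x = "coord c q" and ?O = "coord c' ` (chart_dom c' \<inter> chart_dom c)"
  let ?\<delta> = "\<lambda>x. det (matrix (frechet_derivative ?J (at x)))"
  have x: "?x \<in> U" by (rule coord_in_U[OF q(1,3)])
  have pos: "?\<delta> (coord c' q) > 0" using A cA c' q by (auto simp: oriented_manifold_def)
  have oO: "open ?O" by (rule open_overlap[OF cf(1) charts(1)])
  have sJ: "smooth_on ?O ?J" using cf(3) by (simp add: smoothly_compatible_def)
  have s\<delta>: "smooth_on ?O ?\<delta>"
    unfolding matrix_def
    by (intro smooth_on_det oO) (simp add: smooth_on_vec_nth[OF oO smooth_on_frechet[OF sJ]])
  have qO: "coord c' q \<in> ?O" using q by blast
  have d1: "((\<lambda>x. area_density g f \<nu> c d (?J x)) has_derivative (\<lambda>v. rho ?x * frechet_derivative area (at ?x) (transition_deriv c' c q v))) (at (coord c' q))"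
    by (rule has_derivative_compose[OF transition_has_derivative[OF cf(1) charts(1) cf(3) q(2,1)]])
       (unfold transition_coord[OF cf(1) q(2), of c], rule area_density_derivative[OF x 0])
  define W where "W = chart_dom c' \<inter> (chart_dom c \<inter> f -` chart_dom d) \<inter> f -` chart_dom d'"
  have "open W"
  proof -
    have "open (chart_dom c' \<inter> f -` chart_dom d')"
      using continuous_on_subset[OF continuous_f dom_carrier[OF c']] cf by (intro continuous_open_preimage) (auto simp: is_chart_def)
    then have "open ((chart_dom c \<inter> f -` chart_dom d) \<inter> (chart_dom c' \<inter> f -` chart_dom d'))" using open_dom by blast
    then show ?thesis unfolding W_def by (simp add: Int_ac)
  qed
  then have oW: "open (coord c' ` W)" by (rule open_coord_image[OF cf(1)]) (auto simp: W_def)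
  have "((\<lambda>x. ?\<delta> x * area_density g f \<nu> c d (?J x)) has_derivative
      (\<lambda>v. ?\<delta> (coord c' q) * (rho ?x * frechet_derivative area (at ?x) (transition_deriv c' c q v)) +
        frechet_derivative ?\<delta> (at (coord c' q)) v * area_density g f \<nu> c d (?J (coord c' q)))) (at (coord c' q))"
    by (rule has_derivative_mult[OF smooth_on_has_derivative[OF oO s\<delta> qO] d1])
  then have "(area_density g f \<nu> c' d' has_derivative
      (\<lambda>v. ?\<delta> (coord c' q) * (rho ?x * frechet_derivative area (at ?x) (transition_deriv c' c q v)) +
        frechet_derivative ?\<delta> (at (coord c' q)) v * area_density g f \<nu> c d (?J (coord c' q)))) (at (coord c' q))"
  proof (rule has_derivative_transform_within_open[OF _ oW])
    show "coord c' q \<in> coord c' ` W" using q by (auto simp: W_def)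
    fix x assume "x \<in> coord c' ` W"
    then obtain r where r: "x = coord c' r" "r \<in> chart_dom c" "r \<in> chart_dom c'" "f r \<in> chart_dom d" "f r \<in> chart_dom d'"
      by (auto simp: W_def)
    show "?\<delta> x * area_density g f \<nu> c d (?J x) = area_density g f \<nu> c' d' x"
      using area_density_change[OF c' d' r(2-5)] transition_coord[OF cf(1) r(3), of c] by (simp add: r(1))
  qed
  from fun_cong[OF frechet_derivative_at[OF this], of v]
  have "frechet_derivative (area_density g f \<nu> c' d') (at (coord c' q)) v =
      ?\<delta> (coord c' q) * rho ?x * frechet_derivative area (at ?x) (transition_deriv c' c q v)"
    using area_density_eq[OF x] 0 transition_coord[OF cf(1) q(2), of c] by simp
  then show ?thesis using pos rho_pos[OF x] by (simp add: sgn_mult)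
qed

end

context front_chart
begin

text \<open>Extends the singular curvature, read in the chart \<open>c\<close>, off the singular
  set. Where the denominator vanishes, in particular at the peak, the value is 0 by convention, and
  limits are taken away from that set.\<close>

definition kappa :: "'n connection_comp \<Rightarrow> 3 \<Rightarrow> real ^ 2 \<Rightarrow> real" where
  "kappa \<Gamma> i x = rho x * curvature_numerator (\<lambda>x. \<Gamma> d (f (cinv c x))) i x /
     (\<bar>row i x (turn x)\<bar> * sqrt (frame i x \<bullet> (gm x *v frame i x)) ^ 3)"

text \<open>Every choice of charts, curve and null field gives the value of \<open>kappa\<close>,
  which refers to \<open>c\<close> and \<open>d\<close> only. Curve and null field are transported
  to the chart \<open>c\<close> and evaluated by \<open>singular_curve_curvature\<close>; the
  factors of the formula are matched one by one.\<close>

lemma singular_curvature_formula_eq: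
  assumes \<Gamma>: "affine_connection B \<Gamma>" and c': "c' \<in> A" and d': "d' \<in> B"
    and curve: "singular_curve A B f c' d' q \<epsilon> \<gamma>" and null_f: "null_field f c' d' \<epsilon> \<gamma> \<eta>"
    and q: "q \<in> chart_dom c" "f q \<in> chart_dom d"
    and reg: "coord c q \<in> regular i" and a: "frechet_derivative area (at (coord c q)) \<noteq> (\<lambda>_. 0)"
  shows "row i (coord c q) (turn (coord c q)) \<noteq> 0"
    "singular_curvature_formula g \<Gamma> f \<nu> c' d' \<gamma> \<eta> 0 = kappa \<Gamma> i (coord c q)"
proof -
  note cf = change_facts[OF c' d']
  let ?I0 = "{-\<epsilon><..<\<epsilon>}" and ?x = "coord c q"
  have \<epsilon>: "0 \<in> ?I0" and \<gamma>0: "\<gamma> 0 = q" and \<gamma>c': "\<And>t. t \<in> ?I0 \<Longrightarrow> \<gamma> t \<in> chart_dom c'"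
    and \<gamma>d': "\<And>t. t \<in> ?I0 \<Longrightarrow> f (\<gamma> t) \<in> chart_dom d'" and su: "smooth_on ?I0 (coord c' \<circ> \<gamma>)"
    and sing: "\<And>t. t \<in> ?I0 \<Longrightarrow> \<gamma> t \<in> singular_set A B f"
    using curve unfolding singular_curve_def by auto
  have q': "q \<in> chart_dom c'" "f q \<in> chart_dom d'" using \<gamma>c'[OF \<epsilon>] \<gamma>d'[OF \<epsilon>] \<gamma>0 by auto
  define u where "u = coord c' \<circ> \<gamma>"
  define W where "W = chart_dom c' \<inter> (chart_dom c \<inter> f -` chart_dom d)"
  have "open W" unfolding W_def using open_dom cf by (auto simp: is_chart_def)
  then have oO: "open (coord c' ` W)" by (rule open_coord_image[OF cf(1)]) (simp add: W_def)
  \<comment> \<open>The curve may leave the domain of \<open>c\<close>. Near 0 it lies in both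
    charts, and only derivatives at 0 matter.\<close>
  define I where "I = ?I0 \<inter> u -` (coord c' ` W)"
  have oI: "open I"
    unfolding I_def using smooth_on_continuous[OF su] oO by (intro continuous_open_preimage) (auto simp: u_def)
  have I0: "0 \<in> I" using \<epsilon> \<gamma>0 q q' by (auto simp: I_def u_def W_def)
  have \<gamma>I: "\<gamma> t \<in> chart_dom c" "f (\<gamma> t) \<in> chart_dom d" "\<gamma> t \<in> chart_dom c'" "f (\<gamma> t) \<in> chart_dom d'"
      "\<gamma> t \<in> singular_set A B f" if t: "t \<in> I" for t
  proof -
    have t0: "t \<in> ?I0" using t by (simp add: I_def)
    obtain r where r: "r \<in> W" "coord c' (\<gamma> t) = coord c' r" using t by (auto simp: I_def u_def)
    then have "\<gamma> t = r" using cinv_coord[OF cf(1)] \<gamma>c'[OF t0] by (metis IntD1 W_def)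
    then show "\<gamma> t \<in> chart_dom c" "f (\<gamma> t) \<in> chart_dom d" using r by (auto simp: W_def)
    show "\<gamma> t \<in> chart_dom c'" "f (\<gamma> t) \<in> chart_dom d'" "\<gamma> t \<in> singular_set A B f"
      using \<gamma>c'[OF t0] \<gamma>d'[OF t0] sing[OF t0] by auto
  qed
  have suI: "smooth_on I u" unfolding u_def by (rule smooth_on_subset[OF su]) (simp add: I_def)
  define v where "v t = coord c (\<gamma> t)" for t
  have v0: "v 0 = ?x" by (simp add: v_def \<gamma>0)
  have uv: "transition c' c (u t) = v t" if "t \<in> I" for t
    using transition_coord[OF cf(1) \<gamma>I(3)[OF that], of c] by (simp add: u_def v_def)
  have sT: "smooth_on (coord c' ` (chart_dom c' \<inter> chart_dom c)) (transition c' c)"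
    using cf(3) by (simp add: smoothly_compatible_def)
  have sv: "smooth_on I v"
  proof (rule smooth_on_cong[OF oI _ uv])
    show "smooth_on I (\<lambda>t. transition c' c (u t))"
      by (rule smooth_on_compose[OF oI open_overlap[OF cf(1) charts(1)] sT suI]) (auto simp: I_def W_def)
  qed
  let ?J = "transition_deriv c' c q"
  have lJ: "linear ?J" by (rule transition_deriv_linear[OF cf(1) charts(1) cf(3) q'(1) q(1)])
  have pos: "det (matrix ?J) > 0" using A cA c' q q' by (auto simp: oriented_manifold_def)
  define u1 where "u1 = vector_derivative u (at 0)"
  have uD: "(u has_vector_derivative u1) (at 0)"
    unfolding u1_def using smooth_on_differentiable[OF oI suI I0] vector_derivative_works by blast
  have "(transition c' c has_derivative ?J) (at (u 0))"
    using transition_has_derivative[OF cf(1) charts(1) cf(3) q'(1) q(1)] by (simp add: u_def \<gamma>0)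
  from vector_derivative_diff_chain_within[OF uD has_derivative_at_withinI[OF this]]
  have "((\<lambda>t. transition c' c (u t)) has_vector_derivative ?J u1) (at 0)" by (simp add: o_def)
  then have "(v has_vector_derivative ?J u1) (at 0)"
    by (rule has_vector_derivative_transform_within_open[OF _ oI I0]) (rule uv)
  then have v1: "vector_derivative v (at 0) = ?J u1" by (rule vector_derivative_at)
  have vsing: "v t \<in> U \<and> area (v t) = 0" if "t \<in> I" for t
    using coord_in_U[OF \<gamma>I(1,2)[OF that]] singular_set_iff[OF \<gamma>I(1,2)[OF that]] \<gamma>I(5)[OF that] by (simp add: v_def)
  have area0: "area ?x = 0" using vsing[OF I0] v0 by simp
  have \<eta>: "frechet_derivative (local_rep c' d' f) (at (coord c' q)) (\<eta> 0) = 0" "det (vector [u1, \<eta> 0] :: real ^ 2 ^ 2) > 0"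
    using null_f \<epsilon> \<gamma>0 unfolding null_field_def u1_def u_def by auto
  have \<eta>1: "D (v 0) (?J (\<eta> 0)) = 0"
    using rep_change_kernel[OF cf(1,3,2,5) q(1) q'(1) q(2) q'(2)] \<eta>(1) by (simp add: v0)
  have \<eta>2: "det (vector [vector_derivative v (at 0), ?J (\<eta> 0)] :: real ^ 2 ^ 2) > 0"
    unfolding v1 matrix_rows_mult2[OF lJ] using pos \<eta>(2) by simp
  have bil: "bilinear (\<Gamma> d (f (cinv c (v 0))))"
    using \<Gamma> dB q cinv_coord[OF charts(1) q(1)] unfolding affine_connection_def by (simp add: v0)
  have reg': "v 0 \<in> regular i" and a': "frechet_derivative area (at (v 0)) \<noteq> (\<lambda>_. 0)"
    using reg a by (simp_all add: v0)
  note curv1 = singular_curve_curvature(1)[where \<Gamma> = "\<lambda>x. \<Gamma> d (f (cinv c x))",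
      OF oI I0 sv vsing reg' a' \<eta>1 \<eta>2 bil, unfolded v0]
  note curv2 = singular_curve_curvature(2)[where \<Gamma> = "\<lambda>x. \<Gamma> d (f (cinv c x))" and G = "gm ?x",
      OF oI I0 sv vsing reg' a' \<eta>1 \<eta>2 bil, unfolded v0]
  show "row i ?x (turn ?x) \<noteq> 0" using curv1 .
  define y where "y t = coord d (f (\<gamma> t))" for t
  define y1 where "y1 s = vector_derivative y (at s)" for s
  define y2 where "y2 = vector_derivative y1 (at 0)"
  have Fy: "(rep \<circ> v) t = y t" if "t \<in> I" for t
    using cinv_coord[OF charts(1) \<gamma>I(1)[OF that]] by (simp add: rep_def local_rep_def v_def y_def)
  have sy: "smooth_on I y"
  proof (rule smooth_on_cong[OF oI])
    show "smooth_on I (\<lambda>t. rep (v t))" by (rule smooth_on_compose[OF oI open_U smooth_F sv]) (use vsing in blast)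
  qed (use Fy in simp)
  have yD: "(y has_vector_derivative y1 s) (at s)" if "s \<in> I" for s
    unfolding y1_def using smooth_on_differentiable[OF oI sy that] vector_derivative_works by blast
  have "smooth_on I y1"
  proof (rule smooth_on_cong[OF oI smooth_on_frechet[OF sy, of 1]])
    show "frechet_derivative y (at s) 1 = y1 s" if "s \<in> I" for s
      using frechet_derivative_eq_vector_derivative[OF smooth_on_differentiable[OF oI sy that]] by (simp add: y1_def)
  qed
  then have y1D: "(y1 has_vector_derivative y2) (at 0)"
    unfolding y2_def using smooth_on_differentiable[OF oI _ I0] vector_derivative_works by blast
  have F1: "vector_derivative (rep \<circ> v) (at s) = y1 s" if "s \<in> I" for s
    unfolding y1_def by (rule vector_derivative_cong_open[OF oI that Fy])
  have F2: "vector_derivative (\<lambda>s. vector_derivative (rep \<circ> v) (at s)) (at 0) = y2"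
    unfolding y2_def by (rule vector_derivative_cong_open[OF oI I0 F1])
  define z where "z = coord d' \<circ> (f \<circ> \<gamma>)"
  let ?\<tau> = "transition d d'" and ?S = "coord d ` (chart_dom d \<inter> chart_dom d')" and ?T = "transition_deriv d d' (f q)"
  have oS: "open ?S" by (rule open_overlap[OF charts(2) cf(2)])
  have s\<tau>: "smooth_on ?S ?\<tau>" using cf(5) by (simp add: smoothly_compatible_def)
  have yS: "y s \<in> ?S" if "s \<in> I" for s using \<gamma>I(2,4)[OF that] by (auto simp: y_def)
  have zy: "?\<tau> (y s) = z s" if "s \<in> I" for s
    using transition_coord[OF charts(2) \<gamma>I(2)[OF that], of d'] by (simp add: y_def z_def)
  have z1: "vector_derivative z (at s) = frechet_derivative ?\<tau> (at (y s)) (y1 s)" if s: "s \<in> I" for s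
  proof -
    have "((\<lambda>t. ?\<tau> (y t)) has_vector_derivative frechet_derivative ?\<tau> (at (y s)) (y1 s)) (at s)"
      using vector_derivative_diff_chain_within[OF yD[OF s] has_derivative_at_withinI[OF smooth_on_has_derivative[OF oS s\<tau> yS[OF s]]]]
      by (simp add: o_def)
    then have "(z has_vector_derivative frechet_derivative ?\<tau> (at (y s)) (y1 s)) (at s)"
      by (rule has_vector_derivative_transform_within_open[OF _ oI s]) (rule zy)
    then show ?thesis by (rule vector_derivative_at)
  qed
  have y0: "y 0 = coord d (f q)" by (simp add: y_def \<gamma>0)
  have z10: "vector_derivative z (at 0) = ?T (y1 0)" using z1[OF I0] by (simp add: y0)
  \<comment> \<open>The second derivative of the image curve is not tensorial: the transition map
    contributes its own second derivative, which the transformation law of \<Gamma> absorbs in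
    \<open>acc\<close>.\<close>
  have z20: "vector_derivative (\<lambda>s. vector_derivative z (at s)) (at 0) =
      ?T y2 + frechet_derivative (\<lambda>x. frechet_derivative ?\<tau> (at x) (y1 0)) (at (coord d (f q))) (y1 0)"
  proof -
    have "((\<lambda>s. frechet_derivative ?\<tau> (at (y s)) (y1 s)) has_vector_derivative
      ?T y2 + frechet_derivative (\<lambda>x. frechet_derivative ?\<tau> (at x) (y1 0)) (at (coord d (f q))) (y1 0)) (at 0)"
      using second_derivative_along_curve[OF oS s\<tau> oI I0 yS yD[OF I0] y1D] by (simp add: y0)
    from vector_derivative_at[OF this] show ?thesis
      using vector_derivative_cong_open[OF oI I0 z1] by simp
  qed
  have lT: "linear ?T" by (rule transition_deriv_linear[OF charts(2) cf(2,5) q(2) q'(2)])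
  have "?T (\<Gamma> d (f q) (y1 0) (y1 0)) =
      frechet_derivative (\<lambda>x. frechet_derivative ?\<tau> (at x) (y1 0)) (at (coord d (f q))) (y1 0) + \<Gamma> d' (f q) (?T (y1 0)) (?T (y1 0))"
    using \<Gamma> dB d' q(2) q'(2) unfolding affine_connection_def Let_def by blast
  then have acc: "vector_derivative (\<lambda>s. vector_derivative z (at s)) (at 0) + \<Gamma> d' (f q) (?T (y1 0)) (?T (y1 0)) =
      ?T (y2 + \<Gamma> d (f q) (y1 0) (y1 0))"
    unfolding z20 by (simp add: linear_add[OF lT])
  have cq: "cinv c ?x = q" by (rule cinv_coord[OF charts(1) q(1)])
  have "singular_curvature_formula g \<Gamma> f \<nu> c' d' \<gamma> \<eta> 0 =
      sgn (frechet_derivative (area_density g f \<nu> c' d') (at (coord c' q)) (\<eta> 0)) *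
      volume_form g d' (f q) (?T (y1 0)) (?T (y2 + \<Gamma> d (f q) (y1 0) (y1 0))) (\<nu> d' q) /
      sqrt (metric g d' (f q) (?T (y1 0)) (?T (y1 0))) ^ 3"
    unfolding singular_curvature_formula_def Let_def covariant_deriv_def z_def[symmetric] z10 comp_apply[of f \<gamma>] \<gamma>0 acc ..
  also have "\<dots> = sgn (frechet_derivative area (at ?x) (?J (\<eta> 0))) *
      volume_form g d (f q) (y1 0) (y2 + \<Gamma> d (f q) (y1 0) (y1 0)) (\<nu> d q) / sqrt (metric g d (f q) (y1 0) (y1 0)) ^ 3"
    unfolding area_density_derivative_change[OF c' d' q(1) q'(1) q(2) q'(2) area0] nrm_change[OF d' q q'(2)]
      volume_change[OF d' q(2) q'(2)] ..
  also have "\<dots> = rho ?x * (sgn (frechet_derivative area (at ?x) (?J (\<eta> 0))) *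
      det (vector [y1 0, y2 + \<Gamma> d (f q) (y1 0) (y1 0), nrm ?x] :: real ^ 3 ^ 3) / sqrt (y1 0 \<bullet> (gm ?x *v y1 0)) ^ 3)"
    by (simp add: volume_form_def metric_def rho_def gm_def nrm_def cq)
  also have "\<dots> = kappa \<Gamma> i ?x"
    using curv2 unfolding F2 F1[OF I0] cq by (simp add: kappa_def)
  finally show "singular_curvature_formula g \<Gamma> f \<nu> c' d' \<gamma> \<eta> 0 = kappa \<Gamma> i ?x" .
qed

text \<open>Makes the definite description meaningful: existence comes from the normal form,
  uniqueness from the independence of all choices.\<close>

lemma singular_curvature_eq:
  assumes \<Gamma>: "affine_connection B \<Gamma>" and cusp: "cuspidal_edge A B f q"
    and q: "q \<in> chart_dom c" "f q \<in> chart_dom d"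
    and reg: "coord c q \<in> regular i" and a: "frechet_derivative area (at (coord c q)) \<noteq> (\<lambda>_. 0)"
  shows "row i (coord c q) (turn (coord c q)) \<noteq> 0" "singular_curvature A B g \<Gamma> f \<nu> q = kappa \<Gamma> i (coord c q)"
proof -
  obtain \<epsilon> \<gamma> \<eta> where cn: "singular_curve A B f c d q \<epsilon> \<gamma>" "null_field f c d \<epsilon> \<gamma> \<eta>"
    using cuspidal_edge_structure[OF cusp q] by blast
  note f1 = singular_curvature_formula_eq[OF \<Gamma> cA dB cn q reg a]
  show "row i (coord c q) (turn (coord c q)) \<noteq> 0" by (rule f1(1))
  \<comment> \<open>The fixed chart is called \<open>c0\<close> in the formula, since the
    existential quantifier binds the name \<open>c\<close>.\<close>
  have ex: "\<exists>c\<in>A. \<exists>d\<in>B. \<exists>\<epsilon> \<gamma> \<eta>. singular_curve A B f c d q \<epsilon> \<gamma> \<and> null_field f c d \<epsilon> \<gamma> \<eta> \<and>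
      kappa \<Gamma> i (coord c0 q) = singular_curvature_formula g \<Gamma> f \<nu> c d \<gamma> \<eta> 0" if "c0 = c" for c0
    using cA dB cn f1(2) that by metis
  have uniq: "k = kappa \<Gamma> i (coord c0 q)" if "c0 = c" "\<exists>c\<in>A. \<exists>d\<in>B. \<exists>\<epsilon> \<gamma> \<eta>. singular_curve A B f c d q \<epsilon> \<gamma> \<and>
      null_field f c d \<epsilon> \<gamma> \<eta> \<and> k = singular_curvature_formula g \<Gamma> f \<nu> c d \<gamma> \<eta> 0" for k c0
    using that singular_curvature_formula_eq(2)[OF \<Gamma> _ _ _ _ q reg a] by blast
  show "singular_curvature A B g \<Gamma> f \<nu> q = kappa \<Gamma> i (coord c q)"
    unfolding singular_curvature_def by (rule the_equality) (rule ex[OF refl], rule uniq[OF refl])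
qed

section \<open>The limit at the peak\<close>

lemma continuous_connection:
  assumes \<Gamma>: "affine_connection B \<Gamma>"
  shows "continuous_on U (\<lambda>x. \<Gamma> d (f (cinv c x)) X Y)"
proof (rule continuous_on_eq)
  have "smooth_on (coord d ` chart_dom d) (\<lambda>x. \<Gamma> d (cinv d x) X Y)"
    using \<Gamma> dB by (auto simp: affine_connection_def)
  from smooth_on_compose[OF open_U open_target this smooth_F rep_in]
  show "continuous_on U (\<lambda>x. \<Gamma> d (cinv d (rep x)) X Y)" by (rule smooth_on_continuous)
  show "\<Gamma> d (cinv d (rep x)) X Y = \<Gamma> d (f (cinv c x)) X Y" if "x \<in> U" for x
    using cinv_coord[OF charts(2) U_D(3)[OF that]] by (simp add: rep_def local_rep_def)
qed

text \<open>The numerator has a negative limit by \<open>curvature_numerator_neg\<close>,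
  \<open>\<bar>row i z (turn z)\<bar>\<close> tends to 0 through positive values, and the remaining
  factors are continuous and positive near \<open>x\<close>.\<close>

lemma kappa_tendsto:
  assumes \<Gamma>: "affine_connection B \<Gamma>" and x: "x \<in> regular i" and 0: "area x = 0"
    and a: "frechet_derivative area (at x) \<noteq> (\<lambda>_. 0)" and r: "row i x (turn x) = 0"
  shows "filterlim (kappa \<Gamma> i) at_bot (at x within {z. row i z (turn z) \<noteq> 0})"
proof -
  let ?\<Gamma> = "\<lambda>x. \<Gamma> d (f (cinv c x))" and ?F = "at x within {z. row i z (turn z) \<noteq> 0}"
  define e where "e z = sqrt (frame i z \<bullet> (gm z *v frame i z)) ^ 3" for z
  let ?n = "\<lambda>z. - (rho z * curvature_numerator ?\<Gamma> i z / e z)"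
  have xU: "x \<in> U" using x by (rule regularD)
  have bil: "bilinear (?\<Gamma> z)" if "z \<in> U" for z
    using \<Gamma> dB U_D(3)[OF that] by (auto simp: affine_connection_def)
  have e0: "e z > 0" if "z \<in> regular i" for z
    using gm_pos[OF regularD(1)[OF that] frame_nonzero[OF that]] by (simp add: e_def)
  have sub: "regular i \<subseteq> U" by (auto simp: regular_def)
  have "continuous_on (regular i) (\<lambda>z. frame i z \<bullet> (gm z *v frame i z))"
    by (intro smooth_on_continuous smooth_on_inner smooth_on_matrix_vector smooth_frame open_regular smooth_on_subset[OF smooth_gm sub])
  then have "continuous_on (regular i) e"
    unfolding e_def by (rule continuous_on_power[OF continuous_on_real_sqrt])
  moreover have "continuous_on (regular i) rho"
    unfolding rho_def by (intro continuous_intros continuous_on_subset[OF smooth_on_continuous[OF smooth_det_gm] sub])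
  moreover have "e z \<noteq> 0" if "z \<in> regular i" for z using e0[OF that] by simp
  ultimately have "continuous_on (regular i) ?n"
    using continuous_curvature_numerator[OF bil continuous_connection[OF \<Gamma>]]
    by (intro continuous_intros) auto
  then have "isCont ?n x" using open_regular x continuous_on_eq_continuous_at by blast
  then have n: "(?n \<longlongrightarrow> ?n x) ?F" unfolding isCont_def using tendsto_within_subset by blast
  have np: "0 < ?n x"
    using curvature_numerator_neg[OF x 0 a r, of ?\<Gamma>] rho_pos[OF xU] e0[OF x]
    by (simp add: mult_pos_neg divide_neg_pos)
  have "isCont (\<lambda>z. \<bar>row i z (turn z)\<bar>) x"
    using continuous_on_rabs[OF continuous_row_turn] open_U xU by (simp add: continuous_on_eq_continuous_at)
  then have d: "((\<lambda>z. \<bar>row i z (turn z)\<bar>) \<longlongrightarrow> 0) ?F"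
    unfolding isCont_def using tendsto_within_subset[of _ _ _ UNIV] r by fastforce
  have "\<forall>\<^sub>F z in ?F. 0 < \<bar>row i z (turn z)\<bar>" by (simp add: eventually_at_filter)
  from LIM_at_top_divide[OF n np d this]
  have "filterlim (\<lambda>z. - (kappa \<Gamma> i z)) at_top ?F"
    by (simp add: kappa_def e_def mult.commute)
  then show ?thesis unfolding filterlim_uminus_at_bot .
qed

theorem singular_curvature_tendsto:
  assumes \<Gamma>: "affine_connection B \<Gamma>" and p: "p \<in> chart_dom c" "f p \<in> chart_dom d"
    and sing: "p \<in> singular_set A B f" and ncusp: "\<not> cuspidal_edge A B f p"
    and nd: "frechet_derivative (area_density g f \<nu> c d) (at (coord c p)) \<noteq> (\<lambda>_. 0)"
  shows "filterlim (singular_curvature A B g \<Gamma> f \<nu>) at_bot (at p within {q. cuspidal_edge A B f q})"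
proof -
  let ?x = "coord c p"
  have xU: "?x \<in> U" by (rule coord_in_U[OF p])
  have 0: "area ?x = 0" using sing singular_set_iff[OF p] by simp
  have a: "frechet_derivative area (at ?x) \<noteq> (\<lambda>_. 0)"
  proof
    assume z: "frechet_derivative area (at ?x) = (\<lambda>_. 0)"
    from frechet_derivative_at[OF area_density_derivative[OF xU 0]] nd show False by (simp add: z)
  qed
  obtain i where i: "null i ?x \<noteq> 0" using nonzero_row[OF xU a] by blast
  have reg: "?x \<in> regular i" using xU i by (simp add: regular_def)
  \<comment> \<open>As \<open>p\<close> is not a cuspidal edge, its null vector is tangent to the
    singular curve and so a multiple of \<open>turn\<close>; the factor is nonzero because the null
    vector is.\<close>
  have r: "row i ?x (turn ?x) = 0"
  proof -
    have "frechet_derivative area (at ?x) (null i ?x) = 0"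
      using cuspidal_edgeI[OF p 0 D_null[OF xU 0]] ncusp by blast
    then obtain k where k: "null i ?x = k *\<^sub>R turn ?x" using singular_tangent[OF xU a] by blast
    then have "k * row i ?x (turn ?x) = 0" using row_null[OF xU, of i] by (simp add: linear_cmul[OF linear_row[OF xU]])
    then show ?thesis using i k by auto
  qed
  \<comment> \<open>The row and the derivative of \<open>area\<close> stay nonzero near
    \<open>p\<close>, so the single index \<open>i\<close> serves for all cuspidal edges close to
    \<open>p\<close>.\<close>
  define R where "R = regular i \<inter> turn -` (- {0})"
  have oR: "open R"
    unfolding R_def using continuous_on_subset[OF smooth_on_continuous[OF smooth_turn], of "regular i"]
    by (intro continuous_open_preimage open_regular) (auto simp: regular_def)
  have turn0: "turn z = 0 \<longleftrightarrow> frechet_derivative area (at z) = (\<lambda>_. 0)" if "z \<in> U" for z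
  proof
    assume "turn z = 0"
    then have "frechet_derivative area (at z) (axis 1 1) = 0" "frechet_derivative area (at z) (axis 2 1) = 0"
      by (simp_all add: turn_def vec_eq_iff forall_2)
    then show "frechet_derivative area (at z) = (\<lambda>_. 0)"
      using area_deriv[OF that] by (intro ext) (metis add.right_neutral mult_zero_right)
  qed (simp add: turn_def vec_eq_iff forall_2)
  have xR: "?x \<in> R" using reg a turn0[OF xU] by (simp add: R_def)
  define V where "V = cinv c ` R"
  have RU: "R \<subseteq> U" by (auto simp: R_def regular_def)
  have oV: "open V"
    unfolding V_def by (rule open_cinv_image[OF charts(1) oR]) (use RU U_iff in blast)
  have pV: "p \<in> V" unfolding V_def using xR cinv_coord[OF charts(1) p(1)] by force
  have eq: "row i (coord c q) (turn (coord c q)) \<noteq> 0" "singular_curvature A B g \<Gamma> f \<nu> q = kappa \<Gamma> i (coord c q)"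
    if "q \<in> V" "cuspidal_edge A B f q" for q
  proof -
    obtain z where z: "z \<in> R" "q = cinv c z" using \<open>q \<in> V\<close> by (auto simp: V_def)
    have zU: "z \<in> U" using z RU by blast
    have "coord c q \<in> regular i" "frechet_derivative area (at (coord c q)) \<noteq> (\<lambda>_. 0)"
      using z turn0[OF zU] U_D(2)[OF zU] by (auto simp: R_def)
    from singular_curvature_eq[OF \<Gamma> that(2) _ _ this]
    show "row i (coord c q) (turn (coord c q)) \<noteq> 0" "singular_curvature A B g \<Gamma> f \<nu> q = kappa \<Gamma> i (coord c q)"
      using U_D(1,3)[OF zU] z(2) by auto
  qed
  let ?F = "at p within {q. cuspidal_edge A B f q}"
  have ev: "\<forall>\<^sub>F q in ?F. q \<in> V \<and> cuspidal_edge A B f q"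
    unfolding eventually_at_filter using eventually_nhds_in_open[OF oV pV] by (rule eventually_mono) simp
  have "isCont (coord c) p"
    using charts(1) p(1) unfolding is_chart_def homeomorphism_def by (metis continuous_on_eq_continuous_at)
  then have "(coord c \<longlongrightarrow> ?x) ?F" unfolding isCont_def using tendsto_within_subset by blast
  \<comment> \<open>The approach must also avoid the limit point; it does, since the quantity that
    is nonzero along it vanishes at \<open>?x\<close> by \<open>r\<close>.\<close>
  moreover have "\<forall>\<^sub>F q in ?F. coord c q \<in> {z. row i z (turn z) \<noteq> 0} \<and> coord c q \<noteq> ?x"
      proof (rule eventually_mono[OF ev])
    fix q assume "q \<in> V \<and> cuspidal_edge A B f q"
    then have "row i (coord c q) (turn (coord c q)) \<noteq> 0" using eq(1) by blast
    then show "coord c q \<in> {z. row i z (turn z) \<noteq> 0} \<and> coord c q \<noteq> ?x" using r by auto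
  qed
  ultimately have "filterlim (coord c) (at ?x within {z. row i z (turn z) \<noteq> 0}) ?F"
    by (simp add: filterlim_at)
  from filterlim_compose[OF kappa_tendsto[OF \<Gamma> reg 0 a r] this]
  have "filterlim (\<lambda>q. kappa \<Gamma> i (coord c q)) at_bot ?F" .
  moreover have "\<forall>\<^sub>F q in ?F. kappa \<Gamma> i (coord c q) = singular_curvature A B g \<Gamma> f \<nu> q"
    using ev by (rule eventually_mono) (simp add: eq(2))
  ultimately show ?thesis by (rule filterlim_cong[OF refl refl, THEN iffD1, rotated])
qed

end

theorem corollary1p14:
  fixes A :: "('m::{t2_space,second_countable_topology}, 2) chart set"
    and B :: "('n::{t2_space,second_countable_topology}, 3) chart set"
    and g :: "'n metric_comp"
    and \<Gamma> :: "'n connection_comp"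
    and f :: "'m \<Rightarrow> 'n"
    and \<nu> :: "('m, 'n) field_along"
    and p :: 'm
  assumes "oriented_manifold A"
    and "oriented_manifold B"
    and "riemannian_metric B g"
    and "levi_civita B g \<Gamma>"
    and "front A B g f \<nu>"
    and "non_degenerate_peak A B g f \<nu> p"
  shows "filterlim (singular_curvature A B g \<Gamma> f \<nu>) at_bot (at p within {q. cuspidal_edge A B f q})"
proof -
  have p: "p \<in> singular_set A B f" "\<not> cuspidal_edge A B f p"
    using assms(6) by (auto simp: non_degenerate_peak_def peak_def)
  \<comment> \<open>The charts that witness nondegeneracy are the ones in which everything is
    computed.\<close>
  obtain c d where cd: "c \<in> A" "d \<in> B" "p \<in> chart_dom c" "f p \<in> chart_dom d"
    and nd: "frechet_derivative (area_density g f \<nu> c d) (at (coord c p)) \<noteq> (\<lambda>_. 0)"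
    using assms(6) unfolding non_degenerate_peak_def non_degenerate_def by blast
  interpret front_chart A B g f \<nu> c d
    by unfold_locales (use assms cd in auto)
  have "affine_connection B \<Gamma>" using assms(4) by (simp add: levi_civita_def)
  then show ?thesis by (rule singular_curvature_tendsto[OF _ cd(3,4) p nd])
qed

end
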